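(* Let $G$ be a discrete group for which the normalizer condition holds and such that, for every prime $p$, the $p$-torsion subgroup $T_p$ of $G$ is locally finite. Suppose that there exists a finite-dimensional model for $\underline{\mathrm{B}}G$. Then $\underline{\mathrm{B}}G\simeq\mathrm{B}\bigl(G/\prod_{p\text{ prime}}T_p\bigr)$, where $\prod_{p}T_p$ denotes the (normal) subgroup of all elements of finite order of $G$.
   Context: A group $G$ satisfies the normalizer condition if every proper subgroup of $G$ is distinct from its normalizer. In such a group, for every prime $p$ the elements whose order is a power of $p$ form a normal subgroup $T_p$ (the $p$-torsion subgroup), and the elements of finite order form a normal subgroup that is the (restricted) direct product of the $T_p$ over all primes $p$. For a discrete group $G$, a model for $\underline{\mathrm{E}}G$ is a $G$-CW-complex $Y$ all of whose isotropy groups are finite and such that for every finite subgroup $H\le G$ the fixed-point space $Y^H$ is contractible; it is unique up to $G$-homotopy equivalence. $\underline{\mathrm{B}}G$ (the classifying space for proper $G$-bundles) is the quotient $\underline{\mathrm{E}}G/G$, well defined up to homotopy equivalence; a model for $\underline{\mathrm{B}}G$ is a CW-complex of this homotopy type. *)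

theory Defs
  imports
    "HOL-Algebra.Group_Action" "HOL-Algebra.Left_Coset" "HOL-Algebra.Elementary_Groups"
    "HOL-Algebra.Multiplicative_Group" "HOL-Analysis.Analysis"
begin

section \<open>Group theory\<close>

definition normalizer_condition :: "('g, 'm) monoid_scheme \<Rightarrow> bool" where
  "normalizer_condition G \<longleftrightarrow> (\<forall>H. subgroup H G \<and> H \<noteq> carrier G \<longrightarrow> normalizer G H \<noteq> H)"

text \<open>The library's \<open>group.ord\<close> is \<open>0\<close> on elements of infinite order, so the first set below
  consists of elements of finite order.\<close>

definition p_torsion :: "('g, 'm) monoid_scheme \<Rightarrow> nat \<Rightarrow> 'g set" where
  "p_torsion G p = {x \<in> carrier G. \<exists>k::nat. group.ord G x = p ^ k}"

definition torsion :: "('g, 'm) monoid_scheme \<Rightarrow> 'g set" where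
  "torsion G = {x \<in> carrier G. \<exists>n::nat. 0 < n \<and> x [^]\<^bsub>G\<^esub> n = \<one>\<^bsub>G\<^esub>}"

definition locally_finite_subgroup :: "('g, 'm) monoid_scheme \<Rightarrow> 'g set \<Rightarrow> bool" where
  "locally_finite_subgroup G H \<longleftrightarrow> (\<forall>S. finite S \<and> S \<subseteq> H \<longrightarrow> finite (generate G S))"


section \<open>Spaces with an action of a discrete group\<close>

text \<open>An action in the sense of the library's \<open>group_action\<close> is a homomorphism into \<open>BijGroup\<close>;
  in particular each \<open>\<alpha> g\<close> is extensional, i.e. \<open>undefined\<close> outside the space.\<close>

definition G_space :: "('g, 'm) monoid_scheme \<Rightarrow> 'x topology \<Rightarrow> ('g \<Rightarrow> 'x \<Rightarrow> 'x) \<Rightarrow> bool" where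
  "G_space G X \<alpha> \<longleftrightarrow>
     group_action G (topspace X) \<alpha> \<and> (\<forall>g\<in>carrier G. continuous_map X X (\<alpha> g))"

definition fixed_points ::
    "'x topology \<Rightarrow> ('g \<Rightarrow> 'x \<Rightarrow> 'x) \<Rightarrow> 'g set \<Rightarrow> 'x set" where
  "fixed_points X \<alpha> H = {x \<in> topspace X. \<forall>h\<in>H. \<alpha> h x = x}"

definition orbit_space ::
    "('g, 'm) monoid_scheme \<Rightarrow> 'x topology \<Rightarrow> ('g \<Rightarrow> 'x \<Rightarrow> 'x) \<Rightarrow> 'x set topology" where
  "orbit_space G X \<alpha> = topology (\<lambda>U. U \<subseteq> orbits G (topspace X) \<alpha> \<and>
     openin X {x \<in> topspace X. orbit G \<alpha> x \<in> U})"

lemma openin_orbit_space: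
  "openin (orbit_space G X \<alpha>) U \<longleftrightarrow>
     U \<subseteq> orbits G (topspace X) \<alpha> \<and> openin X {x \<in> topspace X. orbit G \<alpha> x \<in> U}"
proof -
  have "istopology (\<lambda>U. U \<subseteq> orbits G (topspace X) \<alpha> \<and>
      openin X {x \<in> topspace X. orbit G \<alpha> x \<in> U})"
    unfolding istopology_def
  proof (intro conjI allI impI)
    fix S T
    assume "S \<subseteq> orbits G (topspace X) \<alpha> \<and> openin X {x \<in> topspace X. orbit G \<alpha> x \<in> S}"
      and "T \<subseteq> orbits G (topspace X) \<alpha> \<and> openin X {x \<in> topspace X. orbit G \<alpha> x \<in> T}"
    moreover have "{x \<in> topspace X. orbit G \<alpha> x \<in> S \<inter> T} =
        {x \<in> topspace X. orbit G \<alpha> x \<in> S} \<inter> {x \<in> topspace X. orbit G \<alpha> x \<in> T}" by auto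
    ultimately show "S \<inter> T \<subseteq> orbits G (topspace X) \<alpha>"
      "openin X {x \<in> topspace X. orbit G \<alpha> x \<in> S \<inter> T}" by auto
  next
    fix K
    assume *: "\<forall>S\<in>K. S \<subseteq> orbits G (topspace X) \<alpha> \<and>
      openin X {x \<in> topspace X. orbit G \<alpha> x \<in> S}"
    have "{x \<in> topspace X. orbit G \<alpha> x \<in> \<Union>K} =
        (\<Union>S\<in>K. {x \<in> topspace X. orbit G \<alpha> x \<in> S})" by auto
    with * show "\<Union>K \<subseteq> orbits G (topspace X) \<alpha>"
      "openin X {x \<in> topspace X. orbit G \<alpha> x \<in> \<Union>K}" by auto
  qed
  then show ?thesis by (simp add: orbit_space_def)
qed

lemma topspace_orbit_space: "topspace (orbit_space G X \<alpha>) = orbits G (topspace X) \<alpha>"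
proof -
  have "{x \<in> topspace X. orbit G \<alpha> x \<in> orbits G (topspace X) \<alpha>} = topspace X"
    by (auto simp: orbits_def)
  then have "openin (orbit_space G X \<alpha>) (orbits G (topspace X) \<alpha>)"
    by (simp add: openin_orbit_space)
  then show ?thesis
    by (metis openin_orbit_space openin_subset openin_topspace subset_antisym)
qed

lemma quotient_map_orbit: "quotient_map X (orbit_space G X \<alpha>) (orbit G \<alpha>)"
  unfolding quotient_map_def
  by (auto simp: openin_orbit_space topspace_orbit_space orbits_def)


section \<open>Equivariant CW-complexes\<close>

text \<open>\<open>D\<^sup>n\<close>, \<open>S\<^sup>n\<^sup>-\<^sup>1\<close> and the open disc, inside the library's model of \<open>\<real>\<^sup>n\<close> as sequences supported on
  \<open>{..<n}\<close>. For \<open>n = 0\<close> the disc is a point and the sphere is empty.\<close>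

definition disc :: "nat \<Rightarrow> (nat \<Rightarrow> real) topology" where
  "disc n = subtopology (Euclidean_space n) {x. (\<Sum>i<n. (x i)\<^sup>2) \<le> 1}"

definition disc_boundary :: "nat \<Rightarrow> (nat \<Rightarrow> real) set" where
  "disc_boundary n = {x \<in> topspace (disc n). (\<Sum>i<n. (x i)\<^sup>2) = 1}"

definition disc_interior :: "nat \<Rightarrow> (nat \<Rightarrow> real) set" where
  "disc_interior n = {x \<in> topspace (disc n). (\<Sum>i<n. (x i)\<^sup>2) < 1}"

text \<open>The space \<open>G/H \<times> D\<^sup>n\<close>, on which \<open>G\<close> acts by left translation of the first factor.\<close>

definition cell_space ::
    "('g, 'm) monoid_scheme \<Rightarrow> nat \<Rightarrow> 'g set \<Rightarrow> ('g set \<times> (nat \<Rightarrow> real)) topology" where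
  "cell_space G n H = prod_topology (discrete_topology (lcosets\<^bsub>G\<^esub> H)) (disc n)"

text \<open>\<open>B\<close> arises from \<open>A\<close> by attaching equivariant \<open>n\<close>-cells, i.e. for some family of subgroups
  \<open>H\<close> of \<open>G\<close> and \<open>G\<close>-maps \<open>\<Phi> : G/H \<times> D\<^sup>n \<rightarrow> B\<close> there is a pushout square
  \<open>\<Coprod> G/H \<times> S\<^sup>n\<^sup>-\<^sup>1 \<rightarrow> A\<close>, \<open>\<Coprod> G/H \<times> D\<^sup>n \<rightarrow> B\<close>. The \<open>bij_betw\<close> condition says that the square is a pushout of
  sets, and the last condition that \<open>B\<close> carries the pushout topology. The family is indexed by the
  pairs \<open>(H, \<Phi>)\<close> themselves; this is no restriction, because distinct cells have disjoint nonempty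
  interiors and hence distinct characteristic maps.\<close>

definition attaches_cells ::
    "('g, 'm) monoid_scheme \<Rightarrow> 'x topology \<Rightarrow> ('g \<Rightarrow> 'x \<Rightarrow> 'x) \<Rightarrow> nat \<Rightarrow> 'x set \<Rightarrow> 'x set \<Rightarrow> bool"
  where
  "attaches_cells G X \<alpha> n A B \<longleftrightarrow> A \<subseteq> B \<and>
     (\<exists>C :: ('g set \<times> ('g set \<times> (nat \<Rightarrow> real) \<Rightarrow> 'x)) set.
        (\<forall>(H, \<Phi>)\<in>C.
           subgroup H G \<and>
           continuous_map (cell_space G n H) (subtopology X B) \<Phi> \<and>
           (\<forall>g\<in>carrier G. \<forall>c\<in>lcosets\<^bsub>G\<^esub> H. \<forall>x\<in>topspace (disc n).
              \<Phi> (g <#\<^bsub>G\<^esub> c, x) = \<alpha> g (\<Phi> (c, x))) \<and>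
           \<Phi> ` ((lcosets\<^bsub>G\<^esub> H) \<times> disc_boundary n) \<subseteq> A) \<and>
        bij_betw (\<lambda>((H, \<Phi>), z). \<Phi> z)
          (SIGMA (H, \<Phi>):C. (lcosets\<^bsub>G\<^esub> H) \<times> disc_interior n) (B - A) \<and>
        (\<forall>S\<subseteq>B. closedin (subtopology X B) S \<longleftrightarrow>
           closedin (subtopology X A) (S \<inter> A) \<and>
           (\<forall>(H, \<Phi>)\<in>C. closedin (cell_space G n H)
              {z \<in> topspace (cell_space G n H). \<Phi> z \<in> S})))"

text \<open>\<open>F n\<close> is the \<open>(n - 1)\<close>-skeleton, so the filtration starts with the empty set and
  \<open>F (n + 1)\<close> arises from \<open>F n\<close> by attaching \<open>n\<close>-cells. The last two conditions say that \<open>X\<close> is the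
  colimit of the filtration.\<close>

definition CW_filtration ::
    "('g, 'm) monoid_scheme \<Rightarrow> 'x topology \<Rightarrow> ('g \<Rightarrow> 'x \<Rightarrow> 'x) \<Rightarrow> (nat \<Rightarrow> 'x set) \<Rightarrow> bool" where
  "CW_filtration G X \<alpha> F \<longleftrightarrow>
     F 0 = {} \<and>
     (\<forall>n. \<forall>g\<in>carrier G. \<alpha> g ` F n \<subseteq> F n) \<and>
     (\<forall>n. attaches_cells G X \<alpha> n (F n) (F (Suc n))) \<and>
     (\<Union>n. F n) = topspace X \<and>
     (\<forall>S\<subseteq>topspace X. closedin X S \<longleftrightarrow> (\<forall>n. closedin (subtopology X (F n)) (S \<inter> F n)))"

definition G_CW_complex ::
    "('g, 'm) monoid_scheme \<Rightarrow> 'x topology \<Rightarrow> ('g \<Rightarrow> 'x \<Rightarrow> 'x) \<Rightarrow> bool" where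
  "G_CW_complex G X \<alpha> \<longleftrightarrow> G_space G X \<alpha> \<and> (\<exists>F. CW_filtration G X \<alpha> F)"

text \<open>A (non-equivariant) CW-complex is a \<open>G\<close>-CW-complex for the trivial group.\<close>

definition finite_dim_CW_complex :: "'x topology \<Rightarrow> bool" where
  "finite_dim_CW_complex X \<longleftrightarrow>
     (\<exists>F n. CW_filtration (singleton_group ()) X (\<lambda>_. \<lambda>x\<in>topspace X. x) F \<and> F n = topspace X)"


section \<open>Classifying spaces\<close>

text \<open>The library regards the empty space as contractible, hence the explicit nonemptiness
  conditions.\<close>

definition proper_EG_model ::
    "('g, 'm) monoid_scheme \<Rightarrow> 'x topology \<Rightarrow> ('g \<Rightarrow> 'x \<Rightarrow> 'x) \<Rightarrow> bool" where
  "proper_EG_model G Y \<alpha> \<longleftrightarrow>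
     G_CW_complex G Y \<alpha> \<and>
     (\<forall>y\<in>topspace Y. finite (stabilizer G \<alpha> y)) \<and>
     (\<forall>H. subgroup H G \<and> finite H \<longrightarrow>
        fixed_points Y \<alpha> H \<noteq> {} \<and> contractible_space (subtopology Y (fixed_points Y \<alpha> H)))"

text \<open>A model for \<open>EG\<close>: a contractible free \<open>G\<close>-CW-complex, with orbit space \<open>BG\<close>.\<close>

definition EG_model ::
    "('g, 'm) monoid_scheme \<Rightarrow> 'x topology \<Rightarrow> ('g \<Rightarrow> 'x \<Rightarrow> 'x) \<Rightarrow> bool" where
  "EG_model G Z \<beta> \<longleftrightarrow>
     G_CW_complex G Z \<beta> \<and>
     (\<forall>z\<in>topspace Z. stabilizer G \<beta> z = {\<one>\<^bsub>G\<^esub>}) \<and>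
     topspace Z \<noteq> {} \<and> contractible_space Z"

end

theory Submission
  imports Defs "HOL-Algebra.SndIsomorphismGrp"
begin

text \<open>Let \<open>T\<close> be the set of elements of finite order and \<open>Q = G/T\<close>. In a group with the normalizer
  condition every maximal \<open>p\<close>-subgroup is normal, so \<open>T\<close> is a normal subgroup, the restricted product
  of the \<open>T\<^sub>p\<close>, and it is locally finite because the \<open>T\<^sub>p\<close> are. Let \<open>Y\<close> be a model for the proper
  classifying space and \<open>Z\<close> one for \<open>EQ\<close>. Stabilizers in \<open>Y\<close> are finite, hence contained in \<open>T\<close>,
  so \<open>Q\<close> acts on \<open>Y/T\<close> with orbit space \<open>Y/G\<close>, and it suffices that \<open>Y/T\<close> is contractible in a weak
  sense. A map from a compact space to \<open>Y/T\<close> meets only finitely many cells and lifts to \<open>Y/F\<close> for some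
  finite \<open>F \<le> T\<close>, and \<open>Y\<close> contracts \<open>F\<close>-equivariantly to a point. Equivariant obstruction theory, cell
  by cell, then gives equivariant maps \<open>Y \<rightarrow> Z\<close> and \<open>Z \<rightarrow> Y/T\<close> whose composites are equivariantly
  homotopic to the identity of \<open>Z\<close> and to the projection \<open>Y \<rightarrow> Y/T\<close>; passing to orbit spaces gives the
  homotopy equivalence.\<close>

section \<open>Torsion in groups with the normalizer condition\<close>

text \<open>The obstacle is that \<open>T\<close> may be infinite. Then no point of \<open>Y\<close>
  is fixed by \<open>T\<close>, since stabilizers are finite, and no equivariant map can lead from
  \<open>Z\<close> back to \<open>Y\<close>; the return map can reach \<open>Y/T\<close> only.
  Contractibility of \<open>Y/T\<close> is asked for compact test spaces alone. Cells are attached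
  along compact boundaries, so nullhomotopies of maps from compact spaces are all that an extension
  over a cell consumes, and compactness is what allows a lift to some \<open>Y/F\<close>. Local
  finiteness enters there: finitely many elements of \<open>T\<close> identify points of a finite
  subcomplex, and they have to generate a finite group \<open>F\<close> before fixed points of
  finite subgroups can be used. Cell structures are used on \<open>Y\<close> and \<open>Z\<close>,
  and none is constructed on \<open>Y/T\<close>. For this reason the second homotopy is built on
  \<open>Y\<close> and compared with the projection; it descends to \<open>Y/G\<close> all the
  same.\<close>

context group
begin

text \<open>Divisors of a prime power are again powers of that prime, so one equation replaces the
  exact order, which is harder to follow through products.\<close>

lemma mem_p_torsion_iff:
  assumes "Factorial_Ring.prime (p::nat)"
  shows "x \<in> p_torsion G p \<longleftrightarrow> x \<in> carrier G \<and> (\<exists>k::nat. x [^] (p ^ k) = \<one>)"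
  unfolding p_torsion_def using divides_primepow_nat[OF assms] pow_eq_id by blast

lemma torsion_iff_ord: "x \<in> torsion G \<longleftrightarrow> x \<in> carrier G \<and> ord x \<noteq> 0"
proof (cases "x \<in> carrier G")
  case True
  then show ?thesis using ord_eq_0[of x] by (auto simp only: torsion_def)
qed (simp add: torsion_def)

lemma inv_cancel_left:
  assumes "x \<in> carrier G" "y \<in> carrier G"
  shows "inv x \<otimes> (x \<otimes> y) = y" "x \<otimes> (inv x \<otimes> y) = y"
  using assms m_assoc[of "inv x" x y] m_assoc[of x "inv x" y] by simp_all

lemma p_torsion_subset_torsion:
  assumes "Factorial_Ring.prime (p::nat)"
  shows "p_torsion G p \<subseteq> torsion G"
  using assms by (auto simp: p_torsion_def torsion_iff_ord)

lemma conj_pow: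
  assumes "g \<in> carrier G" "x \<in> carrier G"
  shows "(g \<otimes> x \<otimes> inv g) [^] (n::nat) = g \<otimes> x [^] n \<otimes> inv g"
proof (induction n)
  case (Suc n)
  then show ?case using assms by (simp add: m_assoc inv_cancel_left)
qed (use assms in auto)

lemma conj_p_torsion:
  assumes "Factorial_Ring.prime (p::nat)" "g \<in> carrier G" "x \<in> p_torsion G p"
  shows "g \<otimes> x \<otimes> inv g \<in> p_torsion G p"
proof -
  obtain k :: nat where "x \<in> carrier G" "x [^] (p ^ k) = \<one>"
    using assms by (auto simp: mem_p_torsion_iff)
  then show ?thesis using assms conj_pow[of g x "p ^ k"] by (auto simp: mem_p_torsion_iff)
qed

text \<open>If \<open>x ^ n = 1\<close> with \<open>n > 0\<close>, then \<open>x ^ (n - 1)\<close>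
  is the inverse of \<open>x\<close>, so closure under products already yields inverses.\<close>

lemma submonoid_of_torsion_subgroup:
  assumes "H \<subseteq> torsion G" "\<one> \<in> H" and closed: "\<And>x y. x \<in> H \<Longrightarrow> y \<in> H \<Longrightarrow> x \<otimes> y \<in> H"
  shows "subgroup H G"
proof (rule subgroupI)
  have sub: "H \<subseteq> carrier G" using assms by (auto simp: torsion_def)
  show "H \<subseteq> carrier G" by fact
  fix x assume x: "x \<in> H"
  then obtain n where n: "0 < n" "x [^] (n::nat) = \<one>" using assms by (auto simp: torsion_def)
  have pow: "x [^] k \<in> H" for k :: nat by (induction k) (use x assms in auto)
  have "x [^] (n - 1) \<otimes> x = \<one>"
    using n x sub by (metis Suc_diff_1 nat_pow_Suc)
  then have "inv x = x [^] (n - 1)"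
    using x sub by (meson inv_equality nat_pow_closed subsetD)
  then show "inv x \<in> H" using pow by simp
qed (use assms in auto)

lemma mem_normalizer_iff:
  assumes "H \<subseteq> carrier G"
  shows "g \<in> normalizer G H \<longleftrightarrow> g \<in> carrier G \<and> (\<lambda>h. g \<otimes> h \<otimes> inv g) ` H = H"
proof -
  have "g <# H #> inv g = (\<lambda>h. g \<otimes> h \<otimes> inv g) ` H"
    by (auto simp: l_coset_def r_coset_def)
  then show ?thesis using assms by (auto simp: normalizer_def stabilizer_def)
qed

text \<open>Both conjugations are required: for infinite \<open>H\<close> the inclusion of
  \<open>g H g^-1\<close> in \<open>H\<close> may be proper.\<close>

lemma normalizerI:
  assumes H: "H \<subseteq> carrier G" and g: "g \<in> carrier G"
    and "\<And>h. h \<in> H \<Longrightarrow> g \<otimes> h \<otimes> inv g \<in> H"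
    and "\<And>h. h \<in> H \<Longrightarrow> inv g \<otimes> h \<otimes> g \<in> H"
  shows "g \<in> normalizer G H"
proof -
  have "h \<in> (\<lambda>h. g \<otimes> h \<otimes> inv g) ` H" if "h \<in> H" for h
  proof
    show "h = g \<otimes> (inv g \<otimes> h \<otimes> g) \<otimes> inv g"
      using that g subsetD[OF H] by (simp add: m_assoc inv_cancel_left)
  qed (use assms that in auto)
  then show ?thesis using assms by (auto simp: mem_normalizer_iff)
qed

lemma normalizer_conj:
  assumes "subgroup H G" "g \<in> normalizer G H" "h \<in> H"
  shows "g \<otimes> h \<otimes> inv g \<in> H" "inv g \<otimes> h \<otimes> g \<in> H"
proof -
  have H: "H \<subseteq> carrier G" using assms subgroup.subset by blast
  have 1: "g \<otimes> h \<otimes> inv g \<in> H" if "g \<in> normalizer G H" for g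
    using that assms H by (auto simp: mem_normalizer_iff)
  show "g \<otimes> h \<otimes> inv g \<in> H" using 1 assms by blast
  have "inv g \<in> normalizer G H"
    using subgroup.m_inv_closed[OF normalizer_imp_subgroup[OF H] assms(2)] .
  moreover have "g \<in> carrier G" using assms(2) H by (simp add: mem_normalizer_iff)
  ultimately show "inv g \<otimes> h \<otimes> g \<in> H" using 1[of "inv g"] by simp
qed

lemma subgroup_subset_normalizer:
  assumes "subgroup H G"
  shows "H \<subseteq> normalizer G H"
proof
  fix h assume "h \<in> H"
  then show "h \<in> normalizer G H"
    using assms by (intro normalizerI) (auto intro: subgroup.m_closed subgroup.m_inv_closed
        subgroup.subset[THEN subsetD])
qed

section \<open>Maximal p-subgroups and normality of the p-torsion\<close>

lemma maximal_p_subgroup_exists: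
  assumes p: "Factorial_Ring.prime (p::nat)"
  shows "\<exists>P. subgroup P G \<and> P \<subseteq> p_torsion G p \<and>
    (\<forall>P'. subgroup P' G \<and> P' \<subseteq> p_torsion G p \<and> P \<subseteq> P' \<longrightarrow> P' = P)"
proof -
  let ?A = "{P. subgroup P G \<and> P \<subseteq> p_torsion G p}"
  \<comment> \<open>Zorn's lemma takes the place of Sylow's theorem: \<open>G\<close> may be
    infinite, but the union of a chain of p-subgroups is a p-subgroup.\<close>
  have "\<exists>M\<in>?A. \<forall>X\<in>?A. M \<subseteq> X \<longrightarrow> X = M"
  proof (rule subset_Zorn_nonempty)
    have "{\<one>} \<in> ?A" using p by (auto simp: triv_subgroup mem_p_torsion_iff)
    then show "?A \<noteq> {}" by blast
    fix \<C> assume C: "\<C> \<noteq> {}" "subset.chain ?A \<C>"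
    have "subgroup (\<Union>\<C>) G"
    proof (rule submonoid_of_torsion_subgroup)
      show "\<Union>\<C> \<subseteq> torsion G"
        using C p_torsion_subset_torsion[OF p] by (auto simp: subset.chain_def)
      show "\<one> \<in> \<Union>\<C>" using C by (auto simp: subset.chain_def dest!: subgroup.one_closed)
      fix x y assume "x \<in> \<Union>\<C>" "y \<in> \<Union>\<C>"
      then obtain X Y where XY: "X \<in> \<C>" "Y \<in> \<C>" "x \<in> X" "y \<in> Y" by blast
      then have "subgroup X G" "subgroup Y G" "X \<subseteq> Y \<or> Y \<subseteq> X"
        using C by (auto simp: subset_chain_def)
      then show "x \<otimes> y \<in> \<Union>\<C>" using XY by (meson UnionI subgroup.m_closed subsetD)
    qed
    then show "\<Union>\<C> \<in> ?A" using C by (auto simp: subset.chain_def)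
  qed
  then show ?thesis by (simp add: imp_conjL)
qed

text \<open>In the product of \<open>P\<close> with the powers of \<open>x\<close>, the
  \<open>p ^ k\<close>-th power of every element falls into \<open>P\<close> once
  \<open>x ^ (p ^ k) = 1\<close>, and from there a further power of \<open>p\<close> leads to
  \<open>\<one>\<close>.\<close>

lemma normal_p_subgroup_extend:
  assumes p: "Factorial_Ring.prime (p::nat)" and P: "subgroup P G" "P \<subseteq> p_torsion G p"
    and x: "x \<in> p_torsion G p" "x \<in> normalizer G P"
  shows "\<exists>P'. subgroup P' G \<and> P' \<subseteq> p_torsion G p \<and> P \<subseteq> P' \<and> x \<in> P'"
proof -
  \<comment> \<open>Natural exponents exhaust the cyclic group of \<open>x\<close>, because
    \<open>x\<close> has finite order.\<close>
  define P' where "P' = {h \<otimes> x [^] (i::nat) | h i. h \<in> P}"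
  interpret P: subgroup P G by fact
  have xc: "x \<in> carrier G" using x by (simp add: p_torsion_def)
  have conj: "x [^] i \<otimes> h \<otimes> inv (x [^] i) \<in> P" if "h \<in> P" for i :: nat and h
  proof -
    have "x [^] i \<in> normalizer G P"
    proof (induction i)
      case 0
      then show ?case using P.one_closed subgroup_subset_normalizer[OF P(1)] by auto
    next
      case (Suc i)
      then show ?case
        using x normalizer_imp_subgroup[OF P.subset] by (simp add: subgroup.m_closed)
    qed
    then show ?thesis using normalizer_conj[OF P(1)] that by blast
  qed
  have mult: "(h \<otimes> x [^] i) \<otimes> (h' \<otimes> x [^] j) = (h \<otimes> (x [^] i \<otimes> h' \<otimes> inv (x [^] i))) \<otimes> x [^] (i + j)"
    if "h \<in> P" "h' \<in> P" for h h' and i j :: nat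
  proof -
    have "h \<otimes> (x [^] i \<otimes> h' \<otimes> inv (x [^] i)) \<otimes> (x [^] i \<otimes> x [^] j)
       = (h \<otimes> x [^] i) \<otimes> (h' \<otimes> x [^] j)"
      using that xc by (simp add: m_assoc inv_cancel_left)
    then show ?thesis using xc by (simp add: nat_pow_mult)
  qed
  have closed: "y \<otimes> z \<in> P'" if yz: "y \<in> P'" "z \<in> P'" for y z
  proof -
    obtain h i h' j where "h \<in> P" "h' \<in> P" "y = h \<otimes> x [^] (i::nat)" "z = h' \<otimes> x [^] (j::nat)"
      using yz unfolding P'_def by blast
    then show ?thesis unfolding P'_def using mult[of h h' i j] conj P.m_closed by blast
  qed
  have pow: "\<exists>h'\<in>P. (h \<otimes> x [^] i) [^] n = h' \<otimes> x [^] (i * n)" if "h \<in> P" for h and i n :: nat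
  proof (induction n)
    case 0
    then show ?case by (auto intro!: bexI[of _ \<one>])
  next
    case (Suc n)
    then obtain h' where h': "h' \<in> P" "(h \<otimes> x [^] i) [^] n = h' \<otimes> x [^] (i * n)" by blast
    then have "(h \<otimes> x [^] i) [^] Suc n = (h' \<otimes> (x [^] (i * n) \<otimes> h \<otimes> inv (x [^] (i * n)))) \<otimes> x [^] (i * Suc n)"
      using mult[OF h'(1) that, of "i * n" i] by (simp add: add.commute)
    then show ?case using h' conj[OF that] by (meson P.m_closed)
  qed
  obtain k :: nat where k: "x [^] (p ^ k) = \<one>" using x p by (auto simp: mem_p_torsion_iff)
  have tors: "P' \<subseteq> p_torsion G p"
  proof
    fix y assume "y \<in> P'"
    then obtain h i where y: "h \<in> P" "y = h \<otimes> x [^] (i::nat)" unfolding P'_def by blast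
    obtain h' where h': "h' \<in> P" "y [^] (p ^ k) = h' \<otimes> x [^] (i * p ^ k)" using pow y by blast
    have "x [^] (i * p ^ k) = \<one>"
      using k xc by (metis mult.commute nat_pow_one nat_pow_pow)
    then have "y [^] (p ^ k) \<in> P" using h' by simp
    then obtain l :: nat where "(y [^] (p ^ k)) [^] (p ^ l) = \<one>"
      using subsetD[OF P(2)] mem_p_torsion_iff[OF p] by blast
    then have "y [^] (p ^ (k + l)) = \<one>" using y xc by (simp add: nat_pow_pow power_add)
    then show "y \<in> p_torsion G p" using y xc p by (auto simp: mem_p_torsion_iff)
  qed
  have PP': "P \<subseteq> P'" unfolding P'_def 
  proof
    fix h assume "h \<in> P"
    then have "h = h \<otimes> x [^] (0::nat)" by simp
    then show "h \<in> {h \<otimes> x [^] i |h (i::nat). h \<in> P}" using \<open>h \<in> P\<close> by blast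
  qed
  have "x = \<one> \<otimes> x [^] (1::nat)" using xc by simp
  then have xP': "x \<in> P'" unfolding P'_def using P.one_closed by blast
  have "subgroup P' G"
  proof (rule submonoid_of_torsion_subgroup)
    show "P' \<subseteq> torsion G" using tors p_torsion_subset_torsion[OF p] by (rule subset_trans)
    show "\<one> \<in> P'" using PP' P.one_closed by (rule subsetD)
    show "y \<otimes> z \<in> P'" if "y \<in> P'" "z \<in> P'" for y z
      using that by (rule closed)
  qed
  then show ?thesis using tors PP' xP' by metis
qed

text \<open>A maximal \<open>p\<close>-subgroup \<open>P\<close> contains every \<open>p\<close>-element of its normalizer \<open>N\<close>, hence is
  characteristic in \<open>N\<close>, so that \<open>N\<close> is its own normalizer.\<close>

lemma p_torsion_normal:
  assumes nc: "normalizer_condition G" and p: "Factorial_Ring.prime (p::nat)"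
  shows "p_torsion G p \<lhd> G"
proof -
  obtain P where P: "subgroup P G" "P \<subseteq> p_torsion G p"
    and max: "\<forall>P'. subgroup P' G \<and> P' \<subseteq> p_torsion G p \<and> P \<subseteq> P' \<longrightarrow> P' = P"
    using maximal_p_subgroup_exists[OF p] by metis
  have Pc: "P \<subseteq> carrier G" using P subgroup.subset by blast
  have mem: "x \<in> P" if x: "x \<in> p_torsion G p" "x \<in> normalizer G P" for x
  proof -
    obtain P' where "subgroup P' G" "P' \<subseteq> p_torsion G p" "P \<subseteq> P'" "x \<in> P'"
      using normal_p_subgroup_extend[OF p P x] by metis
    then show ?thesis using max by blast
  qed
  let ?N = "normalizer G P"
  have N: "subgroup ?N G" by (simp add: Pc normalizer_imp_subgroup)
  have "normalizer G ?N \<subseteq> ?N"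
  proof
    fix g assume g: "g \<in> normalizer G ?N"
    then have gc: "g \<in> carrier G" by (simp add: normalizer_def stabilizer_def)
    show "g \<in> ?N"
    proof (rule normalizerI[OF Pc gc])
      fix h assume h: "h \<in> P"
      then have hN: "h \<in> ?N" using subgroup_subset_normalizer[OF P(1)] by blast
      show "g \<otimes> h \<otimes> inv g \<in> P"
        using normalizer_conj[OF N g hN] conj_p_torsion[OF p gc] h P(2) mem by blast
      show "inv g \<otimes> h \<otimes> g \<in> P"
        using normalizer_conj[OF N g hN] conj_p_torsion[OF p inv_closed[OF gc], of h] h P(2) mem gc
        by auto
    qed
  qed
  \<comment> \<open>\<open>?N\<close> is self-normalizing, so it cannot be a proper subgroup. Hence
    every p-element normalizes \<open>P\<close> and lies in it by \<open>mem\<close>.\<close>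
  then have "?N = carrier G"
    using nc N subgroup_subset_normalizer[OF N] unfolding normalizer_condition_def by blast
  then have "p_torsion G p = P"
    using mem P by (auto simp: p_torsion_def)
  then show ?thesis using P conj_p_torsion[OF p] by (simp add: normal_inv_iff)
qed

section \<open>Local finiteness and normality of the torsion subgroup\<close>

lemma locally_finite_set_mult_commuting:
  assumes A: "subgroup A G" "locally_finite_subgroup G A"
    and B: "subgroup B G" "locally_finite_subgroup G B"
    and comm: "\<And>a b. a \<in> A \<Longrightarrow> b \<in> B \<Longrightarrow> a \<otimes> b = b \<otimes> a"
  shows "locally_finite_subgroup G (A <#> B)"
  unfolding locally_finite_subgroup_def
proof (intro allI impI)
  fix S assume S: "finite S \<and> S \<subseteq> A <#> B"
  interpret A: subgroup A G by fact
  interpret B: subgroup B G by fact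
  have "\<forall>s\<in>S. \<exists>a b. a \<in> A \<and> b \<in> B \<and> s = a \<otimes> b" using S by (auto simp: set_mult_def) blast
  then obtain f g where fg: "\<And>s. s \<in> S \<Longrightarrow> f s \<in> A \<and> g s \<in> B \<and> s = f s \<otimes> g s" by metis
  let ?A = "generate G (f ` S)" and ?B = "generate G (g ` S)"
  have fA: "f ` S \<subseteq> A" and gB: "g ` S \<subseteq> B" using fg by auto
  have AA: "?A \<subseteq> A" and BB: "?B \<subseteq> B"
    using generate_subgroup_incl[OF fA A(1)] generate_subgroup_incl[OF gB B(1)] by auto
  have sA: "subgroup ?A G" and sB: "subgroup ?B G"
    by (auto intro!: generate_is_subgroup) (use fg in \<open>auto\<close>)
  have fin: "finite ?A" "finite ?B"
    using A(2) B(2) S fA gB unfolding locally_finite_subgroup_def by auto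
  have mem: "a \<otimes> b \<in> ?A <#> ?B" if "a \<in> ?A" "b \<in> ?B" for a b
    using that unfolding set_mult_def by blast
  have sub: "subgroup (?A <#> ?B) G"
  proof (rule subgroupI)
    show "?A <#> ?B \<subseteq> carrier G"
      using sA sB by (simp add: set_mult_closed subgroup.subset)
    show "?A <#> ?B \<noteq> {}" using mem[OF subgroup.one_closed[OF sA] subgroup.one_closed[OF sB]] by blast
    fix x assume "x \<in> ?A <#> ?B"
    then obtain a b where ab: "a \<in> ?A" "b \<in> ?B" "x = a \<otimes> b" by (auto simp: set_mult_def)
    have c: "a \<in> A" "b \<in> B" using ab AA BB by auto
    have "inv x = inv b \<otimes> inv a" using ab c by (simp add: inv_mult_group)
    also have "\<dots> = inv a \<otimes> inv b" using comm[of "inv a" "inv b"] c by simp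
    also have "\<dots> \<in> ?A <#> ?B"
      using subgroup.m_inv_closed[OF sA ab(1)] subgroup.m_inv_closed[OF sB ab(2)] by (rule mem)
    finally show "inv x \<in> ?A <#> ?B" .
    fix y assume "y \<in> ?A <#> ?B"
    then obtain a' b' where ab': "a' \<in> ?A" "b' \<in> ?B" "y = a' \<otimes> b'" by (auto simp: set_mult_def)
    have c': "a' \<in> A" "b' \<in> B" using ab' AA BB by auto
    have "x \<otimes> y = a \<otimes> (b \<otimes> a') \<otimes> b'" using ab ab' c c' by (simp add: m_assoc)
    also have "\<dots> = a \<otimes> (a' \<otimes> b) \<otimes> b'" using comm[of a' b] c c' by simp
    also have "\<dots> = (a \<otimes> a') \<otimes> (b \<otimes> b')"
      using c c' by (simp add: m_assoc)
    also have "\<dots> \<in> ?A <#> ?B"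
      using subgroup.m_closed[OF sA ab(1) ab'(1)] subgroup.m_closed[OF sB ab(2) ab'(2)] by (rule mem)
    finally show "x \<otimes> y \<in> ?A <#> ?B" .
  qed
  \<comment> \<open>Each element of \<open>S\<close> is a product of a generator of
    \<open>?A\<close> and one of \<open>?B\<close>, so \<open>generate G S\<close> is trapped in a
    product of two finite groups.\<close>
  have "S \<subseteq> ?A <#> ?B"
    using fg unfolding set_mult_def by (blast intro: generate.incl)
  then have "generate G S \<subseteq> ?A <#> ?B" using generate_subgroup_incl[OF _ sub] by blast
  moreover have "finite (?A <#> ?B)"
    unfolding set_mult_def using fin by simp
  ultimately show "finite (generate G S)" using finite_subset by blast
qed

text \<open>Induction on the exponent: with \<open>n = p ^ k * m\<close> and \<open>m\<close> prime
  to \<open>p\<close>, the power \<open>x ^ m\<close> is a p-element, \<open>x ^ (p ^ k)\<close> is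
  killed by the smaller exponent \<open>m\<close>, and \<open>x\<close> is a product of powers of
  these two.\<close>

lemma mem_subgroup_of_primary_parts:
  assumes P: "subgroup P G" and x: "x \<in> carrier G" "x [^] n = \<one>" "0 < n"
    and "\<And>p. Factorial_Ring.prime p \<Longrightarrow> p dvd n \<Longrightarrow> p_torsion G p \<subseteq> P"
  shows "x \<in> P"
  using x assms(5)
proof (induction n arbitrary: x rule: less_induct)
  case (less n)
  interpret P: subgroup P G by fact
  show ?case
  proof (cases "n = 1")
    case True
    then show ?thesis using less by simp
  next
    case False
    then obtain p where p: "Factorial_Ring.prime p" "p dvd n"
      using prime_factor_nat by blast
    obtain k m where km: "n = p ^ k * m" "\<not> p dvd m"
      using less.prems p by (metis multiplicity_decompose' neq0_conv not_prime_unit)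
    then have k: "0 < k" using p by (metis gr0I mult_1 power_0)
    then have m: "0 < m" "m < n"
      using km less.prems one_less_power[OF prime_gt_1_nat[OF p(1)] k] by (auto intro!: Nat.gr0I)
    have "coprime (p ^ k) m" using km p by (simp add: prime_imp_coprime)
    \<comment> \<open>Bezout coefficients may be negative, hence the integer powers below.\<close>
    then obtain u v where uv: "int (p ^ k) * u + int m * v = 1"
      by (metis bezout_int coprime_int_iff coprime_iff_gcd_eq_1 mult.commute)
    have 1: "x [^] (p ^ k) \<in> P"
    proof (rule less.IH[OF m(2)])
      show "(x [^] (p ^ k)) [^] m = \<one>" using less.prems km by (simp add: nat_pow_pow)
    qed (use less.prems m km in auto)
    have 2: "x [^] m \<in> P"
    proof -
      have "(x [^] m) [^] (p ^ k) = \<one>"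
        using less.prems km by (simp add: nat_pow_pow mult.commute)
      then have "x [^] m \<in> p_torsion G p"
        unfolding mem_p_torsion_iff[OF p(1)] using less.prems by blast
      then show ?thesis using less.prems(4)[OF p] by blast
    qed
    have "x = x [^] (int (p ^ k) * u + int m * v)" using uv less.prems by (simp add: int_pow_1)
    also have "\<dots> = (x [^] (p ^ k)) [^] u \<otimes> (x [^] m) [^] v"
      using less.prems by (simp only: int_pow_mult int_pow_pow[symmetric] int_pow_int)
    also have "\<dots> \<in> P"
      using 1 2 P by (simp add: subgroup_int_pow_closed)
    finally show ?thesis .
  qed
qed

text \<open>The subgroup is the product of the \<open>p_torsion G p\<close> over the finite set
  \<open>\<pi>\<close>. The clause on exponents is carried along for the induction: it makes the
  part built so far meet the next \<open>p_torsion G q\<close> trivially, and normal subgroups with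
  trivial intersection commute.\<close>

lemma locally_finite_normal_of_prime_set:
  assumes nc: "normalizer_condition G"
    and lf: "\<And>p::nat. Factorial_Ring.prime p \<Longrightarrow> locally_finite_subgroup G (p_torsion G p)"
    and "finite \<pi>" "\<And>p. p \<in> \<pi> \<Longrightarrow> Factorial_Ring.prime (p::nat)"
  shows "\<exists>P. P \<lhd> G \<and> locally_finite_subgroup G P \<and> (\<forall>p\<in>\<pi>. p_torsion G p \<subseteq> P) \<and>
    (\<forall>x\<in>P. \<exists>n>0. x [^] n = \<one> \<and> (\<forall>p::nat. Factorial_Ring.prime p \<longrightarrow> p dvd n \<longrightarrow> p \<in> \<pi>))"
  using assms(3,4)
proof (induction \<pi> rule: finite_induct)
  case empty
  have "finite (generate G S)" if "S \<subseteq> {\<one>}" for S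
    using generate_subgroup_incl[OF that triv_subgroup] finite_subset by blast
  then have "locally_finite_subgroup G {\<one>}" unfolding locally_finite_subgroup_def by blast
  moreover have "\<forall>x\<in>{\<one>}. \<exists>n>0. x [^] n = \<one> \<and> (\<forall>p::nat. Factorial_Ring.prime p \<longrightarrow> p dvd n \<longrightarrow> p \<in> {})"
    by (auto intro!: exI[of _ "1::nat"])
  ultimately show ?case using one_is_normal by (intro exI[of _ "{\<one>}"]) auto
next
  case (insert q \<pi>)
  then obtain P where P: "P \<lhd> G" "locally_finite_subgroup G P" "\<forall>p\<in>\<pi>. p_torsion G p \<subseteq> P"
    and ord: "\<forall>x\<in>P. \<exists>n>0. x [^] n = \<one> \<and> (\<forall>p::nat. Factorial_Ring.prime p \<longrightarrow> p dvd n \<longrightarrow> p \<in> \<pi>)"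
    using insertI2 by metis
  have q: "Factorial_Ring.prime q" using insert by blast
  let ?Q = "p_torsion G q"
  have Q: "?Q \<lhd> G" by (rule p_torsion_normal[OF nc q])
  interpret P: normal P G by fact
  interpret Q: normal ?Q G by fact
  have "x = \<one>" if x: "x \<in> P" "x \<in> ?Q" for x
  proof -
    obtain n :: nat where n: "0 < n" "x [^] n = \<one>" "\<not> q dvd n" using bspec[OF ord x(1)] q insert(2) by auto
    obtain k :: nat where "x [^] (q ^ k) = \<one>" using x q by (auto simp: mem_p_torsion_iff)
    then have "ord x dvd q ^ k" "ord x dvd n" using n x by (simp_all add: pow_eq_id P.mem_carrier)
    moreover have "coprime (q ^ k) n" using n q by (simp add: prime_imp_coprime)
    ultimately have "ord x = 1" by (meson coprime_common_divisor nat_dvd_1_iff_1)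
    then show ?thesis using x ord_eq_1 by (simp add: P.mem_carrier)
  qed
  then have comm: "a \<otimes> b = b \<otimes> a" if "a \<in> P" "b \<in> ?Q" for a b
    by (intro normal_imp_commuting[OF P(1) Q _ that]) auto
  have "locally_finite_subgroup G (P <#> ?Q)"
    by (rule locally_finite_set_mult_commuting)
      (use comm lf[OF q] P P.subgroup_axioms Q.subgroup_axioms in auto)
  moreover have "P <#> ?Q \<lhd> G" by (rule normal_subgroup_set_mult_closed[OF P(1) Q])
  moreover have "P \<subseteq> P <#> ?Q"
  proof
    fix x assume "x \<in> P"
    then have "x = x \<otimes> \<one>" by simp
    then show "x \<in> P <#> ?Q"
      using Q.one_closed \<open>x \<in> P\<close> unfolding set_mult_def by blast
  qed
  moreover have "?Q \<subseteq> P <#> ?Q"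
  proof
    fix x assume "x \<in> ?Q"
    then have "x = \<one> \<otimes> x" by simp
    then show "x \<in> P <#> ?Q"
      using P.one_closed \<open>x \<in> ?Q\<close> unfolding set_mult_def by blast
  qed
  moreover have "\<exists>n>0. x [^] n = \<one> \<and> (\<forall>p::nat. Factorial_Ring.prime p \<longrightarrow> p dvd n \<longrightarrow> p \<in> insert q \<pi>)"
    if x: "x \<in> P <#> ?Q" for x
  proof -
    obtain a b where ab: "a \<in> P" "b \<in> ?Q" "x = a \<otimes> b" using x by (auto simp: set_mult_def)
    obtain n where n: "0 < n" "a [^] n = \<one>" "\<And>p::nat. Factorial_Ring.prime p \<Longrightarrow> p dvd n \<Longrightarrow> p \<in> \<pi>"
      using bspec[OF ord ab(1)] by auto
    obtain k :: nat where k: "b [^] (q ^ k) = \<one>" using ab q by (auto simp: mem_p_torsion_iff)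
    have c: "a \<in> carrier G" "b \<in> carrier G" using ab by auto
    have "x [^] (n * q ^ k) = a [^] (n * q ^ k) \<otimes> b [^] (n * q ^ k)"
      unfolding ab(3) by (rule pow_mult_distrib[OF comm[OF ab(1,2)] c])
    also have "\<dots> = (a [^] n) [^] (q ^ k) \<otimes> (b [^] (q ^ k)) [^] n"
      using c by (simp add: nat_pow_pow mult.commute)
    finally have "x [^] (n * q ^ k) = \<one>" using n k c by simp
    moreover have "\<forall>p::nat. Factorial_Ring.prime p \<longrightarrow> p dvd n * q ^ k \<longrightarrow> p \<in> insert q \<pi>"
      using n q by (metis insertCI prime_dvd_mult_nat prime_dvd_power primes_dvd_imp_eq)
    moreover have "0 < n * q ^ k" using n q by (simp add: prime_gt_0_nat)
    ultimately show ?thesis by blast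
  qed
  ultimately show ?case using P(3) by (intro exI[of _ "P <#> ?Q"] conjI; (assumption | blast))
qed

lemma finite_torsion_subset_in_locally_finite_normal:
  assumes nc: "normalizer_condition G"
    and lf: "\<And>p::nat. Factorial_Ring.prime p \<Longrightarrow> locally_finite_subgroup G (p_torsion G p)"
    and S: "finite S" "S \<subseteq> torsion G"
  shows "\<exists>P. P \<lhd> G \<and> locally_finite_subgroup G P \<and> S \<subseteq> P \<and> P \<subseteq> torsion G"
proof -
  \<comment> \<open>Finitely many elements involve finitely many primes; this reduces the product
    over all primes to finite products.\<close>
  define \<pi> where "\<pi> = (\<Union>x\<in>S. {p. Factorial_Ring.prime p \<and> p dvd ord x})"
  have "finite \<pi>" unfolding \<pi>_def
    using S by (auto simp: torsion_iff_ord subset_eq intro!: finite_prime_divisors)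
  moreover have "Factorial_Ring.prime p" if "p \<in> \<pi>" for p using that by (auto simp: \<pi>_def)
  ultimately obtain P where P: "P \<lhd> G" "locally_finite_subgroup G P" "\<forall>p\<in>\<pi>. p_torsion G p \<subseteq> P"
    and ord: "\<And>x. x \<in> P \<Longrightarrow> \<exists>n>0. x [^] (n::nat) = \<one>"
    using locally_finite_normal_of_prime_set[OF nc lf] by metis
  have "x \<in> P" if "x \<in> S" for x
  proof (rule mem_subgroup_of_primary_parts)
    show "subgroup P G" by (rule normal_imp_subgroup[OF P(1)])
    show "x \<in> carrier G" "x [^] ord x = \<one>" "0 < ord x"
      using that S by (auto simp: torsion_iff_ord)
  qed (use P that in \<open>auto simp: \<pi>_def\<close>)
  moreover have "P \<subseteq> torsion G"
    using ord subgroup.subset[OF normal_imp_subgroup[OF P(1)]] by (auto simp: torsion_def)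
  ultimately show ?thesis using P by (intro exI[of _ P]) auto
qed

text \<open>Closure under products and local finiteness concern finitely many elements at a time,
  and these lie in one of the locally finite normal subgroups attached to finite sets of
  primes.\<close>

proposition torsion_normal_locally_finite:
  assumes nc: "normalizer_condition G"
    and lf: "\<And>p::nat. Factorial_Ring.prime p \<Longrightarrow> locally_finite_subgroup G (p_torsion G p)"
  shows "torsion G \<lhd> G" "locally_finite_subgroup G (torsion G)"
proof -
  have "x \<otimes> y \<in> torsion G" if xy: "x \<in> torsion G" "y \<in> torsion G" for x y
  proof -
    obtain P where P: "P \<lhd> G" "{x,y} \<subseteq> P" "P \<subseteq> torsion G"
      using finite_torsion_subset_in_locally_finite_normal[OF nc lf, of "{x,y}"] xy by auto
    then show ?thesis using subgroup.m_closed[OF normal_imp_subgroup[OF P(1)], of x y] by auto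
  qed
  then have "subgroup (torsion G) G"
    by (intro submonoid_of_torsion_subgroup) (auto simp: torsion_iff_ord)
  moreover have "g \<otimes> x \<otimes> inv g \<in> torsion G" if "g \<in> carrier G" "x \<in> torsion G" for g x
    using that conj_pow[of g x] by (force simp: torsion_def)
  ultimately show "torsion G \<lhd> G" by (simp add: normal_inv_iff)
  show "locally_finite_subgroup G (torsion G)"
    unfolding locally_finite_subgroup_def
  proof (intro allI impI)
    fix S assume S: "finite S \<and> S \<subseteq> torsion G"
    then obtain P where "locally_finite_subgroup G P" "S \<subseteq> P"
      using finite_torsion_subset_in_locally_finite_normal[OF nc lf, of S] by auto
    then show "finite (generate G S)" using S by (auto simp: locally_finite_subgroup_def)
  qed
qed

lemma finite_subgroup_subset_torsion:
  assumes "subgroup H G" "finite H"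
  shows "H \<subseteq> torsion G"
proof
  fix x assume x: "x \<in> H"
  interpret H: group "G\<lparr>carrier := H\<rparr>" using assms subgroup_imp_group by blast
  have "x [^]\<^bsub>G\<lparr>carrier := H\<rparr>\<^esub> card H = \<one>"
    using H.pow_order_eq_1[of x] x unfolding Coset.order_def by simp
  then have "x [^] card H = \<one>" by (metis nat_pow_consistent)
  moreover have "0 < card H" using x assms by (auto simp: card_gt_0_iff)
  ultimately show "x \<in> torsion G" using x assms subgroup.subset by (force simp: torsion_def)
qed

end

section \<open>Extending maps from the boundary of a disc\<close>

definition radius :: "nat \<Rightarrow> (nat \<Rightarrow> real) \<Rightarrow> real" where
  "radius n x = sqrt (\<Sum>i<n. (x i)\<^sup>2)"

lemma radius_nonneg: "0 \<le> radius n x"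
  by (simp add: radius_def sum_nonneg)

lemma radius_scale: "0 \<le> a \<Longrightarrow> radius n (\<lambda>i. a * x i) = a * radius n x"
  by (simp add: radius_def power_mult_distrib real_sqrt_mult flip: sum_distrib_left)

lemma topspace_disc: "topspace (disc n) = {x. (\<forall>i\<ge>n. x i = 0) \<and> radius n x \<le> 1}"
  by (auto simp: disc_def topspace_Euclidean_space radius_def)

lemma disc_boundary_radius: "disc_boundary n = {x. (\<forall>i\<ge>n. x i = 0) \<and> radius n x = 1}"
  by (auto simp: disc_boundary_def topspace_disc radius_def)

lemma disc_interior_radius: "disc_interior n = {x. (\<forall>i\<ge>n. x i = 0) \<and> radius n x < 1}"
  by (auto simp: disc_interior_def topspace_disc radius_def)

lemma topspace_disc_split: "topspace (disc n) = disc_boundary n \<union> disc_interior n"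
  by (auto simp: topspace_disc disc_boundary_radius disc_interior_radius)

lemma zero_in_disc_interior: "(\<lambda>_. 0) \<in> disc_interior n"
  by (simp add: disc_interior_radius radius_def)

lemma disc_boundary_0: "disc_boundary 0 = {}"
  by (simp add: disc_boundary_radius radius_def)

lemma continuous_map_disc_component: "continuous_map (disc n) euclideanreal (\<lambda>x. x i)"
  by (auto simp: disc_def Euclidean_space_def
      intro!: continuous_map_from_subtopology continuous_map_product_projection)

lemma continuous_map_into_disc:
  assumes "\<And>i. continuous_map X euclideanreal (\<lambda>x. f x i)"
    and "\<And>x. x \<in> topspace X \<Longrightarrow> f x \<in> topspace (disc n)"
  shows "continuous_map X (disc n) f"
  using assms unfolding disc_def Euclidean_space_def topspace_disc
  by (auto simp: continuous_map_in_subtopology continuous_map_componentwise_UNIV radius_def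
      image_subset_iff topspace_subtopology)

lemma Hausdorff_space_disc: "Hausdorff_space (disc n)"
  by (simp add: disc_def Hausdorff_Euclidean_space Hausdorff_space_subtopology)

lemma closedin_disc_finite:
  assumes "finite S" "S \<subseteq> topspace (disc n)"
  shows "closedin (disc n) S"
  using assms Hausdorff_imp_t1_space[OF Hausdorff_space_disc] t1_space_closedin_finite by blast

lemma continuous_map_radius: "continuous_map (disc n) euclideanreal (radius n)"
proof -
  have "continuous_map (disc n) euclideanreal (\<lambda>x. \<Sum>i<n. (x i)\<^sup>2)"
    by (intro continuous_map_sum continuous_map_real_pow continuous_map_disc_component) auto
  from continuous_map_compose[OF this continuous_map_square_root]
  show ?thesis by (simp add: radius_def[abs_def] o_def)
qed

lemma compact_space_disc: "compact_space (disc n)"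
proof -
  let ?P = "powertop_real (UNIV :: nat set)"
  \<comment> \<open>Coordinates from \<open>n\<close> on are pinned to \<open>0\<close>. The box is
    a product of compact sets, hence compact by Tychonoff, and the disc is closed in it.\<close>
  let ?K = "PiE UNIV (\<lambda>i. if i < n then {-1..1} else {0::real})"
  have K: "compactin ?P ?K"
    by (subst compactin_PiE) (auto simp: compactin_euclidean_iff)
  have "closedin ?P {x \<in> topspace ?P. (\<Sum>i<n. (x i)\<^sup>2) \<in> {..1}}"
  proof (rule closedin_continuous_map_preimage)
    show "continuous_map ?P euclideanreal (\<lambda>x. \<Sum>i<n. (x i)\<^sup>2)"
      by (intro continuous_map_sum continuous_map_real_pow continuous_map_product_projection) auto
  qed auto
  then have "compactin ?P (?K \<inter> {x \<in> topspace ?P. (\<Sum>i<n. (x i)\<^sup>2) \<in> {..1}})"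
    using K compact_Int_closedin by blast
  moreover have "?K \<inter> {x \<in> topspace ?P. (\<Sum>i<n. (x i)\<^sup>2) \<in> {..1}} = topspace (disc n)"
  proof -
    have "x i \<in> {-1..1}" if "(\<Sum>i<n. (x i)\<^sup>2) \<le> 1" "i < n" for x :: "nat \<Rightarrow> real" and i
    proof -
      have "(x i)\<^sup>2 \<le> (\<Sum>i<n. (x i)\<^sup>2)"
        using that by (intro member_le_sum) auto
      then have "(x i)\<^sup>2 \<le> 1" using that by linarith
      then show ?thesis by (auto simp: abs_square_le_1 abs_le_iff)
    qed
    then have "x \<in> ?K \<longleftrightarrow> (\<forall>i\<ge>n. x i = 0)" if "(\<Sum>i<n. (x i)\<^sup>2) \<le> 1" for x
      using that by (auto simp: PiE_iff split: if_splits)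
    then show ?thesis by (auto simp: topspace_disc radius_def)
  qed
  ultimately have "compactin ?P (topspace (disc n))" by simp
  moreover have "disc n = subtopology ?P (topspace (disc n))"
    by (auto simp: disc_def Euclidean_space_def subtopology_subtopology topspace_subtopology)
  ultimately show ?thesis by (metis compact_space_subtopology)
qed

lemma closedin_disc_boundary: "closedin (disc n) (disc_boundary n)"
proof -
  have "closedin (disc n) {x \<in> topspace (disc n). radius n x \<in> {1}}"
    by (rule closedin_continuous_map_preimage[OF continuous_map_radius]) auto
  moreover have "{x \<in> topspace (disc n). radius n x \<in> {1}} = disc_boundary n"
    by (auto simp: topspace_disc disc_boundary_radius)
  ultimately show ?thesis by simp
qed

text \<open>The spaces \<open>B\<close> range over a single type, which contains the boundaries of all \<open>J \<times> D\<^sup>n\<close> with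
  \<open>J \<subseteq> \<real>\<close>; this is all that is needed to extend maps over cells.\<close>

definition compactly_contractible :: "'v topology \<Rightarrow> bool" where
  "compactly_contractible V \<longleftrightarrow> topspace V \<noteq> {} \<and>
    (\<forall>(B :: (real \<times> (nat \<Rightarrow> real)) topology) u. compact_space B \<and> continuous_map B V u \<longrightarrow>
       (\<exists>c. homotopic_with (\<lambda>_. True) B V u (\<lambda>_. c)))"

lemma contractible_imp_compactly_contractible:
  assumes "contractible_space V" "topspace V \<noteq> {}"
  shows "compactly_contractible V"
  unfolding compactly_contractible_def
proof (intro conjI allI impI assms)
  fix B :: "(real \<times> (nat \<Rightarrow> real)) topology" and u
  assume u: "compact_space B \<and> continuous_map B V u"
  obtain a where a: "homotopic_with (\<lambda>_. True) V V id (\<lambda>_. a)"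
    using assms unfolding contractible_space_def by blast
  have "homotopic_with (\<lambda>_. True) B V (id \<circ> u) ((\<lambda>_. a) \<circ> u)"
    by (rule homotopic_with_compose_continuous_map_right[OF a]) (use u in auto)
  then show "\<exists>c. homotopic_with (\<lambda>_. True) B V u (\<lambda>_. c)" by (auto simp: o_def)
qed

section \<open>Cones and extension of maps from the boundary of a cell\<close>

lemma quotient_map_lift:
  assumes "quotient_map X Y f" "continuous_map X Z h"
    and "\<And>x y. x \<in> topspace X \<Longrightarrow> y \<in> topspace X \<Longrightarrow> f x = f y \<Longrightarrow> h x = h y"
  shows "\<exists>g. continuous_map Y Z g \<and> (\<forall>x\<in>topspace X. g (f x) = h x)"
proof (rule quotient_map_lift_exists[OF assms(1,2)])
  show "h x = h y" if "x \<in> topspace X" "y \<in> topspace X" "f x = f y" for x y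
    using that by (rule assms(3))
qed blast

text \<open>\<open>r\<close> presents \<open>P\<close> as the cone over \<open>B\<close>, the apex being \<open>r (1, b)\<close>.\<close>

lemma cone_extension:
  fixes r :: "real \<times> 'p \<Rightarrow> 'p"
  assumes P: "Hausdorff_space P" and B: "compactin P B"
    and r: "continuous_map (prod_topology (top_of_set {0..1}) (subtopology P B)) P r"
    and surj: "topspace P \<subseteq> r ` ({0..1} \<times> B)"
    and r0: "\<And>b. b \<in> B \<Longrightarrow> r (0, b) = b"
    and inj: "\<And>s b s' b'. s \<in> {0..1} \<Longrightarrow> s' \<in> {0..1} \<Longrightarrow> b \<in> B \<Longrightarrow> b' \<in> B \<Longrightarrow>
      r (s, b) = r (s', b') \<Longrightarrow> s = s' \<and> (s = 1 \<or> b = b')"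
    and u: "homotopic_with (\<lambda>_. True) (subtopology P B) V u (\<lambda>_. c)"
  shows "\<exists>v. continuous_map P V v \<and> (\<forall>b\<in>B. v b = u b)"
proof -
  let ?I = "top_of_set {0..1::real}"
  let ?C = "prod_topology ?I (subtopology P B)"
  have sub: "B \<subseteq> topspace P" using B by (simp add: compactin_subset_topspace)
  obtain h where h: "continuous_map ?C V h" "\<And>x. h (0, x) = u x" "\<And>x. h (1, x) = c"
    using u unfolding homotopic_with_def by blast
  have "compact_space ?C"
    using B by (simp add: compact_space_prod_topology compact_space_subtopology compactin_euclidean_iff)
  then have "closed_map ?C P r"
    using continuous_imp_closed_map r P by blast
  moreover have "r ` topspace ?C = topspace P"
  proof
    show "r ` topspace ?C \<subseteq> topspace P" by (rule continuous_map_image_subset_topspace[OF r])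
    show "topspace P \<subseteq> r ` topspace ?C" using surj sub by (simp add: Int_absorb1)
  qed
  \<comment> \<open>A continuous surjection from a compact space to a Hausdorff space is a quotient
    map, so the nullhomotopy on the cylinder over \<open>B\<close> can be pushed down to
    \<open>P\<close>.\<close>
  ultimately have q: "quotient_map ?C P r"
    using continuous_closed_imp_quotient_map r by blast
  \<comment> \<open>\<open>r\<close> identifies distinct points only at \<open>s = 1\<close>, where
    \<open>h\<close> has the constant value \<open>c\<close>.\<close>
  have eq: "h z = h z'" if z: "z \<in> topspace ?C" "z' \<in> topspace ?C" "r z = r z'" for z z'
  proof -
    obtain s b s' b' where sb: "z = (s, b)" "z' = (s', b')" by fastforce
    then have "s = s' \<and> (s = 1 \<or> b = b')" using z inj[of s s' b b'] by auto
    then show ?thesis using sb h by auto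
  qed
  have "\<exists>v. continuous_map P V v \<and> (\<forall>z\<in>topspace ?C. v (r z) = h z)"
    by (rule quotient_map_lift[OF q h(1) eq])
  then obtain v where v: "continuous_map P V v" "\<And>z. z \<in> topspace ?C \<Longrightarrow> v (r z) = h z"
    by blast
  have "v b = u b" if "b \<in> B" for b
    using v(2)[of "(0, b)"] that sub r0 h by auto
  then show ?thesis using v(1) by blast
qed

text \<open>Scaling about the point \<open>(m, \<lambda>_. 0)\<close>, the centre of the body that
  is to be presented as a cone.\<close>

definition dilate :: "real \<Rightarrow> real \<Rightarrow> real \<times> (nat \<Rightarrow> real) \<Rightarrow> real \<times> (nat \<Rightarrow> real)" where
  "dilate m a p = (m + a * (fst p - m), \<lambda>i. a * snd p i)"

lemma dilate_dilate: "dilate m a (dilate m b p) = dilate m (a * b) p"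
  by (simp add: dilate_def mult.assoc)

lemma dilate_1: "dilate m 1 p = p"
  by (simp add: dilate_def)

text \<open>\<open>\<mu>\<close> is the gauge of the body \<open>T \<times> D^n\<close> about its
  centre: the body is \<open>\<mu> \<le> 1\<close> and its boundary \<open>B\<close> is
  \<open>\<mu> = 1\<close>. Scaling towards the centre presents the body as the cone over
  \<open>B\<close>. As \<open>B\<close> is compact, \<open>V\<close> supplies the nullhomotopy that
  \<open>cone_extension\<close> requires.\<close>

lemma gauge_extension:
  fixes T :: "real set" and \<mu> :: "real \<times> (nat \<Rightarrow> real) \<Rightarrow> real" and V :: "'v topology"
  assumes T: "compact T" and P: "T \<times> topspace (disc n) = {p \<in> L. \<mu> p \<le> 1}"
    and B: "B = {p \<in> L. \<mu> p = 1}" "B \<noteq> {}"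
      "closedin (prod_topology (top_of_set T) (disc n)) B"
    and L: "\<And>a p. 0 \<le> a \<Longrightarrow> p \<in> L \<Longrightarrow> dilate m a p \<in> L \<and> \<mu> (dilate m a p) = a * \<mu> p"
    and nonneg: "\<And>p. p \<in> L \<Longrightarrow> 0 \<le> \<mu> p"
    and zero: "\<And>p. p \<in> L \<Longrightarrow> \<mu> p = 0 \<Longrightarrow> p = (m, \<lambda>_. 0)"
    and V: "compactly_contractible V"
    and u: "continuous_map (subtopology (prod_topology (top_of_set T) (disc n)) B) V u"
  shows "\<exists>v. continuous_map (prod_topology (top_of_set T) (disc n)) V v \<and> (\<forall>b\<in>B. v b = u b)"
proof -
  let ?P = "prod_topology (top_of_set T) (disc n)"
  have topP: "topspace ?P = {p \<in> L. \<mu> p \<le> 1}" using P by simp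
  have comp: "compactin ?P B"
    using B(3) T compact_space_disc[of n]
    by (simp add: closedin_compact_space compact_space_prod_topology compact_space_subtopology
        compactin_euclidean_iff)
  then have "compact_space (subtopology ?P B)" using compact_space_subtopology by blast
  then obtain c where c: "homotopic_with (\<lambda>_. True) (subtopology ?P B) V u (\<lambda>_. c)"
    using V u unfolding compactly_contractible_def by blast
  \<comment> \<open>The cone coordinate is reversed: \<open>s = 0\<close> is the boundary and
    \<open>s = 1\<close> the apex, whence the factor \<open>1 - s\<close>.\<close>
  let ?r = "\<lambda>(s, p). dilate m (1 - s) p"
  show ?thesis
  proof (rule cone_extension[OF _ comp _ _ _ _ c, of ?r])
    show "Hausdorff_space ?P"
      by (simp add: Hausdorff_space_prod_topology Hausdorff_space_disc Hausdorff_space_subtopology)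
    let ?C = "prod_topology (top_of_set {0..1}) (subtopology ?P B)"
    have 1: "continuous_map ?C euclideanreal fst"
      using continuous_map_into_fulltopology[OF continuous_map_fst] .
    have 2: "continuous_map ?C ?P snd"
      by (metis continuous_map_from_subtopology continuous_map_into_fulltopology continuous_map_snd)
    have 3: "continuous_map ?C euclideanreal (\<lambda>z. fst (snd z))"
      using continuous_map_into_fulltopology[OF continuous_map_compose[OF 2 continuous_map_fst]]
      by (simp add: o_def)
    have 4: "continuous_map ?C euclideanreal (\<lambda>z. snd (snd z) i)" for i
      using continuous_map_compose[OF continuous_map_compose[OF 2 continuous_map_snd]
          continuous_map_disc_component[of n i]] by (simp add: o_def)
    have mem: "dilate m (1 - s) b \<in> topspace ?P" if "s \<in> {0..1}" "b \<in> B" for s b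
      using that L[of "1 - s" b] unfolding topP by (auto simp: B(1))
    have "continuous_map ?C (prod_topology (top_of_set T) (disc n))
        (\<lambda>z. (m + (1 - fst z) * (fst (snd z) - m), \<lambda>i. (1 - fst z) * snd (snd z) i))"
    proof (rule continuous_map_pairedI)
      show "continuous_map ?C (top_of_set T) (\<lambda>z. m + (1 - fst z) * (fst (snd z) - m))"
        unfolding continuous_map_in_subtopology
      proof
        show "continuous_map ?C euclideanreal (\<lambda>z. m + (1 - fst z) * (fst (snd z) - m))"
          by (intro continuous_intros 1 3)
        show "(\<lambda>z. m + (1 - fst z) * (fst (snd z) - m)) \<in> topspace ?C \<rightarrow> T"
          using mem by (auto simp: dilate_def)
      qed
      show "continuous_map ?C (disc n) (\<lambda>z i. (1 - fst z) * snd (snd z) i)"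
      proof (rule continuous_map_into_disc)
        show "continuous_map ?C euclideanreal (\<lambda>z. (1 - fst z) * snd (snd z) i)" for i
          by (intro continuous_intros 1 4)
        show "(\<lambda>i. (1 - fst z) * snd (snd z) i) \<in> topspace (disc n)" if "z \<in> topspace ?C" for z
          using mem[of "fst z" "snd z"] that by (auto simp: dilate_def)
      qed
    qed
    then show "continuous_map ?C ?P ?r"
      by (simp add: dilate_def case_prod_unfold)
    show "topspace ?P \<subseteq> ?r ` ({0..1} \<times> B)"
    proof
      fix p assume p: "p \<in> topspace ?P"
      then have pL: "p \<in> L" "\<mu> p \<le> 1" unfolding topP by auto
      show "p \<in> ?r ` ({0..1} \<times> B)"
      proof (cases "\<mu> p = 0")
        case True
        obtain b where "b \<in> B" using B by blast
        then show ?thesis using zero[OF pL(1) True]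
          by (intro image_eqI[of _ _ "(1, b)"]) (auto simp: dilate_def)
      next
        case False
        then have pos: "0 < \<mu> p" using nonneg[OF pL(1)] by simp
        \<comment> \<open>Radial projection of \<open>p\<close> to the boundary; scaling back by
          \<open>\<mu> p\<close>, that is, at cone coordinate \<open>1 - \<mu> p\<close>, recovers
          \<open>p\<close>.\<close>
        let ?b = "dilate m (1 / \<mu> p) p"
        have "?b \<in> B" using L[of "1 / \<mu> p" p] pL pos by (auto simp: B(1))
        moreover have "p = dilate m (1 - (1 - \<mu> p)) ?b"
          using pos by (simp add: dilate_dilate dilate_1)
        ultimately show ?thesis using pL pos by (intro image_eqI[of _ _ "(1 - \<mu> p, ?b)"]) auto
      qed
    qed
    show "?r (0, b) = b" if "b \<in> B" for b by (simp add: dilate_1)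
    fix s b s' b'
    assume s: "s \<in> {0..1}" "s' \<in> {0..1}" and b: "b \<in> B" "b' \<in> B" and eq: "?r (s, b) = ?r (s', b')"
    have "\<mu> (?r (s, b)) = 1 - s" "\<mu> (?r (s', b')) = 1 - s'"
      using L[of "1 - s" b] L[of "1 - s'" b'] s b by (auto simp: B(1))
    then have ss: "s = s'" using eq by simp
    moreover have "b = b'" if "s \<noteq> 1"
    proof -
      have "dilate m (1 / (1 - s)) (dilate m (1 - s) b) = dilate m (1 / (1 - s)) (dilate m (1 - s) b')"
        using eq ss by simp
      then show ?thesis using that by (simp add: dilate_dilate dilate_1)
    qed
    ultimately show "s = s' \<and> (s = 1 \<or> b = b')" by blast
  qed
qed

text \<open>With \<open>J\<^sub>0 = \<emptyset> \<subseteq> J = {*}\<close> this allows the construction of maps cell by cell, with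
  \<open>J\<^sub>0 = {0, 1} \<subseteq> J = [0, 1]\<close> that of homotopies.\<close>

definition extends_over_cells :: "real set \<Rightarrow> real set \<Rightarrow> 'v topology \<Rightarrow> bool" where
  "extends_over_cells J J\<^sub>0 V \<longleftrightarrow> (\<forall>n u.
     continuous_map (subtopology (prod_topology (top_of_set J) (disc n))
       (J \<times> disc_boundary n \<union> J\<^sub>0 \<times> topspace (disc n))) V u \<longrightarrow>
     (\<exists>v. continuous_map (prod_topology (top_of_set J) (disc n)) V v \<and>
       (\<forall>p \<in> J \<times> disc_boundary n \<union> J\<^sub>0 \<times> topspace (disc n). v p = u p)))"

lemma closedin_relative_boundary:
  assumes "closed J\<^sub>0" "J\<^sub>0 \<subseteq> J"
  shows "closedin (prod_topology (top_of_set J) (disc n))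
    (J \<times> disc_boundary n \<union> J\<^sub>0 \<times> topspace (disc n))"
  using assms closedin_disc_boundary[of n]
  by (intro closedin_Un) (auto simp: closedin_prod_Times_iff closed_subset)

lemma extends_over_cells_point:
  assumes V: "compactly_contractible V"
  shows "extends_over_cells {0} {} V"
  unfolding extends_over_cells_def
proof (intro allI impI)
  fix n and u :: "real \<times> (nat \<Rightarrow> real) \<Rightarrow> 'a"
  let ?P = "prod_topology (top_of_set {0::real}) (disc n)"
  let ?B = "{0} \<times> disc_boundary n \<union> {} \<times> topspace (disc n)"
  assume u: "continuous_map (subtopology ?P ?B) V u"
  show "\<exists>v. continuous_map ?P V v \<and> (\<forall>p\<in>?B. v p = u p)"
  proof (cases "n = 0")
    case True
    \<comment> \<open>\<open>D^0\<close> is a point with empty boundary and is no cone over it; any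
      point of \<open>V\<close> serves as the extension.\<close>
    obtain c where "c \<in> topspace V" using V unfolding compactly_contractible_def by blast
    then show ?thesis using True by (intro exI[of _ "\<lambda>_. c"]) (auto simp: disc_boundary_0)
  next
    case False
    show ?thesis
    proof (rule gauge_extension[where \<mu> = "\<lambda>p. radius n (snd p)"
            and L = "{p. fst p = 0 \<and> (\<forall>i\<ge>n. snd p i = 0)}" and m = 0])
      show "?B = {p \<in> {p. fst p = 0 \<and> (\<forall>i\<ge>n. snd p i = 0)}. radius n (snd p) = 1}"
        by (auto simp: disc_boundary_radius)
      have "(\<lambda>i. if i = 0 then 1 else 0) \<in> disc_boundary n"
        using False by (auto simp: disc_boundary_radius radius_def if_distrib[of "\<lambda>x. x\<^sup>2"] cong: if_cong)
      then show "?B \<noteq> {}" by auto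
      show "closedin ?P ?B" using closedin_relative_boundary[of "{}" "{0}" n] by simp
      show "p = (0, \<lambda>_. 0)"
        if "p \<in> {p. fst p = 0 \<and> (\<forall>i\<ge>n. snd p i = 0)}" "radius n (snd p) = 0" for p
      proof -
        have "\<forall>i<n. snd p i = 0" using that(2) by (auto simp: radius_def sum_nonneg_eq_0_iff)
        then have "snd p i = 0" for i using that(1) by (cases "i < n") auto
        then show ?thesis using that(1) by (auto simp: prod_eq_iff)
      qed
    qed (use V u in \<open>auto simp: topspace_disc radius_nonneg dilate_def radius_scale\<close>)
  qed
qed

lemma extends_over_cells_interval:
  assumes V: "compactly_contractible V"
  shows "extends_over_cells {0..1} {0,1} V"
  unfolding extends_over_cells_def
proof (intro allI impI)
  fix n and u :: "real \<times> (nat \<Rightarrow> real) \<Rightarrow> 'a"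
  let ?P = "prod_topology (top_of_set {0..1::real}) (disc n)"
  let ?B = "{0..1} \<times> disc_boundary n \<union> {0,1} \<times> topspace (disc n)"
  \<comment> \<open>The gauge of the cylinder about the midpoint \<open>1/2\<close> of its axis:
    \<open>radius\<close> is \<open>1\<close> on the mantle, the other term is \<open>1\<close> on
    the two ends. The ends keep this boundary nonempty for every \<open>n\<close>, so
    \<open>n = 0\<close> is no exception here.\<close>
  let ?\<mu> = "\<lambda>p. max (radius n (snd p)) \<bar>2 * (fst p - 1/2)\<bar>"
  let ?L = "{p :: real \<times> (nat \<Rightarrow> real). \<forall>i\<ge>n. snd p i = 0}"
  assume u: "continuous_map (subtopology ?P ?B) V u"
  show "\<exists>v. continuous_map ?P V v \<and> (\<forall>p\<in>?B. v p = u p)"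
  proof (rule gauge_extension[where \<mu> = ?\<mu> and L = ?L and m = "1/2"])
    have unit: "\<bar>2 * (t - 1/2)\<bar> \<le> 1 \<longleftrightarrow> t \<in> {0..1}" for t :: real by auto
    have ends: "\<bar>2 * (t - 1/2)\<bar> = 1 \<longleftrightarrow> t \<in> {0, 1}" for t :: real by auto
    show "{0..1} \<times> topspace (disc n) = {p \<in> ?L. ?\<mu> p \<le> 1}"
      unfolding max.bounded_iff unit by (auto simp: topspace_disc)
    have max1: "max a b = 1 \<longleftrightarrow> a \<le> 1 \<and> b \<le> 1 \<and> (a = 1 \<or> b = 1)" for a b :: real by auto
    show "?B = {p \<in> ?L. ?\<mu> p = 1}"
      unfolding max1 unit ends by (auto simp: disc_boundary_radius topspace_disc)
    have "(0, \<lambda>_. 0) \<in> ?B" using zero_in_disc_interior[of n] by (auto simp: topspace_disc_split)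
    then show "?B \<noteq> {}" by blast
    show "closedin ?P ?B" by (rule closedin_relative_boundary) auto
    show "p = (1/2, \<lambda>_. 0)" if p: "p \<in> ?L" "?\<mu> p = 0" for p
    proof -
      have "radius n (snd p) \<le> 0" "\<bar>2 * (fst p - 1/2)\<bar> \<le> 0"
        using p(2) by (metis max.cobounded1, metis max.cobounded2)
      then have "radius n (snd p) = 0" "fst p = 1/2" using radius_nonneg[of n "snd p"] by auto
      then have "\<forall>i<n. snd p i = 0" by (auto simp: radius_def sum_nonneg_eq_0_iff)
      then have "snd p i = 0" for i using p(1) by (cases "i < n") auto
      then show ?thesis using \<open>fst p = 1/2\<close> by (auto simp: prod_eq_iff)
    qed
    show "0 \<le> ?\<mu> p" if "p \<in> ?L" for p using radius_nonneg[of n "snd p"] by simp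
    show "dilate (1/2) a p \<in> ?L \<and> ?\<mu> (dilate (1/2) a p) = a * ?\<mu> p" if "0 \<le> a" "p \<in> ?L" for a p
    proof -
      have "\<bar>2 * (fst (dilate (1/2) a p) - 1/2)\<bar> = a * \<bar>2 * (fst p - 1/2)\<bar>"
      proof -
        have "2 * (fst (dilate (1/2) a p) - 1/2) = a * (2 * (fst p - 1/2))"
          by (simp add: dilate_def)
        then show ?thesis using that(1) by (simp only: abs_mult abs_of_nonneg)
      qed
      moreover have "radius n (snd (dilate (1/2) a p)) = a * radius n (snd p)"
        using that(1) by (simp add: dilate_def radius_scale)
      ultimately show ?thesis using that by (simp add: max_mult_distrib_left) (simp add: dilate_def)
    qed
  qed (use V u in auto)
qed

section \<open>Families of maps that determine a topology\<close>

text \<open>Each summand is open in the sum, so continuity near a point can be tested within the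
  summand that contains it.\<close>

lemma continuous_map_prod_sum_topology:
  assumes "\<And>e. e \<in> E \<Longrightarrow> continuous_map (prod_topology J (D e)) V (\<lambda>(j, x). f (j, (e, x)))"
  shows "continuous_map (prod_topology J (sum_topology D E)) V f"
  unfolding continuous_map_def
proof (intro conjI allI impI)
  show "f \<in> topspace (prod_topology J (sum_topology D E)) \<rightarrow> topspace V"
  proof
    fix z assume "z \<in> topspace (prod_topology J (sum_topology D E))"
    then obtain j e x where "z = (j, (e, x))" "j \<in> topspace J" "e \<in> E" "x \<in> topspace (D e)"
      by auto
    then show "f z \<in> topspace V"
      using continuous_map_funspace[OF assms, of e] by (auto simp: Pi_iff)
  qed
  fix U assume U: "openin V U"
  let ?W = "{z \<in> topspace (prod_topology J (sum_topology D E)). f z \<in> U}"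
  show "openin (prod_topology J (sum_topology D E)) ?W"
    unfolding openin_prod_topology_alt
  proof (intro allI impI)
    fix j y assume "(j, y) \<in> ?W"
    then obtain e x where y: "y = (e, x)" "j \<in> topspace J" "e \<in> E" "x \<in> topspace (D e)" "f (j, (e, x)) \<in> U"
      by auto
    define W where "W = {z \<in> topspace (prod_topology J (D e)). (\<lambda>(j, x). f (j, (e, x))) z \<in> U}"
    have W: "openin (prod_topology J (D e)) W"
      unfolding W_def using openin_continuous_map_preimage[OF assms[OF y(3)] U] .
    have "(j, x) \<in> W" using y by (auto simp: W_def)
    then have "\<exists>A B. openin J A \<and> openin (D e) B \<and> j \<in> A \<and> x \<in> B \<and> A \<times> B \<subseteq> W"
      by (rule W[unfolded openin_prod_topology_alt, THEN spec, THEN spec, THEN mp])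
    then obtain A B where AB: "openin J A" "openin (D e) B" "j \<in> A" "x \<in> B" "A \<times> B \<subseteq> W"
      by (elim exE conjE) (rule that)
    have "openin (sum_topology D E) (Pair e ` B)"
      using open_map_component_injection[OF y(3), of D] AB(2) by (simp add: open_map_def)
    moreover have "A \<times> Pair e ` B \<subseteq> ?W"
    proof
      fix z assume "z \<in> A \<times> Pair e ` B"
      then obtain a b where "z = (a, (e, b))" "(a, b) \<in> W" using AB(5) by blast
      then show "z \<in> ?W" using y(3) by (auto simp: W_def)
    qed
    ultimately show "\<exists>A' B'. openin J A' \<and> openin (sum_topology D E) B' \<and> j \<in> A' \<and> y \<in> B' \<and> A' \<times> B' \<subseteq> ?W"
      using AB y by (intro exI[of _ A] exI[of _ "Pair e ` B"]) auto
  qed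
qed

text \<open>\<open>X\<close> is a quotient of the disjoint sum of the pieces, and the product with a
  locally compact Hausdorff space preserves quotient maps. This gives joint continuity of homotopies
  that are controlled cell by cell.\<close>

lemma continuous_map_prod_from_pieces:
  assumes \<psi>: "\<And>e. e \<in> E \<Longrightarrow> continuous_map (D e) X (\<psi> e)"
    and cover: "topspace X \<subseteq> (\<Union>e\<in>E. \<psi> e ` topspace (D e))"
    and coherent: "\<And>S. S \<subseteq> topspace X \<Longrightarrow>
      (\<And>e. e \<in> E \<Longrightarrow> closedin (D e) {x \<in> topspace (D e). \<psi> e x \<in> S}) \<Longrightarrow> closedin X S"
    and J: "locally_compact_space J" "Hausdorff_space J"
    and h: "\<And>e. e \<in> E \<Longrightarrow> continuous_map (prod_topology J (D e)) V (\<lambda>(j, x). h (j, \<psi> e x))"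
  shows "continuous_map (prod_topology J X) V h"
proof -
  let ?q = "\<lambda>(e, x). \<psi> e x"
  have "quotient_map (sum_topology D E) X ?q"
    unfolding quotient_map_closedin
  proof (intro conjI allI impI)
    show "?q ` topspace (sum_topology D E) = topspace X"
      using cover continuous_map_image_subset_topspace[OF \<psi>] by fastforce
    fix S assume S: "S \<subseteq> topspace X"
    have "closedin (sum_topology D E) {z \<in> topspace (sum_topology D E). ?q z \<in> S} \<longleftrightarrow>
        (\<forall>e\<in>E. closedin (D e) {x \<in> topspace (D e). \<psi> e x \<in> S})"
      unfolding closedin_sum_topology by (auto cong: conj_cong intro!: arg_cong2[of _ _ _ _ closedin])
    also have "\<dots> \<longleftrightarrow> closedin X S"
      using coherent[OF S] closedin_continuous_map_preimage[OF \<psi>] by blast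
    finally show "closedin (sum_topology D E) {z \<in> topspace (sum_topology D E). ?q z \<in> S} \<longleftrightarrow> closedin X S" .
  qed
  then have q: "quotient_map (prod_topology J (sum_topology D E)) (prod_topology J X) (\<lambda>(j, z). (j, ?q z))"
    using quotient_map_prod_right J by blast
  have "continuous_map (prod_topology J (sum_topology D E)) V (h \<circ> (\<lambda>(j, z). (j, ?q z)))"
    using h by (intro continuous_map_prod_sum_topology) (simp add: o_def)
  then show ?thesis using continuous_compose_quotient_map[OF q] by blast
qed

text \<open>\<open>S\<close> is closed in a compact set, hence compact, and it is discrete because
  all its subsets are closed; compact discrete spaces are finite.\<close>

lemma compactin_hereditarily_closed_imp_finite:
  assumes K: "compactin X K" and S: "S \<subseteq> K" and closed: "\<And>S'. S' \<subseteq> S \<Longrightarrow> closedin X S'"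
  shows "finite S"
proof -
  have "compactin X S" using closed_compactin[OF K S] closed by blast
  then have "compact_space (subtopology X S)" by (simp add: compact_space_subtopology)
  moreover have "subtopology X S = discrete_topology S"
  proof -
    have "topspace (subtopology X S) = S"
      using closed[of S] closedin_subset by fastforce
    moreover have "openin (subtopology X S) {x}" if "x \<in> S" for x
    proof -
      have "closedin (subtopology X S) (S - {x})"
        using closed[of "S - {x}"] by (auto intro: closedin_subset_topspace)
      then have "openin (subtopology X S) (topspace (subtopology X S) - (S - {x}))" by blast
      moreover have "topspace (subtopology X S) - (S - {x}) = {x}"
        using \<open>topspace (subtopology X S) = S\<close> that by blast
      ultimately show ?thesis by simp
    qed
    ultimately show ?thesis using discrete_topology_unique[of S "subtopology X S"] by auto
  qed
  ultimately show ?thesis by (simp add: compact_space_discrete_topology)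
qed

section \<open>Spaces built from cells that are permuted by a group\<close>

text \<open>A \<open>G\<close>-cell \<open>G/H \<times> D\<^sup>n\<close> is treated as a family of ordinary cells \<open>{c} \<times> D\<^sup>n\<close>, which \<open>G\<close>
  permutes; \<open>char e\<close> is the characteristic map of the cell \<open>e\<close>.\<close>

locale cellular_action =
  fixes G :: "('g, 'm) monoid_scheme" and X :: "'x topology" and \<alpha> :: "'g \<Rightarrow> 'x \<Rightarrow> 'x"
    and E :: "'e set" and dim :: "'e \<Rightarrow> nat" and char :: "'e \<Rightarrow> (nat \<Rightarrow> real) \<Rightarrow> 'x"
    and act :: "'g \<Rightarrow> 'e \<Rightarrow> 'e"
  fixes skeleton :: "nat \<Rightarrow> 'x set"
  defines "skeleton n \<equiv> (\<Union>e\<in>{e \<in> E. dim e < n}. char e ` disc_interior (dim e))"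
  assumes grp: "group G"
    and action_continuous: "g \<in> carrier G \<Longrightarrow> continuous_map X X (\<alpha> g)"
    and action_one: "x \<in> topspace X \<Longrightarrow> \<alpha> \<one>\<^bsub>G\<^esub> x = x"
    and action_mult: "g \<in> carrier G \<Longrightarrow> h \<in> carrier G \<Longrightarrow> x \<in> topspace X \<Longrightarrow>
      \<alpha> (g \<otimes>\<^bsub>G\<^esub> h) x = \<alpha> g (\<alpha> h x)"
    and char_continuous: "e \<in> E \<Longrightarrow> continuous_map (disc (dim e)) X (char e)"
    and interior_inj: "e \<in> E \<Longrightarrow> e' \<in> E \<Longrightarrow> a \<in> disc_interior (dim e) \<Longrightarrow>
      a' \<in> disc_interior (dim e') \<Longrightarrow> char e a = char e' a' \<Longrightarrow> e = e' \<and> a = a'"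
    and cells_cover: "topspace X \<subseteq> (\<Union>e\<in>E. char e ` disc_interior (dim e))"
    and boundary_skeleton: "e \<in> E \<Longrightarrow> char e ` disc_boundary (dim e) \<subseteq> skeleton (dim e)"
    and closedin_skeletonI: "S \<subseteq> skeleton n \<Longrightarrow>
      (\<And>e. e \<in> E \<Longrightarrow> dim e < n \<Longrightarrow>
        closedin (disc (dim e)) {a \<in> topspace (disc (dim e)). char e a \<in> S}) \<Longrightarrow> closedin X S"
    and closedin_colimitI: "S \<subseteq> topspace X \<Longrightarrow> (\<And>n. closedin X (S \<inter> skeleton n)) \<Longrightarrow> closedin X S"
    and act_cell: "g \<in> carrier G \<Longrightarrow> e \<in> E \<Longrightarrow> act g e \<in> E"
    and act_dim: "g \<in> carrier G \<Longrightarrow> e \<in> E \<Longrightarrow> dim (act g e) = dim e"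
    and act_char: "g \<in> carrier G \<Longrightarrow> e \<in> E \<Longrightarrow> a \<in> topspace (disc (dim e)) \<Longrightarrow>
      char (act g e) a = \<alpha> g (char e a)"
begin

section \<open>Cells and skeleta under the action\<close>

lemma interior_disc: "x \<in> disc_interior n \<Longrightarrow> x \<in> topspace (disc n)"
  and boundary_disc: "x \<in> disc_boundary n \<Longrightarrow> x \<in> topspace (disc n)"
  by (auto simp: topspace_disc_split)

lemma action_closed: "g \<in> carrier G \<Longrightarrow> x \<in> topspace X \<Longrightarrow> \<alpha> g x \<in> topspace X"
  using continuous_map_funspace[OF action_continuous] by (auto simp: Pi_iff)

lemma action_inv:
  assumes "g \<in> carrier G" "x \<in> topspace X"
  shows "\<alpha> (inv\<^bsub>G\<^esub> g) (\<alpha> g x) = x" "\<alpha> g (\<alpha> (inv\<^bsub>G\<^esub> g) x) = x"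
  using assms action_mult[of "inv\<^bsub>G\<^esub> g" g x] action_mult[of g "inv\<^bsub>G\<^esub> g" x] action_one[of x]
    group.inv_closed[OF grp] group.l_inv[OF grp] group.r_inv[OF grp] by auto

lemma char_topspace: "e \<in> E \<Longrightarrow> x \<in> topspace (disc (dim e)) \<Longrightarrow> char e x \<in> topspace X"
  using continuous_map_funspace[OF char_continuous] by (auto simp: Pi_iff)

lemma cell_coordinates:
  assumes "y \<in> topspace X"
  obtains e x where "e \<in> E" "x \<in> disc_interior (dim e)" "y = char e x"
  using cells_cover assms by blast

text \<open>The action on cells is known only through the characteristic maps. Comparing the centres
  of the two cells, and using that open cells are disjoint, recovers the action law.\<close>

lemma act_mult:
  assumes "g \<in> carrier G" "h \<in> carrier G" "e \<in> E"
  shows "act (g \<otimes>\<^bsub>G\<^esub> h) e = act g (act h e)"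
proof -
  have gh: "g \<otimes>\<^bsub>G\<^esub> h \<in> carrier G" using assms grp by (simp add: group.subgroup_self subgroup.m_closed)
  let ?z = "\<lambda>_. 0 :: real"
  have z: "?z \<in> disc_interior (dim e)" "?z \<in> topspace (disc (dim e))"
    using zero_in_disc_interior interior_disc by blast+
  have "char (act (g \<otimes>\<^bsub>G\<^esub> h) e) ?z = char (act g (act h e)) ?z"
    using assms gh z by (simp add: act_char act_cell act_dim action_mult char_topspace)
  then show ?thesis
    using interior_inj[of "act (g \<otimes>\<^bsub>G\<^esub> h) e" "act g (act h e)" ?z ?z] assms gh z
    by (simp add: act_cell act_dim)
qed

lemma act_one:
  assumes "e \<in> E"
  shows "act \<one>\<^bsub>G\<^esub> e = e"
proof -
  let ?z = "\<lambda>_. 0 :: real"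
  have one: "\<one>\<^bsub>G\<^esub> \<in> carrier G" using grp by (simp add: group.subgroup_self subgroup.one_closed)
  have z: "?z \<in> disc_interior (dim e)" "?z \<in> topspace (disc (dim e))"
    using zero_in_disc_interior interior_disc by blast+
  have "char (act \<one>\<^bsub>G\<^esub> e) ?z = char e ?z"
    using assms one z by (simp add: act_char action_one char_topspace)
  then show ?thesis
    using interior_inj[of "act \<one>\<^bsub>G\<^esub> e" e ?z ?z] assms one z by (simp add: act_cell act_dim)
qed

lemma act_inv:
  assumes "g \<in> carrier G" "e \<in> E"
  shows "act (inv\<^bsub>G\<^esub> g) (act g e) = e"
  using assms act_mult[of "inv\<^bsub>G\<^esub> g" g e] act_one[of e]
    group.inv_closed[OF grp] group.l_inv[OF grp] by auto

text \<open>The index is shifted: \<open>skeleton n\<close> holds the open cells of dimension below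
  \<open>n\<close>. The boundary of a cell lies in \<open>skeleton (dim e)\<close>, so the closed
  cell lies in every skeleton of larger index.\<close>

lemma skeleton_memI:
  assumes "e \<in> E" "dim e < n" "x \<in> topspace (disc (dim e))"
  shows "char e x \<in> skeleton n"
proof (cases "x \<in> disc_interior (dim e)")
  case True
  then show ?thesis using assms unfolding skeleton_def by blast
next
  case False
  then have "x \<in> disc_boundary (dim e)" using assms by (simp add: topspace_disc_split)
  then have "char e x \<in> skeleton (dim e)" using boundary_skeleton[OF assms(1)] by blast
  then show ?thesis using assms(2) unfolding skeleton_def by fastforce
qed

lemma skeleton_mono: "m \<le> n \<Longrightarrow> skeleton m \<subseteq> skeleton n"
  unfolding skeleton_def by fastforce

lemma skeleton_0: "skeleton 0 = {}"
  by (simp add: skeleton_def)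

lemma skeleton_cell:
  assumes "e \<in> E" "x \<in> disc_interior (dim e)"
  shows "char e x \<in> skeleton n \<longleftrightarrow> dim e < n"
proof
  assume "char e x \<in> skeleton n"
  then obtain e' x' where "e' \<in> E" "dim e' < n" "x' \<in> disc_interior (dim e')" "char e x = char e' x'"
    unfolding skeleton_def by blast
  then show "dim e < n" using interior_inj assms by blast
qed (use assms in \<open>auto simp: skeleton_def\<close>)

lemma skeleton_cover:
  assumes "y \<in> topspace X"
  shows "\<exists>n. y \<in> skeleton n"
proof -
  obtain e x where "e \<in> E" "x \<in> disc_interior (dim e)" "y = char e x"
    using cell_coordinates[OF assms] .
  then show ?thesis using skeleton_cell[of e x "Suc (dim e)"] by auto
qed

lemma action_skeleton:
  assumes "g \<in> carrier G" "y \<in> skeleton n"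
  shows "\<alpha> g y \<in> skeleton n"
proof -
  obtain e x where ex: "e \<in> E" "dim e < n" "x \<in> disc_interior (dim e)" "y = char e x"
    using assms(2) unfolding skeleton_def by blast
  then have "\<alpha> g y = char (act g e) x" using assms(1) by (simp add: act_char interior_disc)
  then show ?thesis
    using skeleton_memI[of "act g e" n x] ex assms(1) by (simp add: act_cell act_dim interior_disc)
qed

text \<open>Induction on skeleta: when the trace of \<open>S\<close> on a closed cell is examined,
  the part of \<open>S\<close> in lower cells may already be taken as closed, which settles the
  boundary of the cell.\<close>

lemma closedin_by_skeleta:
  assumes S: "S \<subseteq> topspace X"
    and step: "\<And>e. e \<in> E \<Longrightarrow> closedin X (S \<inter> skeleton (dim e)) \<Longrightarrow>
      closedin (disc (dim e)) {x \<in> topspace (disc (dim e)). char e x \<in> S}"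
  shows "closedin X S"
proof (rule closedin_colimitI[OF S])
  show "closedin X (S \<inter> skeleton n)" for n
  proof (induction n rule: less_induct)
    case (less n)
    show ?case
    proof (rule closedin_skeletonI[of _ n])
      fix e assume e: "e \<in> E" "dim e < n"
      have "{x \<in> topspace (disc (dim e)). char e x \<in> S \<inter> skeleton n} =
          {x \<in> topspace (disc (dim e)). char e x \<in> S}"
        using skeleton_memI[OF e] by blast
      then show "closedin (disc (dim e)) {x \<in> topspace (disc (dim e)). char e x \<in> S \<inter> skeleton n}"
        using step[OF e(1) less[OF e(2)]] by simp
    qed simp
  qed
qed

lemma closedin_by_cells:
  assumes "S \<subseteq> topspace X"
    and "\<And>e. e \<in> E \<Longrightarrow> closedin (disc (dim e)) {x \<in> topspace (disc (dim e)). char e x \<in> S}"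
  shows "closedin X S"
  using closedin_by_skeleta assms by blast

lemma closedin_boundary_part:
  assumes "e \<in> E" "closedin X (S \<inter> skeleton (dim e))"
  shows "closedin (disc (dim e)) {x \<in> disc_boundary (dim e). char e x \<in> S}"
proof -
  have "{x \<in> disc_boundary (dim e). char e x \<in> S} = disc_boundary (dim e) \<inter>
      {x \<in> topspace (disc (dim e)). char e x \<in> S \<inter> skeleton (dim e)}"
    using boundary_skeleton[OF assms(1)] boundary_disc by blast
  then show ?thesis
    using closedin_Int[OF closedin_disc_boundary
        closedin_continuous_map_preimage[OF char_continuous[OF assms(1)] assms(2)]] by simp
qed

text \<open>On a closed cell the trace of \<open>S\<close> consists of a boundary part, closed by
  the skeletal induction, and finitely many interior points.\<close>

lemma closedin_of_finite_interiors:
  assumes S: "S \<subseteq> topspace X"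
    and fin: "\<And>e. e \<in> E \<Longrightarrow> finite {x \<in> disc_interior (dim e). char e x \<in> S}"
  shows "closedin X S"
proof (rule closedin_by_skeleta[OF S])
  fix e assume e: "e \<in> E" "closedin X (S \<inter> skeleton (dim e))"
  have "{x \<in> topspace (disc (dim e)). char e x \<in> S} =
      {x \<in> disc_boundary (dim e). char e x \<in> S} \<union> {x \<in> disc_interior (dim e). char e x \<in> S}"
    by (auto simp: topspace_disc_split)
  moreover have "closedin (disc (dim e)) {x \<in> disc_interior (dim e). char e x \<in> S}"
    using interior_disc by (intro closedin_disc_finite[OF fin[OF e(1)]]) blast
  ultimately show "closedin (disc (dim e)) {x \<in> topspace (disc (dim e)). char e x \<in> S}"
    using closedin_Un[OF closedin_boundary_part[OF e]] by simp
qed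

section \<open>Subcomplexes and closure finiteness\<close>

definition subcomplex :: "'e set \<Rightarrow> bool" where
  "subcomplex M \<longleftrightarrow> M \<subseteq> E \<and>
    (\<forall>e\<in>M. char e ` disc_boundary (dim e) \<subseteq> (\<Union>e'\<in>M. char e' ` disc_interior (dim e')))"

text \<open>A closed cell of \<open>M\<close> lies wholly in the union, while any other cell can
  meet it only along its boundary, since open cells are disjoint.\<close>

lemma closedin_subcomplex:
  assumes M: "subcomplex M"
  shows "closedin X (\<Union>e\<in>M. char e ` disc_interior (dim e))" (is "closedin X ?L")
proof (rule closedin_by_skeleta)
  show "?L \<subseteq> topspace X" using M char_topspace interior_disc unfolding subcomplex_def by fastforce
  fix e assume e: "e \<in> E" "closedin X (?L \<inter> skeleton (dim e))"
  show "closedin (disc (dim e)) {x \<in> topspace (disc (dim e)). char e x \<in> ?L}"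
  proof (cases "e \<in> M")
    case True
    then have "{x \<in> topspace (disc (dim e)). char e x \<in> ?L} = topspace (disc (dim e))"
      using M unfolding subcomplex_def topspace_disc_split by blast
    then show ?thesis by simp
  next
    case False
    have "char e x \<notin> ?L" if x: "x \<in> disc_interior (dim e)" for x
    proof
      assume "char e x \<in> ?L"
      then obtain e' x' where "e' \<in> M" "x' \<in> disc_interior (dim e')" "char e x = char e' x'" by blast
      then show False using interior_inj[OF e(1) _ x, of e' x'] M False by (auto simp: subcomplex_def)
    qed
    then have "{x \<in> topspace (disc (dim e)). char e x \<in> ?L} = {x \<in> disc_boundary (dim e). char e x \<in> ?L}"
      unfolding topspace_disc_split by blast
    then show ?thesis using closedin_boundary_part[OF e] by simp
  qed
qed

text \<open>One point of \<open>K\<close> is chosen in each open cell that \<open>K\<close> meets. A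
  set of chosen points has at most one point in each open cell, so all such sets are closed, which
  inside a compact set forces finiteness.\<close>

lemma compactin_meets_finitely_many_cells:
  assumes K: "compactin X K"
  shows "finite {e \<in> E. \<exists>x\<in>disc_interior (dim e). char e x \<in> K}" (is "finite ?M")
proof -
  define \<xi> where "\<xi> e = (SOME x. x \<in> disc_interior (dim e) \<and> char e x \<in> K)" for e
  have \<xi>: "\<xi> e \<in> disc_interior (dim e) \<and> char e (\<xi> e) \<in> K" if "e \<in> ?M" for e
  proof -
    have "\<exists>x. x \<in> disc_interior (dim e) \<and> char e x \<in> K" using that by blast
    then show ?thesis unfolding \<xi>_def by (rule someI_ex)
  qed
  define p where "p e = char e (\<xi> e)" for e
  have "inj_on p ?M"
  proof (rule inj_onI)
    fix e e' assume e: "e \<in> ?M" "e' \<in> ?M" "p e = p e'"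
    then show "e = e'" using interior_inj[of e e' "\<xi> e" "\<xi> e'"] \<xi> unfolding p_def by blast
  qed
  moreover have "finite (p ` ?M)"
  proof (rule compactin_hereditarily_closed_imp_finite[OF K])
    show "p ` ?M \<subseteq> K" using \<xi> unfolding p_def by blast
    fix S' assume S': "S' \<subseteq> p ` ?M"
    show "closedin X S'"
    proof (rule closedin_of_finite_interiors)
      show "S' \<subseteq> topspace X"
        using S' \<xi> compactin_subset_topspace[OF K] unfolding p_def by blast
      fix e assume e: "e \<in> E"
      have "{x \<in> disc_interior (dim e). char e x \<in> S'} \<subseteq> {\<xi> e}"
      proof
        fix x assume x: "x \<in> {x \<in> disc_interior (dim e). char e x \<in> S'}"
        then obtain e' where e': "e' \<in> ?M" "char e x = char e' (\<xi> e')" using S' unfolding p_def by blast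
        then have "e = e' \<and> x = \<xi> e'" using interior_inj[OF e, of e' x "\<xi> e'"] x \<xi>[OF e'(1)] by blast
        then show "x \<in> {\<xi> e}" by blast
      qed
      then show "finite {x \<in> disc_interior (dim e). char e x \<in> S'}" using finite_subset by blast
    qed
  qed
  ultimately show ?thesis using finite_image_iff by blast
qed

lemma compactin_closed_cell: "e \<in> E \<Longrightarrow> compactin X (char e ` topspace (disc (dim e)))"
  using image_compactin[OF _ char_continuous] compact_space_disc unfolding compact_space_def by blast

text \<open>Induction on dimension: the boundary of a cell is compact, so it meets finitely many
  open cells, all of lower dimension and hence contained in finite subcomplexes.\<close>

lemma finite_subcomplex_cell:
  assumes "e \<in> E"
  shows "\<exists>M. finite M \<and> subcomplex M \<and> e \<in> M"
  using assms
proof (induction "dim e" arbitrary: e rule: less_induct)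
  case less
  define faces where "faces = {e' \<in> E. \<exists>x\<in>disc_interior (dim e'). char e' x \<in> char e ` disc_boundary (dim e)}"
  have "compactin X (char e ` disc_boundary (dim e))"
    using image_compactin[OF _ char_continuous[OF less.prems]]
      closedin_compact_space[OF compact_space_disc closedin_disc_boundary] by blast
  then have fin: "finite faces" unfolding faces_def by (rule compactin_meets_finitely_many_cells)
  have "\<exists>M. finite M \<and> subcomplex M \<and> e' \<in> M" if e': "e' \<in> faces" for e'
  proof -
    obtain x where x: "x \<in> disc_interior (dim e')" "char e' x \<in> skeleton (dim e)"
      using e' boundary_skeleton[OF less.prems] unfolding faces_def by blast
    moreover have "e' \<in> E" using e' unfolding faces_def by blast
    ultimately show ?thesis using less.hyps[of e'] skeleton_cell[of e' x "dim e"] by simp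
  qed
  then have "\<forall>e'\<in>faces. \<exists>M. finite M \<and> subcomplex M \<and> e' \<in> M" by blast
  then obtain M where M: "\<And>e'. e' \<in> faces \<Longrightarrow> finite (M e') \<and> subcomplex (M e') \<and> e' \<in> M e'"
    using bchoice[of faces "\<lambda>e' M. finite M \<and> subcomplex M \<and> e' \<in> M"] by blast
  let ?M = "insert e (\<Union>e'\<in>faces. M e')"
  have "finite ?M" using fin M by blast
  moreover have "subcomplex ?M"
    unfolding subcomplex_def
  proof (intro conjI ballI subsetI)
    show "f \<in> E" if "f \<in> ?M" for f using that M less.prems unfolding subcomplex_def by blast
    fix f y assume f: "f \<in> ?M" and y: "y \<in> char f ` disc_boundary (dim f)"
    show "y \<in> (\<Union>e'\<in>?M. char e' ` disc_interior (dim e'))"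
    proof (cases "f = e")
      case True
      then have "y \<in> skeleton (dim e)" using y boundary_skeleton[OF less.prems] by blast
      then obtain e' x where "e' \<in> E" "x \<in> disc_interior (dim e')" "y = char e' x"
        unfolding skeleton_def by blast
      then have "e' \<in> faces" using y True unfolding faces_def by blast
      then have "e' \<in> ?M" using M by blast
      then show ?thesis using \<open>x \<in> disc_interior (dim e')\<close> \<open>y = char e' x\<close> by blast
    next
      case False
      then obtain e' where e': "e' \<in> faces" "f \<in> M e'" using f by blast
      then have "y \<in> (\<Union>e''\<in>M e'. char e'' ` disc_interior (dim e''))"
        using M[OF e'(1)] y unfolding subcomplex_def by blast
      then obtain e'' x where x: "e'' \<in> M e'" "x \<in> disc_interior (dim e'')" "y = char e'' x" by blast
      then have "e'' \<in> ?M" using e'(1) by blast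
      then show ?thesis by (rule UN_I) (use x in auto)
    qed
  qed
  ultimately show ?case by blast
qed

lemma finite_subcomplex:
  assumes "finite R" "R \<subseteq> E"
  shows "\<exists>M. finite M \<and> subcomplex M \<and> R \<subseteq> M"
proof -
  have "\<forall>e\<in>R. \<exists>M. finite M \<and> subcomplex M \<and> e \<in> M"
    using finite_subcomplex_cell assms(2) by blast
  then obtain M where M: "\<And>e. e \<in> R \<Longrightarrow> finite (M e) \<and> subcomplex (M e) \<and> e \<in> M e"
    using bchoice[of R "\<lambda>e M. finite M \<and> subcomplex M \<and> e \<in> M"] by blast
  have "subcomplex (\<Union>e\<in>R. M e)"
  proof (unfold subcomplex_def, intro conjI ballI subsetI)
    show "f \<in> E" if f: "f \<in> (\<Union>e\<in>R. M e)" for f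
    proof -
      obtain e where "e \<in> R" "f \<in> M e" using f by blast
      then show ?thesis using M[of e] by (auto simp: subcomplex_def)
    qed
    fix f y assume "f \<in> (\<Union>e\<in>R. M e)" and y: "y \<in> char f ` disc_boundary (dim f)"
    then obtain e where e: "e \<in> R" "f \<in> M e" by blast
    then have "y \<in> (\<Union>e'\<in>M e. char e' ` disc_interior (dim e'))"
      using M[OF e(1)] y unfolding subcomplex_def by blast
    then obtain e' x where x: "e' \<in> M e" "x \<in> disc_interior (dim e')" "y = char e' x" by blast
    then have "e' \<in> (\<Union>e\<in>R. M e)" using e(1) by blast
    then show "y \<in> (\<Union>e'\<in>(\<Union>e\<in>R. M e). char e' ` disc_interior (dim e'))"
      by (rule UN_I) (use x in auto)
  qed
  moreover have "finite (\<Union>e\<in>R. M e)" using M assms(1) by blast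
  ultimately show ?thesis using M by (intro exI[of _ "\<Union>e\<in>R. M e"]) blast
qed

lemma continuous_map_prod_from_skeleton:
  assumes J: "compact (J :: real set)"
    and h: "\<And>e. e \<in> E \<Longrightarrow> dim e < n \<Longrightarrow>
      continuous_map (prod_topology (top_of_set J) (disc (dim e))) V (\<lambda>(j, x). h (j, char e x))"
  shows "continuous_map (prod_topology (top_of_set J) (subtopology X (skeleton n))) V h"
proof (rule continuous_map_prod_from_pieces[where E = "{e \<in> E. dim e < n}" and D = "\<lambda>e. disc (dim e)" and \<psi> = char])
  show "continuous_map (disc (dim e)) (subtopology X (skeleton n)) (char e)"
    if "e \<in> {e \<in> E. dim e < n}" for e
    using that char_continuous skeleton_memI by (auto simp: continuous_map_in_subtopology)
  show "topspace (subtopology X (skeleton n)) \<subseteq> (\<Union>e\<in>{e \<in> E. dim e < n}. char e ` topspace (disc (dim e)))"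
    unfolding skeleton_def using interior_disc by fastforce
  fix S assume S: "S \<subseteq> topspace (subtopology X (skeleton n))"
    and "\<And>e. e \<in> {e \<in> E. dim e < n} \<Longrightarrow> closedin (disc (dim e)) {x \<in> topspace (disc (dim e)). char e x \<in> S}"
  then have "closedin X S" by (intro closedin_skeletonI[of S n]) auto
  then show "closedin (subtopology X (skeleton n)) S"
    using S by (intro closedin_subset_topspace) auto
next
  show "locally_compact_space (top_of_set J)"
    using J by (intro compact_imp_locally_compact_space) (simp add: compact_space_subtopology compactin_euclidean_iff)
  show "Hausdorff_space (top_of_set J)" by (simp add: Hausdorff_space_subtopology)
qed (use h in auto)

lemma continuous_map_prod_from_cells:
  assumes J: "compact (J :: real set)"
    and h: "\<And>e. e \<in> E \<Longrightarrow>
      continuous_map (prod_topology (top_of_set J) (disc (dim e))) V (\<lambda>(j, x). h (j, char e x))"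
  shows "continuous_map (prod_topology (top_of_set J) X) V h"
proof (rule continuous_map_prod_from_pieces[where E = E and D = "\<lambda>e. disc (dim e)" and \<psi> = char])
  show "topspace X \<subseteq> (\<Union>e\<in>E. char e ` topspace (disc (dim e)))"
    using cells_cover interior_disc by fastforce
  show "locally_compact_space (top_of_set J)"
    using J by (intro compact_imp_locally_compact_space) (simp add: compact_space_subtopology compactin_euclidean_iff)
  show "Hausdorff_space (top_of_set J)" by (simp add: Hausdorff_space_subtopology)
qed (use h char_continuous closedin_by_cells in auto)

end

section \<open>Equivariant extension and quotients by locally finite groups\<close>

context cellular_action
begin

text \<open>The choice depends on the orbit as a set and not on the cell, so all cells of an orbit
  get the same representative.\<close>

definition rep :: "'g set \<Rightarrow> 'e \<Rightarrow> 'e" where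
  "rep K e = (SOME e'. e' \<in> (\<lambda>k. act k e) ` K)"

lemma
  assumes K: "subgroup K G" and e: "e \<in> E"
  shows rep_orbit: "\<exists>k\<in>K. act k e = rep K e"
    and rep_act: "k \<in> K \<Longrightarrow> rep K (act k e) = rep K e"
    and rep_inv: "\<exists>k\<in>K. act k (rep K e) = e"
    and rep_cell: "rep K e \<in> E" "dim (rep K e) = dim e"
proof -
  interpret subgroup K G by fact
  have "act \<one>\<^bsub>G\<^esub> e \<in> (\<lambda>k. act k e) ` K" using one_closed by (rule imageI)
  then have "rep K e \<in> (\<lambda>k. act k e) ` K"
    unfolding rep_def by (rule someI[where P = "\<lambda>e'. e' \<in> (\<lambda>k. act k e) ` K"])
  then obtain k where k: "k \<in> K" "act k e = rep K e" by auto
  then show "\<exists>k\<in>K. act k e = rep K e" by (rule bexI[rotated])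
  show "rep K e \<in> E" "dim (rep K e) = dim e"
    using k e act_cell[of k e] act_dim[of k e] by auto
  show "\<exists>k\<in>K. act k (rep K e) = e"
    using k e act_inv[of k e] m_inv_closed[of k] by (intro bexI[of _ "inv\<^bsub>G\<^esub> k"]) auto
  show "rep K (act k e) = rep K e" if k: "k \<in> K" for k
  proof -
    have "(\<lambda>l. act l (act k e)) ` K = (\<lambda>l. act l e) ` K"
    proof (intro equalityI subsetI)
      fix f assume "f \<in> (\<lambda>l. act l (act k e)) ` K"
      then obtain l where "l \<in> K" "f = act l (act k e)" by auto
      then show "f \<in> (\<lambda>l. act l e) ` K"
        using k e by (intro image_eqI[of _ _ "l \<otimes>\<^bsub>G\<^esub> k"]) (auto simp: act_mult)
    next
      fix f assume "f \<in> (\<lambda>l. act l e) ` K"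
      then obtain l where l: "l \<in> K" "f = act l e" by auto
      have "f = act (l \<otimes>\<^bsub>G\<^esub> inv\<^bsub>G\<^esub> k) (act k e)"
        using l k e by (simp add: act_mult act_inv act_cell group.inv_closed[OF grp])
      then show "f \<in> (\<lambda>l. act l (act k e)) ` K"
        using l k by (intro image_eqI[of _ _ "l \<otimes>\<^bsub>G\<^esub> inv\<^bsub>G\<^esub> k"]) auto
    qed
    then show ?thesis by (simp add: rep_def)
  qed
qed

definition cell_of :: "'x \<Rightarrow> 'e \<times> (nat \<Rightarrow> real)" where
  "cell_of y = (SOME (e, a). e \<in> E \<and> a \<in> disc_interior (dim e) \<and> char e a = y)"

lemma cell_of_char:
  assumes "e \<in> E" "a \<in> disc_interior (dim e)"
  shows "cell_of (char e a) = (e, a)"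
  unfolding cell_of_def
proof (rule some_equality)
  show "case (e, a) of (e', a') \<Rightarrow> e' \<in> E \<and> a' \<in> disc_interior (dim e') \<and> char e' a' = char e a"
    using assms by simp
  show "p = (e, a)"
    if "case p of (e', a') \<Rightarrow> e' \<in> E \<and> a' \<in> disc_interior (dim e') \<and> char e' a' = char e a" for p
    using that interior_inj[of "fst p" e "snd p" a] assms by (auto simp: case_prod_unfold prod_eq_iff)
qed

end

text \<open>The setting of equivariant obstruction theory. A group element that maps a cell to
  itself fixes the cell pointwise, so an equivariant map must send the cell into the fixed points of
  the cell's stabilizer. The hypothesis \<open>fixed\<close> therefore asks for extensions inside
  that fixed set.\<close>

locale equivariant_extension = cellular_action G X \<alpha> E dim char act skeleton
  for G :: "('g, 'm) monoid_scheme" and X :: "'x topology" and \<alpha>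
    and E :: "'e set" and dim char act skeleton +
  fixes K :: "'g set" and V :: "'v topology" and \<gamma> :: "'g \<Rightarrow> 'v \<Rightarrow> 'v"
    and J J\<^sub>0 :: "real set" and h\<^sub>0 :: "real \<times> 'x \<Rightarrow> 'v"
  assumes K: "subgroup K G"
    and target_continuous: "k \<in> K \<Longrightarrow> continuous_map V V (\<gamma> k)"
    and target_mult: "k \<in> K \<Longrightarrow> l \<in> K \<Longrightarrow> v \<in> topspace V \<Longrightarrow> \<gamma> (k \<otimes>\<^bsub>G\<^esub> l) v = \<gamma> k (\<gamma> l v)"
    and J: "compact J" "closed J\<^sub>0" "J\<^sub>0 \<subseteq> J"
    and fixed: "e \<in> E \<Longrightarrow> extends_over_cells J J\<^sub>0
      (subtopology V {v \<in> topspace V. \<forall>k\<in>K. act k e = e \<longrightarrow> \<gamma> k v = v})"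
    and initial_continuous: "continuous_map (prod_topology (top_of_set J\<^sub>0) X) V h\<^sub>0"
    and initial_equivariant: "k \<in> K \<Longrightarrow> t \<in> J\<^sub>0 \<Longrightarrow> x \<in> topspace X \<Longrightarrow>
      h\<^sub>0 (t, \<alpha> k x) = \<gamma> k (h\<^sub>0 (t, x))"
begin

text \<open>\<open>h\<close> is a total function but is constrained only on cells of dimension below
  \<open>n\<close>. Continuity is recorded cell by cell, a form that passes to the next skeleton and
  to the limit.\<close>

definition extends_to :: "nat \<Rightarrow> (real \<times> 'x \<Rightarrow> 'v) \<Rightarrow> bool" where
  "extends_to n h \<longleftrightarrow>
    (\<forall>e\<in>E. dim e < n \<longrightarrow>
      continuous_map (prod_topology (top_of_set J) (disc (dim e))) V (\<lambda>(t, a). h (t, char e a))) \<and>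
    (\<forall>k\<in>K. \<forall>t\<in>J. \<forall>x\<in>skeleton n. h (t, \<alpha> k x) = \<gamma> k (h (t, x))) \<and>
    (\<forall>t\<in>J\<^sub>0. \<forall>x\<in>skeleton n. h (t, x) = h\<^sub>0 (t, x))"

lemma K_carrier: "k \<in> K \<Longrightarrow> k \<in> carrier G"
  using K by (rule subgroup.mem_carrier)

lemma extend_over_cell:
  assumes h: "extends_to n h" and e: "e \<in> E" "dim e = n"
  shows "\<exists>v. continuous_map (prod_topology (top_of_set J) (disc n)) V v \<and>
    (\<forall>t\<in>J. \<forall>a\<in>disc_boundary n. v (t, a) = h (t, char e a)) \<and>
    (\<forall>t\<in>J\<^sub>0. \<forall>a\<in>topspace (disc n). v (t, a) = h\<^sub>0 (t, char e a)) \<and>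
    (\<forall>t\<in>J. \<forall>a\<in>topspace (disc n). \<forall>k\<in>K. act k e = e \<longrightarrow> \<gamma> k (v (t, a)) = v (t, a))"
proof -
  let ?P = "prod_topology (top_of_set J) (disc n)"
  let ?B1 = "J \<times> disc_boundary n" and ?B2 = "J\<^sub>0 \<times> topspace (disc n)"
  let ?B = "?B1 \<union> ?B2"
  let ?F = "{v \<in> topspace V. \<forall>k\<in>K. act k e = e \<longrightarrow> \<gamma> k v = v}"
  \<comment> \<open>On the boundary of the cell the values come from the lower skeleton, over
    \<open>J\<^sub>0\<close> from the prescribed map. Both pieces are closed and the maps agree on
    the overlap, so they glue.\<close>
  define w where "w = (\<lambda>(t, a). if a \<in> disc_boundary n then h (t, char e a) else h\<^sub>0 (t, char e a))"
  have h_cont: "continuous_map (prod_topology (top_of_set J) (subtopology X (skeleton n))) V h"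
    using h unfolding extends_to_def by (intro continuous_map_prod_from_skeleton[OF J(1)]) blast
  have h_equiv: "\<And>k t x. k \<in> K \<Longrightarrow> t \<in> J \<Longrightarrow> x \<in> skeleton n \<Longrightarrow> h (t, \<alpha> k x) = \<gamma> k (h (t, x))"
    and h_init: "\<And>t x. t \<in> J\<^sub>0 \<Longrightarrow> x \<in> skeleton n \<Longrightarrow> h (t, x) = h\<^sub>0 (t, x)"
    using h unfolding extends_to_def by blast+
  have bd: "char e a \<in> skeleton n" if "a \<in> disc_boundary n" for a
    using boundary_skeleton[OF e(1)] e(2) that by blast
  have ch: "char e a \<in> topspace X" if "a \<in> topspace (disc n)" for a
    using char_topspace[OF e(1)] e(2) that by blast
  have ch_cont: "continuous_map (disc n) X (char e)" using char_continuous[OF e(1)] e(2) by simp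
  have c1: "continuous_map (subtopology ?P ?B1) V (\<lambda>(t, a). h (t, char e a))"
  proof -
    have "continuous_map (subtopology ?P ?B1) (prod_topology (top_of_set J) (subtopology X (skeleton n)))
        (\<lambda>z. (fst z, char e (snd z)))"
    proof (rule continuous_map_pairedI)
      show "continuous_map (subtopology ?P ?B1) (top_of_set J) fst"
        by (rule continuous_map_from_subtopology[OF continuous_map_fst])
      have "continuous_map (subtopology ?P ?B1) X (char e \<circ> snd)"
        by (rule continuous_map_from_subtopology[OF continuous_map_compose[OF continuous_map_snd ch_cont]])
      then show "continuous_map (subtopology ?P ?B1) (subtopology X (skeleton n)) (\<lambda>z. char e (snd z))"
        using bd by (auto simp: continuous_map_in_subtopology o_def)
    qed
    from continuous_map_compose[OF this h_cont] show ?thesis by (simp add: o_def case_prod_unfold)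
  qed
  have c2: "continuous_map (subtopology ?P ?B2) V (\<lambda>(t, a). h\<^sub>0 (t, char e a))"
  proof -
    have "continuous_map (subtopology ?P ?B2) (prod_topology (top_of_set J\<^sub>0) X)
        (\<lambda>z. (fst z, char e (snd z)))"
    proof (rule continuous_map_pairedI)
      have "continuous_map (subtopology ?P ?B2) (top_of_set J) fst"
        by (rule continuous_map_from_subtopology[OF continuous_map_fst])
      then show "continuous_map (subtopology ?P ?B2) (top_of_set J\<^sub>0) fst"
        by (auto simp: continuous_map_in_subtopology)
      have "continuous_map (subtopology ?P ?B2) X (char e \<circ> snd)"
        by (rule continuous_map_from_subtopology[OF continuous_map_compose[OF continuous_map_snd ch_cont]])
      then show "continuous_map (subtopology ?P ?B2) X (\<lambda>z. char e (snd z))" by (simp add: o_def)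
    qed
    from continuous_map_compose[OF this initial_continuous] show ?thesis
      by (simp add: o_def case_prod_unfold)
  qed
  let ?f1 = "\<lambda>(t, a). h (t, char e a)" and ?f2 = "\<lambda>(t, a). h\<^sub>0 (t, char e a)"
  have agree: "h (t, char e a) = h\<^sub>0 (t, char e a)" if "t \<in> J\<^sub>0" "a \<in> disc_boundary n" for t a
    using h_init[OF that(1) bd[OF that(2)]] .
  have cl1: "closedin ?P ?B1"
    using closedin_relative_boundary[of "{}" J n] by simp
  have cl2: "closedin ?P ?B2"
    using J by (simp add: closedin_prod_Times_iff closed_subset)
  have w_cont: "continuous_map (subtopology ?P ?B) V w"
  proof (rule pasting_lemma_closed[where I = "{True, False}" and T = "\<lambda>b. if b then ?B1 else ?B2"
        and f = "\<lambda>b. if b then ?f1 else ?f2"])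
    show "closedin (subtopology ?P ?B) (if b then ?B1 else ?B2)" for b
      using cl1 cl2 by (auto intro: closedin_subset_topspace)
    show "continuous_map (subtopology (subtopology ?P ?B) (if b then ?B1 else ?B2)) V
        (if b then ?f1 else ?f2)" for b
    proof -
      have "?B \<inter> ?B1 = ?B1" "?B \<inter> ?B2 = ?B2" by auto
      then show ?thesis using c1 c2 by (cases b) (simp_all only: subtopology_subtopology if_True if_False)
    qed
  next
    fix z assume "z \<in> topspace (subtopology ?P ?B)"
    then show "\<exists>b. b \<in> {True, False} \<and> z \<in> (if b then ?B1 else ?B2) \<and>
        w z = (if b then ?f1 else ?f2) z"
      by (cases "snd z \<in> disc_boundary n")
        (auto simp: w_def intro!: exI[of _ "snd z \<in> disc_boundary n"] dest: J(3)[THEN subsetD])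
  next
    show "(if i then ?f1 else ?f2) z =
        (if j then ?f1 else ?f2) z"
      if "z \<in> topspace (subtopology ?P ?B) \<inter> (if i then ?B1 else ?B2) \<inter> (if j then ?B1 else ?B2)" for i j z
      using that agree by (cases i; cases j) auto
  qed auto
  have "w z \<in> ?F" if z: "z \<in> topspace (subtopology ?P ?B)" for z
  proof -
    obtain t a where ta: "z = (t, a)" "t \<in> J" "a \<in> topspace (disc n)" "a \<in> disc_boundary n \<or> t \<in> J\<^sub>0"
      using z by (cases z) auto
    have "\<gamma> k (w z) = w z" if k: "k \<in> K" "act k e = e" for k
    proof -
      have eq: "\<alpha> k (char e a) = char e a"
        using act_char[of k e a] k ta(3) e by (simp add: K_carrier)
      show ?thesis
      proof (cases "a \<in> disc_boundary n")
        case True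
        then show ?thesis using h_equiv[OF k(1) ta(2) bd[OF True]] eq by (simp add: w_def ta(1))
      next
        case False
        then have "t \<in> J\<^sub>0" using ta(4) by simp
        then show ?thesis using initial_equivariant[OF k(1) _ ch[OF ta(3)], of t] eq False
          by (simp add: w_def ta(1))
      qed
    qed
    moreover have "w z \<in> topspace V"
      using continuous_map_funspace[OF w_cont] z by (rule funcset_mem)
    ultimately show ?thesis by simp
  qed
  with w_cont have "continuous_map (subtopology ?P ?B) (subtopology V ?F) w"
    unfolding continuous_map_in_subtopology by (intro conjI funcsetI)
  then obtain v where v: "continuous_map ?P (subtopology V ?F) v" "\<forall>p\<in>?B. v p = w p"
    using fixed[OF e(1)] unfolding extends_over_cells_def by blast
  have "v (t, a) \<in> ?F" if "t \<in> J" "a \<in> topspace (disc n)" for t a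
    using continuous_map_funspace[OF v(1)] that by (auto simp: Pi_iff)
  then show ?thesis
    using v(2) agree
    by (intro exI[of _ v] conjI continuous_map_into_fulltopology[OF v(1)])
      (auto simp: w_def)
qed

text \<open>One cell in each \<open>K\<close>-orbit is treated by \<open>extend_over_cell\<close>,
  the others by translation. The translating element is unique only up to the stabilizer of the
  representative, and the chosen values are fixed by that stabilizer.\<close>

lemma extend_step:
  assumes h: "extends_to n h"
  shows "\<exists>h'. extends_to (Suc n) h' \<and> (\<forall>t\<in>J. \<forall>x\<in>skeleton n. h' (t, x) = h (t, x))"
proof -
  interpret KG: subgroup K G by (rule K)
  let ?good = "\<lambda>e v. continuous_map (prod_topology (top_of_set J) (disc n)) V v \<and>
    (\<forall>t\<in>J. \<forall>a\<in>disc_boundary n. v (t, a) = h (t, char e a)) \<and>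
    (\<forall>t\<in>J\<^sub>0. \<forall>a\<in>topspace (disc n). v (t, a) = h\<^sub>0 (t, char e a)) \<and>
    (\<forall>t\<in>J. \<forall>a\<in>topspace (disc n). \<forall>k\<in>K. act k e = e \<longrightarrow> \<gamma> k (v (t, a)) = v (t, a))"
  have "\<forall>e\<in>{e \<in> E. dim e = n}. \<exists>v. ?good e v"
    using extend_over_cell[OF h] by simp
  then have "\<exists>v. \<forall>e\<in>{e \<in> E. dim e = n}. ?good e (v e)" by (rule bchoice)
  then obtain v where "\<forall>e\<in>{e \<in> E. dim e = n}. ?good e (v e)" by (elim exE) (rule that)
  then have v: "\<And>e. e \<in> E \<Longrightarrow> dim e = n \<Longrightarrow> ?good e (v e)" by simp
  have v_cont: "\<And>e. e \<in> E \<Longrightarrow> dim e = n \<Longrightarrow> continuous_map (prod_topology (top_of_set J) (disc n)) V (v e)"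
    and v_bd: "\<And>e t a. e \<in> E \<Longrightarrow> dim e = n \<Longrightarrow> t \<in> J \<Longrightarrow> a \<in> disc_boundary n \<Longrightarrow>
      v e (t, a) = h (t, char e a)"
    and v_init: "\<And>e t a. e \<in> E \<Longrightarrow> dim e = n \<Longrightarrow> t \<in> J\<^sub>0 \<Longrightarrow> a \<in> topspace (disc n) \<Longrightarrow>
      v e (t, a) = h\<^sub>0 (t, char e a)"
    and v_fix: "\<And>e t a k. e \<in> E \<Longrightarrow> dim e = n \<Longrightarrow> t \<in> J \<Longrightarrow> a \<in> topspace (disc n) \<Longrightarrow>
      k \<in> K \<Longrightarrow> act k e = e \<Longrightarrow> \<gamma> k (v e (t, a)) = v e (t, a)"
    using v by simp_all
  have v_top: "v e (t, a) \<in> topspace V" if "e \<in> E" "dim e = n" "t \<in> J" "a \<in> topspace (disc n)" for e t a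
    using continuous_map_funspace[OF v_cont[OF that(1,2)]] that(3,4) by (auto simp: Pi_iff)
  define \<kappa> where "\<kappa> e = (SOME k. k \<in> K \<and> act k (rep K e) = e)" for e
  have \<kappa>: "\<kappa> e \<in> K \<and> act (\<kappa> e) (rep K e) = e" if "e \<in> E" for e
  proof -
    have "\<exists>k. k \<in> K \<and> act k (rep K e) = e" using rep_inv[OF K that] by (simp add: Bex_def)
    then show ?thesis unfolding \<kappa>_def by (rule someI_ex)
  qed
  define h' where "h' = (\<lambda>(t, y). if y \<in> skeleton n then h (t, y)
    else case cell_of y of (e, a) \<Rightarrow> \<gamma> (\<kappa> e) (v (rep K e) (t, a)))"
  have h_equiv: "\<And>k t x. k \<in> K \<Longrightarrow> t \<in> J \<Longrightarrow> x \<in> skeleton n \<Longrightarrow> h (t, \<alpha> k x) = \<gamma> k (h (t, x))"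
    and h_init: "\<And>t x. t \<in> J\<^sub>0 \<Longrightarrow> x \<in> skeleton n \<Longrightarrow> h (t, x) = h\<^sub>0 (t, x)"
    and h_cell: "\<And>e. e \<in> E \<Longrightarrow> dim e < n \<Longrightarrow>
      continuous_map (prod_topology (top_of_set J) (disc (dim e))) V (\<lambda>(t, a). h (t, char e a))"
    using h unfolding extends_to_def by simp_all
  have old: "h' (t, y) = h (t, y)" if "y \<in> skeleton n" for t y
    using that by (simp add: h'_def)
  have char_rep: "\<alpha> (\<kappa> e) (char (rep K e) a) = char e a" if "e \<in> E" "a \<in> topspace (disc (dim e))" for e a
    using act_char[of "\<kappa> e" "rep K e" a] \<kappa>[OF that(1)] rep_cell[OF K that(1)] that(2) K_carrier by simp
  \<comment> \<open>The formula for new cells also holds on their boundary, where it reduces to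
    equivariance of \<open>h\<close>; this is what makes \<open>h'\<close> continuous on closed
    cells.\<close>
  have new: "h' (t, char e a) = \<gamma> (\<kappa> e) (v (rep K e) (t, a))"
    if e: "e \<in> E" "dim e = n" and t: "t \<in> J" and a: "a \<in> topspace (disc n)" for e t a
  proof (cases "a \<in> disc_boundary n")
    case True
    have "char e a \<in> skeleton n" using boundary_skeleton[OF e(1)] e(2) True by auto
    then have "h' (t, char e a) = h (t, \<alpha> (\<kappa> e) (char (rep K e) a))"
      using old char_rep[OF e(1)] a e(2) by simp
    also have "\<dots> = \<gamma> (\<kappa> e) (h (t, char (rep K e) a))"
    proof (rule h_equiv)
      show "char (rep K e) a \<in> skeleton n"
        using boundary_skeleton[OF rep_cell(1)[OF K e(1)]] rep_cell(2)[OF K e(1)] e(2) True by auto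
    qed (use \<kappa>[OF e(1)] t in auto)
    also have "h (t, char (rep K e) a) = v (rep K e) (t, a)"
      using v_bd[OF rep_cell(1)[OF K e(1)] _ t True] rep_cell(2)[OF K e(1)] e(2) by simp
    finally show ?thesis .
  next
    case False
    then have "a \<in> disc_interior (dim e)" using a e(2) by (simp add: topspace_disc_split)
    then show ?thesis
      using skeleton_cell[OF e(1), of a n] cell_of_char[OF e(1), of a] e(2) by (simp add: h'_def)
  qed
  have coords: "\<exists>e a. e \<in> E \<and> dim e = n \<and> a \<in> topspace (disc n) \<and> y = char e a"
    if y: "y \<in> skeleton (Suc n)" "y \<notin> skeleton n" for y
  proof -
    obtain e a where ea: "e \<in> E" "dim e < Suc n" "a \<in> disc_interior (dim e)" "y = char e a"
      using y(1) unfolding skeleton_def by auto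
    then have "dim e = n" using skeleton_cell[of e a n] y(2) by simp
    then show ?thesis using ea interior_disc by (intro exI[of _ e] exI[of _ a]) simp
  qed
  have "extends_to (Suc n) h'"
    unfolding extends_to_def
  proof (intro conjI ballI impI)
    fix e assume e: "e \<in> E" "dim e < Suc n"
    show "continuous_map (prod_topology (top_of_set J) (disc (dim e))) V (\<lambda>(t, a). h' (t, char e a))"
    proof (cases "dim e = n")
      case True
      have r: "rep K e \<in> E" "dim (rep K e) = n" using rep_cell[OF K e(1)] True by auto
      have "continuous_map (prod_topology (top_of_set J) (disc n)) V (\<gamma> (\<kappa> e) \<circ> v (rep K e))"
        using continuous_map_compose[OF v_cont[OF r]] target_continuous \<kappa>[OF e(1)] by blast
      then have "continuous_map (prod_topology (top_of_set J) (disc n)) V (\<lambda>(t, a). h' (t, char e a))"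
        by (rule continuous_map_eq) (use new[OF e(1) True] in auto)
      then show ?thesis using True by simp
    next
      case False
      then have n: "dim e < n" using e by simp
      show ?thesis
        by (rule continuous_map_eq[OF h_cell[OF e(1) n]])
          (use old skeleton_memI[OF e(1) n] in auto)
    qed
  next
    fix t y assume t: "t \<in> J\<^sub>0" and y: "y \<in> skeleton (Suc n)"
    show "h' (t, y) = h\<^sub>0 (t, y)"
    proof (cases "y \<in> skeleton n")
      case True
      then show ?thesis using old h_init t by simp
    next
      case False
      obtain e a where ea: "e \<in> E" "dim e = n" "a \<in> topspace (disc n)" "y = char e a"
        using coords[OF y False] by auto
      have r: "rep K e \<in> E" "dim (rep K e) = n" using rep_cell[OF K ea(1)] ea(2) by auto
      have tJ: "t \<in> J" using t J(3) by auto
      have "h' (t, y) = \<gamma> (\<kappa> e) (h\<^sub>0 (t, char (rep K e) a))"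
        using new[OF ea(1,2) tJ ea(3)] v_init[OF r t ea(3)] ea(4) by simp
      also have "\<dots> = h\<^sub>0 (t, \<alpha> (\<kappa> e) (char (rep K e) a))"
        using initial_equivariant[of "\<kappa> e" t "char (rep K e) a"] \<kappa>[OF ea(1)] t char_topspace[OF r(1)] r(2) ea(3)
        by simp
      finally show ?thesis using char_rep[OF ea(1)] ea by simp
    qed
  next
    fix k t y assume k: "k \<in> K" and t: "t \<in> J" and y: "y \<in> skeleton (Suc n)"
    show "h' (t, \<alpha> k y) = \<gamma> k (h' (t, y))"
    proof (cases "y \<in> skeleton n")
      case True
      then show ?thesis using old h_equiv[OF k t] action_skeleton[OF K_carrier[OF k]] by simp
    next
      case False
      obtain e a where ea: "e \<in> E" "dim e = n" "a \<in> topspace (disc n)" "y = char e a"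
        using coords[OF y False] by auto
      let ?r = "rep K e" and ?f = "act k e"
      have r: "?r \<in> E" "dim ?r = n" using rep_cell[OF K ea(1)] ea(2) by auto
      have f: "?f \<in> E" "dim ?f = n" "rep K ?f = ?r"
        using act_cell[OF K_carrier[OF k] ea(1)] act_dim[OF K_carrier[OF k] ea(1)] rep_act[OF K ea(1) k] ea(2)
        by auto
      have \<kappa>e: "\<kappa> e \<in> K" "act (\<kappa> e) ?r = e" using \<kappa>[OF ea(1)] by auto
      have \<kappa>f: "\<kappa> ?f \<in> K" "act (\<kappa> ?f) ?r = ?f" using \<kappa>[OF f(1)] f(3) by auto
      \<comment> \<open>The discrepancy between moving the representative directly to
        \<open>?f\<close> and moving it first to \<open>e\<close> and then by \<open>k\<close>. It
        stabilizes the representative, so it fixes the values of \<open>v\<close>.\<close>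
      let ?l = "inv\<^bsub>G\<^esub> (\<kappa> ?f) \<otimes>\<^bsub>G\<^esub> (k \<otimes>\<^bsub>G\<^esub> \<kappa> e)"
      have l: "?l \<in> K" using k \<kappa>e(1) \<kappa>f(1) by simp
      have kk: "k \<otimes>\<^bsub>G\<^esub> \<kappa> e = \<kappa> ?f \<otimes>\<^bsub>G\<^esub> ?l"
        using K_carrier[OF k] K_carrier[OF \<kappa>e(1)] K_carrier[OF \<kappa>f(1)]
        by (simp add: group.inv_cancel_left[OF grp] group.subgroup_self[OF grp] subgroup.m_closed)
      have "act ?l ?r = act (inv\<^bsub>G\<^esub> (\<kappa> ?f)) (act (k \<otimes>\<^bsub>G\<^esub> \<kappa> e) ?r)"
        using K_carrier k \<kappa>e(1) \<kappa>f(1) r(1) by (intro act_mult) auto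
      also have "act (k \<otimes>\<^bsub>G\<^esub> \<kappa> e) ?r = ?f"
        using act_mult[of k "\<kappa> e" ?r] K_carrier k \<kappa>e r(1) by simp
      also have "act (inv\<^bsub>G\<^esub> (\<kappa> ?f)) ?f = ?r"
        using act_inv[OF K_carrier[OF \<kappa>f(1)] r(1)] \<kappa>f(2) by simp
      finally have lr: "act ?l ?r = ?r" .
      let ?v = "v ?r (t, a)"
      have vt: "?v \<in> topspace V" using v_top[OF r t ea(3)] .
      have "\<alpha> k y = char ?f a" using act_char[OF K_carrier[OF k] ea(1)] ea by simp
      then have "h' (t, \<alpha> k y) = \<gamma> (\<kappa> ?f) ?v" using new[OF f(1,2) t ea(3)] f(3) by simp
      also have "\<dots> = \<gamma> (\<kappa> ?f) (\<gamma> ?l ?v)" using v_fix[OF r t ea(3) l lr] by simp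
      also have "\<dots> = \<gamma> (k \<otimes>\<^bsub>G\<^esub> \<kappa> e) ?v" using target_mult[OF \<kappa>f(1) l vt] kk by simp
      also have "\<dots> = \<gamma> k (\<gamma> (\<kappa> e) ?v)" using target_mult[OF k \<kappa>e(1) vt] .
      also have "\<gamma> (\<kappa> e) ?v = h' (t, y)" using new[OF ea(1,2) t ea(3)] ea(4) by simp
      finally show ?thesis .
    qed
  qed
  then show ?thesis using old by (intro exI[of _ h']) simp
qed

theorem extension_exists:
  "\<exists>h. continuous_map (prod_topology (top_of_set J) X) V h \<and>
    (\<forall>t\<in>J\<^sub>0. \<forall>x\<in>topspace X. h (t, x) = h\<^sub>0 (t, x)) \<and>
    (\<forall>k\<in>K. \<forall>t\<in>J. \<forall>x\<in>topspace X. h (t, \<alpha> k x) = \<gamma> k (h (t, x)))"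
proof -
  have "\<exists>f. \<forall>n. extends_to n (f n) \<and> (\<forall>t\<in>J. \<forall>x\<in>skeleton n. f (Suc n) (t, x) = f n (t, x))"
  proof (rule dependent_nat_choice)
    show "\<exists>h. extends_to 0 h" by (simp add: extends_to_def skeleton_0)
    show "\<exists>h'. extends_to (Suc n) h' \<and> (\<forall>t\<in>J. \<forall>x\<in>skeleton n. h' (t, x) = h (t, x))"
      if "extends_to n h" for h n
      using extend_step[OF that] .
  qed
  then obtain f where f: "\<And>n. extends_to n (f n)"
    and f_step: "\<And>n t x. t \<in> J \<Longrightarrow> x \<in> skeleton n \<Longrightarrow> f (Suc n) (t, x) = f n (t, x)"
    by blast
  have stable: "f m (t, x) = f n (t, x)" if "n \<le> m" "t \<in> J" "x \<in> skeleton n" for m n t x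
    using that(1)
  proof (induction m rule: dec_induct)
    case (step m)
    then show ?case using f_step[of t x m] that skeleton_mono[of n m] by auto
  qed simp
  \<comment> \<open>Later stages agree with earlier ones on the earlier skeleton, so the value at
    \<open>x\<close> may be read off at the first skeleton that contains \<open>x\<close>.\<close>
  define h where "h = (\<lambda>(t, x). f (LEAST n. x \<in> skeleton n) (t, x))"
  have h: "h (t, x) = f n (t, x)" if "t \<in> J" "x \<in> skeleton n" for n t x
    using stable[of "LEAST n. x \<in> skeleton n" n t x] that LeastI[of "\<lambda>n. x \<in> skeleton n" n]
      Least_le[of "\<lambda>n. x \<in> skeleton n" n] by (simp add: h_def)
  have "continuous_map (prod_topology (top_of_set J) X) V h"
  proof (rule continuous_map_prod_from_cells[OF J(1)])
    fix e assume e: "e \<in> E"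
    let ?n = "Suc (dim e)"
    have "continuous_map (prod_topology (top_of_set J) (disc (dim e))) V (\<lambda>(t, a). f ?n (t, char e a))"
      using f[of ?n] e unfolding extends_to_def by simp
    then show "continuous_map (prod_topology (top_of_set J) (disc (dim e))) V (\<lambda>(t, a). h (t, char e a))"
      by (rule continuous_map_eq) (use h[where n = ?n] skeleton_memI[OF e, of ?n] in auto)
  qed
  moreover have "h (t, x) = h\<^sub>0 (t, x)" if t: "t \<in> J\<^sub>0" and x: "x \<in> topspace X" for t x
  proof -
    obtain n where n: "x \<in> skeleton n" using skeleton_cover[OF x] by auto
    then show ?thesis using h[OF _ n, of t] f[of n] t J(3) unfolding extends_to_def by auto
  qed
  moreover have "h (t, \<alpha> k x) = \<gamma> k (h (t, x))" if k: "k \<in> K" and t: "t \<in> J" and x: "x \<in> topspace X" for k t x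
  proof -
    obtain n where n: "x \<in> skeleton n" using skeleton_cover[OF x] by auto
    then have "\<alpha> k x \<in> skeleton n" using action_skeleton K_carrier[OF k] by simp
    then show ?thesis using h[OF t n] h[OF t, of "\<alpha> k x" n] f[of n] k t n unfolding extends_to_def by simp
  qed
  ultimately show ?thesis by (intro exI[of _ h]) simp
qed

end

text \<open>The points of \<open>{0, 1}\<close> are open in it, so any two maps form continuous
  initial data for a homotopy between them.\<close>

lemma continuous_map_two_points:
  assumes f: "continuous_map X V f" and g: "continuous_map X V g"
  shows "continuous_map (prod_topology (top_of_set {0, 1::real}) X) V (\<lambda>(t, x). if t = 0 then f x else g x)"
  unfolding continuous_map_def
proof (intro conjI allI impI)
  let ?P = "prod_topology (top_of_set {0, 1::real}) X" and ?h = "\<lambda>(t::real, x). if t = 0 then f x else g x"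
  show "?h \<in> topspace ?P \<rightarrow> topspace V"
    using continuous_map_funspace[OF f] continuous_map_funspace[OF g] by (auto simp: Pi_iff)
  fix U assume U: "openin V U"
  have "{0, 1} \<inter> {..<1} = {0::real}" "{0, 1} \<inter> {0<..} = {1::real}" by auto
  then have "openin (top_of_set {0, 1::real}) {0}" "openin (top_of_set {0, 1::real}) {1}"
    using openin_open_Int[of "{..<1::real}" "{0,1}"] openin_open_Int[of "{0::real<..}" "{0,1}"] by auto
  then have "openin ?P ({0} \<times> {x \<in> topspace X. f x \<in> U} \<union> {1} \<times> {x \<in> topspace X. g x \<in> U})"
    using openin_continuous_map_preimage[OF f U] openin_continuous_map_preimage[OF g U]
    by (intro openin_Un) (auto simp: openin_prod_Times_iff)
  also have "{0} \<times> {x \<in> topspace X. f x \<in> U} \<union> {1} \<times> {x \<in> topspace X. g x \<in> U} =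
      {z \<in> topspace ?P. ?h z \<in> U}"
    by auto
  finally show "openin ?P {z \<in> topspace ?P. ?h z \<in> U}" .
qed

text \<open>The unit interval is locally compact, so the product of \<open>q\<close> with it is
  again a quotient map, through which \<open>h\<close> factors.\<close>

lemma homotopy_descends:
  assumes q: "quotient_map X X' q"
    and h: "continuous_map (prod_topology (top_of_set {0..1::real}) X) V h"
    and compat: "\<And>t x y. t \<in> {0..1} \<Longrightarrow> x \<in> topspace X \<Longrightarrow> y \<in> topspace X \<Longrightarrow> q x = q y \<Longrightarrow>
      h (t, x) = h (t, y)"
  shows "\<exists>h'. continuous_map (prod_topology (top_of_set {0..1::real}) X') V h' \<and>
    (\<forall>t\<in>{0..1}. \<forall>x\<in>topspace X. h' (t, q x) = h (t, x))"
proof -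
  let ?I = "top_of_set {0..1::real}"
  have "compact_space ?I" by (simp add: compact_space_subtopology compactin_euclidean_iff)
  then have "quotient_map (prod_topology ?I X) (prod_topology ?I X') (\<lambda>(t, x). (t, q x))"
    using q by (intro quotient_map_prod_right compact_imp_locally_compact_space)
      (auto simp: Hausdorff_space_subtopology)
  then have "\<exists>h'. continuous_map (prod_topology ?I X') V h' \<and>
      (\<forall>z\<in>topspace (prod_topology ?I X). h' ((\<lambda>(t, x). (t, q x)) z) = h z)"
  proof (rule quotient_map_lift[OF _ h])
    fix z z' assume z: "z \<in> topspace (prod_topology ?I X)" "z' \<in> topspace (prod_topology ?I X)"
      "(\<lambda>(t, x). (t, q x)) z = (\<lambda>(t, x). (t, q x)) z'"
    then show "h z = h z'" using compat[of "fst z" "snd z" "snd z'"] by (cases z; cases z') auto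
  qed
  then show ?thesis by auto
qed

context cellular_action
begin

section \<open>Orbit quotients and their compact subsets\<close>

abbreviation proj :: "'g set \<Rightarrow> 'x \<Rightarrow> 'x set" where
  "proj K \<equiv> orbit (G\<lparr>carrier := K\<rparr>) \<alpha>"

abbreviation quot :: "'g set \<Rightarrow> 'x set topology" where
  "quot K \<equiv> orbit_space (G\<lparr>carrier := K\<rparr>) X \<alpha>"

lemma proj_eq_image: "proj K x = (\<lambda>k. \<alpha> k x) ` K"
  by (auto simp: orbit_def)

lemma proj_eq_iff:
  assumes K: "subgroup K G" and x: "x \<in> topspace X" and y: "y \<in> topspace X"
  shows "proj K x = proj K y \<longleftrightarrow> (\<exists>k\<in>K. y = \<alpha> k x)"
proof
  interpret subgroup K G by fact
  have "y \<in> proj K y"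
    unfolding proj_eq_image
    by (rule image_eqI[of _ _ "\<one>\<^bsub>G\<^esub>"]) (simp_all add: action_one[OF y])
  then show "\<exists>k\<in>K. y = \<alpha> k x" if "proj K x = proj K y" using that by (auto simp: proj_eq_image)
  assume "\<exists>k\<in>K. y = \<alpha> k x"
  then obtain k where k: "k \<in> K" "y = \<alpha> k x" by auto
  show "proj K x = proj K y"
    unfolding proj_eq_image
  proof (intro equalityI subsetI)
    fix z assume "z \<in> (\<lambda>k. \<alpha> k x) ` K"
    then obtain l where l: "l \<in> K" "z = \<alpha> l x" by auto
    have "\<alpha> (l \<otimes>\<^bsub>G\<^esub> inv\<^bsub>G\<^esub> k) y = \<alpha> l (\<alpha> (inv\<^bsub>G\<^esub> k) y)"
      using l k y group.inv_closed[OF grp] by (intro action_mult) auto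
    then have "z = \<alpha> (l \<otimes>\<^bsub>G\<^esub> inv\<^bsub>G\<^esub> k) y" using l k x action_inv[of k x] by simp
    moreover have "l \<otimes>\<^bsub>G\<^esub> inv\<^bsub>G\<^esub> k \<in> K" using l k by simp
    ultimately show "z \<in> (\<lambda>k. \<alpha> k y) ` K" by (rule image_eqI)
  next
    fix z assume "z \<in> (\<lambda>k. \<alpha> k y) ` K"
    then obtain l where l: "l \<in> K" "z = \<alpha> l y" by auto
    then have "z = \<alpha> (l \<otimes>\<^bsub>G\<^esub> k) x" using k x by (simp add: action_mult)
    moreover have "l \<otimes>\<^bsub>G\<^esub> k \<in> K" using l k by simp
    ultimately show "z \<in> (\<lambda>k. \<alpha> k x) ` K" by (rule image_eqI)
  qed
qed

lemma quotient_map_proj: "quotient_map X (quot K) (proj K)"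
  by (rule quotient_map_orbit)

lemma topspace_quot: "topspace (quot K) = proj K ` topspace X"
  by (auto simp: topspace_orbit_space orbits_def)

lemma closedin_quotI:
  assumes "S \<subseteq> topspace (quot K)" "closedin X {y \<in> topspace X. proj K y \<in> S}"
  shows "closedin (quot K) S"
  using quotient_map_proj assms unfolding quotient_map_closedin by blast

lemma stabilizer_cell_fixes:
  assumes "g \<in> carrier G" "e \<in> E" "act g e = e" "a \<in> topspace (disc (dim e))"
  shows "\<alpha> g (char e a) = char e a"
  using act_char[OF assms(1,2,4)] assms(3) by simp

lemma action_moves_cell:
  assumes g: "g \<in> carrier G" and e: "e \<in> E" "a \<in> disc_interior (dim e)"
    and f: "f \<in> E" "b \<in> disc_interior (dim f)" and eq: "\<alpha> g (char e a) = char f b"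
  shows "act g e = f" "a = b"
proof -
  have "char (act g e) a = char f b" using act_char[OF g e(1)] e(2) eq interior_disc by simp
  then have "act g e = f \<and> a = b"
    using interior_inj[OF act_cell[OF g e(1)] f(1) _ f(2)] e(2) act_dim[OF g e(1)] by simp
  then show "act g e = f" "a = b" by auto
qed

text \<open>For two given cells, the elements that move the first to the second form a coset of the
  stabilizer of the first, or there are none.\<close>

lemma finite_transporter:
  assumes stab: "\<And>e. e \<in> E \<Longrightarrow> finite {g \<in> carrier G. act g e = e}"
    and M: "finite M" "M \<subseteq> E" and N: "finite N"
  shows "finite {g \<in> carrier G. \<exists>e\<in>M. act g e \<in> N}"
proof -
  have "finite {g \<in> carrier G. act g e = f}" if e: "e \<in> E" for e f
  proof (cases "\<exists>g\<^sub>0\<in>carrier G. act g\<^sub>0 e = f")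
    case True
    then obtain g\<^sub>0 where g\<^sub>0: "g\<^sub>0 \<in> carrier G" "act g\<^sub>0 e = f" by auto
    have "{g \<in> carrier G. act g e = f} \<subseteq> (\<lambda>h. g\<^sub>0 \<otimes>\<^bsub>G\<^esub> h) ` {g \<in> carrier G. act g e = e}"
    proof
      fix g assume "g \<in> {g \<in> carrier G. act g e = f}"
      then have g: "g \<in> carrier G" "act g e = f" by auto
      have inv: "inv\<^bsub>G\<^esub> g\<^sub>0 \<in> carrier G" using g\<^sub>0 group.inv_closed[OF grp] by simp
      have "act (inv\<^bsub>G\<^esub> g\<^sub>0 \<otimes>\<^bsub>G\<^esub> g) e = e"
        using act_mult[OF inv g(1) e] act_inv[OF g\<^sub>0(1) e] g\<^sub>0(2) g(2) by simp
      moreover have "inv\<^bsub>G\<^esub> g\<^sub>0 \<otimes>\<^bsub>G\<^esub> g \<in> carrier G"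
        using inv g(1) by (simp add: group.subgroup_self[OF grp] subgroup.m_closed)
      moreover have "g = g\<^sub>0 \<otimes>\<^bsub>G\<^esub> (inv\<^bsub>G\<^esub> g\<^sub>0 \<otimes>\<^bsub>G\<^esub> g)"
        using group.inv_cancel_left(2)[OF grp g\<^sub>0(1) g(1)] by simp
      ultimately show "g \<in> (\<lambda>h. g\<^sub>0 \<otimes>\<^bsub>G\<^esub> h) ` {g \<in> carrier G. act g e = e}" by blast
    qed
    then show ?thesis using finite_subset stab[OF e] by blast
  next
    case False
    then have "{g \<in> carrier G. act g e = f} = {}" by auto
    then show ?thesis by (simp only: finite.emptyI)
  qed
  then have "finite (\<Union>e\<in>M. \<Union>f\<in>N. {g \<in> carrier G. act g e = f})"
    using M N by blast
  moreover have "{g \<in> carrier G. \<exists>e\<in>M. act g e \<in> N} \<subseteq> (\<Union>e\<in>M. \<Union>f\<in>N. {g \<in> carrier G. act g e = f})"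
    by auto
  ultimately show ?thesis using finite_subset by blast
qed

text \<open>As for compact sets in \<open>X\<close>, but with one chosen point for each orbit of
  cells. The action preserves disc coordinates, so the preimage in \<open>X\<close> of any set of
  chosen points of the quotient still has at most one point in each open cell and is closed.\<close>

lemma compactin_quotient_meets_finitely_many_orbits:
  assumes K: "subgroup K G" and C: "compactin (quot K) C"
  shows "finite (rep K ` {e \<in> E. \<exists>a\<in>disc_interior (dim e). proj K (char e a) \<in> C})"
proof -
  define R where "R = rep K ` {e \<in> E. \<exists>a\<in>disc_interior (dim e). proj K (char e a) \<in> C}"
  have R: "e \<in> E \<and> rep K e = e \<and> (\<exists>a. a \<in> disc_interior (dim e) \<and> proj K (char e a) \<in> C)"
    if e: "e \<in> R" for e
  proof -
    obtain f a where f: "f \<in> E" "a \<in> disc_interior (dim f)" "proj K (char f a) \<in> C" "e = rep K f"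
      using e unfolding R_def by auto
    obtain k where k: "k \<in> K" "act k f = e" using rep_orbit[OF K f(1)] f(4) by auto
    have kG: "k \<in> carrier G" using k(1) K by (rule subgroup.mem_carrier[rotated])
    have "char e a = \<alpha> k (char f a)" using act_char[OF kG f(1)] f(2) k(2) interior_disc by simp
    moreover have "char f a \<in> topspace X" using char_topspace f interior_disc by simp
    ultimately have "proj K (char e a) = proj K (char f a)"
      using proj_eq_iff[OF K, of "char f a" "char e a"] k(1) action_closed[OF kG] by auto
    moreover have "a \<in> disc_interior (dim e)" using rep_cell(2)[OF K f(1)] f by simp
    moreover have "rep K e = e" using rep_act[OF K f(1) k(1)] k(2) f(4) by simp
    ultimately show ?thesis using rep_cell(1)[OF K f(1)] f by auto
  qed
  define \<xi> where "\<xi> e = (SOME a. a \<in> disc_interior (dim e) \<and> proj K (char e a) \<in> C)" for e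
  have \<xi>: "\<xi> e \<in> disc_interior (dim e) \<and> proj K (char e (\<xi> e)) \<in> C" if "e \<in> R" for e
  proof -
    have "\<exists>a. a \<in> disc_interior (dim e) \<and> proj K (char e a) \<in> C" using R[OF that] by simp
    then show ?thesis unfolding \<xi>_def by (rule someI_ex)
  qed
  have unique: "e = f \<and> a = \<xi> f"
    if e: "e \<in> E" "rep K e = e" "a \<in> disc_interior (dim e)" and f: "f \<in> R"
      and eq: "proj K (char e a) = proj K (char f (\<xi> f))" for e a f
  proof -
    have t: "char e a \<in> topspace X" "char f (\<xi> f) \<in> topspace X"
      using char_topspace e R[OF f] \<xi>[OF f] interior_disc by simp_all
    obtain k where k: "k \<in> K" "char f (\<xi> f) = \<alpha> k (char e a)"
      using proj_eq_iff[OF K t] eq by auto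
    have kG: "k \<in> carrier G" using k(1) K by (rule subgroup.mem_carrier[rotated])
    have "act k e = f" "a = \<xi> f"
      using action_moves_cell[OF kG e(1,3), of f "\<xi> f"] R[OF f] \<xi>[OF f] k(2) by auto
    moreover have "rep K f = f" using R[OF f] by simp
    ultimately show ?thesis using rep_act[OF K e(1) k(1)] e(2) by simp
  qed
  define p where "p e = proj K (char e (\<xi> e))" for e
  have "inj_on p R"
  proof (rule inj_onI)
    fix e f assume "e \<in> R" "f \<in> R" "p e = p f"
    then show "e = f" using unique[of e "\<xi> e" f] R \<xi> unfolding p_def by simp
  qed
  moreover have "finite (p ` R)"
  proof (rule compactin_hereditarily_closed_imp_finite[OF C])
    show pR: "p ` R \<subseteq> C" using \<xi> unfolding p_def by auto
    fix S' assume S': "S' \<subseteq> p ` R"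
    show "closedin (quot K) S'"
    proof (rule closedin_quotI)
      show "S' \<subseteq> topspace (quot K)" using S' pR compactin_subset_topspace[OF C] by (meson subset_trans)
      show "closedin X {y \<in> topspace X. proj K y \<in> S'}"
      proof (rule closedin_of_finite_interiors)
        fix e assume e: "e \<in> E"
        have "{a \<in> disc_interior (dim e). char e a \<in> {y \<in> topspace X. proj K y \<in> S'}} \<subseteq> {\<xi> (rep K e)}"
        proof
          fix a assume "a \<in> {a \<in> disc_interior (dim e). char e a \<in> {y \<in> topspace X. proj K y \<in> S'}}"
          then have a: "a \<in> disc_interior (dim e)" "char e a \<in> topspace X" "proj K (char e a) \<in> S'" by auto
          then obtain f where f: "f \<in> R" "proj K (char e a) = proj K (char f (\<xi> f))"
            using S' unfolding p_def by auto
          obtain k where k: "k \<in> K" "act k e = rep K e" using rep_orbit[OF K e] by auto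
          have kG: "k \<in> carrier G" using k(1) K by (rule subgroup.mem_carrier[rotated])
          have "char (rep K e) a = \<alpha> k (char e a)"
            using act_char[OF kG e] a(1) k(2) interior_disc by simp
          then have "proj K (char (rep K e) a) = proj K (char e a)"
            using proj_eq_iff[OF K a(2), of "char (rep K e) a"] k(1) a(2) action_closed[OF kG] by auto
          then have "rep K e = f \<and> a = \<xi> f"
            using unique[of "rep K e" a f] rep_cell[OF K e] rep_act[OF K e k(1)] k(2) a(1) f by simp
          then show "a \<in> {\<xi> (rep K e)}" by simp
        qed
        then show "finite {a \<in> disc_interior (dim e). char e a \<in> {y \<in> topspace X. proj K y \<in> S'}}"
          using finite_subset by blast
      qed auto
    qed
  qed
  ultimately show ?thesis using finite_image_iff unfolding R_def by blast
qed

lemma compactin_quotient_subset_finite_subcomplex: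
  assumes K: "subgroup K G" and C: "compactin (quot K) C"
  shows "\<exists>M. finite M \<and> subcomplex M \<and> C \<subseteq> proj K ` (\<Union>e\<in>M. char e ` disc_interior (dim e))"
proof -
  let ?E = "{e \<in> E. \<exists>a\<in>disc_interior (dim e). proj K (char e a) \<in> C}"
  have "rep K ` ?E \<subseteq> E" using rep_cell(1)[OF K] by auto
  then obtain M where M: "finite M" "subcomplex M" "rep K ` ?E \<subseteq> M"
    using finite_subcomplex[OF compactin_quotient_meets_finitely_many_orbits[OF K C]] by auto
  have "c \<in> proj K ` (\<Union>e\<in>M. char e ` disc_interior (dim e))" if c: "c \<in> C" for c
  proof -
    have "c \<in> topspace (quot K)" using c compactin_subset_topspace[OF C] by auto
    then obtain y where y: "y \<in> topspace X" "c = proj K y" unfolding topspace_quot by auto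
    obtain e a where e: "e \<in> E" "a \<in> disc_interior (dim e)" "y = char e a"
      using cell_coordinates[OF y(1)] .
    then have eE: "e \<in> ?E" using c y by auto
    obtain k where k: "k \<in> K" "act k e = rep K e" using rep_orbit[OF K e(1)] by auto
    have kG: "k \<in> carrier G" using k(1) K by (rule subgroup.mem_carrier[rotated])
    have 1: "char (rep K e) a = \<alpha> k y"
      using act_char[OF kG e(1)] e k(2) interior_disc by simp
    then have "c = proj K (char (rep K e) a)"
      using proj_eq_iff[OF K y(1), of "\<alpha> k y"] k(1) y action_closed[OF kG] by auto
    moreover have "a \<in> disc_interior (dim (rep K e))" using rep_cell(2)[OF K e(1)] e(2) by simp
    moreover have "rep K e \<in> M" using M(3) eE by auto
    ultimately show ?thesis by blast
  qed
  then show ?thesis using M by (intro exI[of _ M]) auto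
qed

text \<open>Infinitely many translates of \<open>L\<close> are united, but locally only finitely
  many count: a closed cell meets finitely many open cells, and by finiteness of stabilizers only
  finitely many elements move one of these into \<open>M\<close>.\<close>

lemma saturation_closed:
  assumes stab: "\<And>e. e \<in> E \<Longrightarrow> finite {g \<in> carrier G. act g e = e}"
    and K: "subgroup K G" and M: "finite M" "M \<subseteq> E"
    and L: "closedin X L" "L \<subseteq> (\<Union>e\<in>M. char e ` disc_interior (dim e))"
  shows "closedin X {y \<in> topspace X. \<exists>k\<in>K. \<alpha> k y \<in> L}"
proof (rule closedin_by_cells)
  fix e assume e: "e \<in> E"
  let ?D = "topspace (disc (dim e))"
  define N where "N = {f \<in> E. \<exists>a\<in>disc_interior (dim f). char f a \<in> char e ` ?D}"
  have N: "finite N"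
    unfolding N_def by (rule compactin_meets_finitely_many_cells[OF compactin_closed_cell[OF e]])
  define K' where "K' = {k \<in> K. \<exists>a\<in>?D. \<alpha> k (char e a) \<in> L}"
  have KG: "k \<in> carrier G" if "k \<in> K" for k using K that by (rule subgroup.mem_carrier)
  have "K' \<subseteq> {g \<in> carrier G. \<exists>f\<in>N. act g f \<in> M}"
  proof
    fix k assume "k \<in> K'"
    then obtain a where k: "k \<in> K" and a: "a \<in> ?D" "\<alpha> k (char e a) \<in> L" unfolding K'_def by auto
    obtain f b where f: "f \<in> E" "b \<in> disc_interior (dim f)" "char e a = char f b"
      using cell_coordinates[OF char_topspace[OF e a(1)]] .
    have "\<alpha> k (char e a) \<in> (\<Union>e\<in>M. char e ` disc_interior (dim e))" using a(2) L(2) by (rule subsetD[rotated])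
    then obtain e' a' where e': "e' \<in> M" "a' \<in> disc_interior (dim e')" "\<alpha> k (char e a) = char e' a'"
      by auto
    then have "act k f = e'" using action_moves_cell[OF KG[OF k] f(1,2), of e' a'] f(3) M(2) by auto
    moreover have "f \<in> N" unfolding N_def using f a(1) by force
    ultimately show "k \<in> {g \<in> carrier G. \<exists>f\<in>N. act g f \<in> M}" using KG[OF k] e'(1) by auto
  qed
  moreover have "finite {g \<in> carrier G. \<exists>f\<in>N. act g f \<in> M}"
    using finite_transporter[OF stab N _ M(1)] by (auto simp: N_def)
  ultimately have "finite K'" by (rule finite_subset)
  moreover have "closedin (disc (dim e)) {a \<in> ?D. (\<alpha> k \<circ> char e) a \<in> L}" if "k \<in> K'" for k
    using that KG unfolding K'_def
    by (intro closedin_continuous_map_preimage[OF _ L(1)]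
        continuous_map_compose[OF char_continuous[OF e] action_continuous]) auto
  ultimately have "closedin (disc (dim e)) (\<Union>k\<in>K'. {a \<in> ?D. (\<alpha> k \<circ> char e) a \<in> L})"
    by (intro closedin_Union) auto
  also have "(\<Union>k\<in>K'. {a \<in> ?D. (\<alpha> k \<circ> char e) a \<in> L}) =
      {a \<in> ?D. char e a \<in> {y \<in> topspace X. \<exists>k\<in>K. \<alpha> k y \<in> L}}"
    using char_topspace[OF e] unfolding K'_def by auto
  finally show "closedin (disc (dim e)) {a \<in> ?D. char e a \<in> {y \<in> topspace X. \<exists>k\<in>K. \<alpha> k y \<in> L}}" .
qed auto

text \<open>Two points of a finite subcomplex \<open>L\<close> in the same \<open>T\<close>-orbit are related by an element of the
  finite set \<open>{t. t L \<inter> L \<noteq> \<emptyset>}\<close>. This set generates a finite group \<open>F\<close>, so the image of \<open>L\<close> in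
  \<open>X/T\<close> lifts to \<open>X/F\<close>.\<close>

lemma compact_map_lifts_to_finite_quotient:
  fixes B :: "'b topology"
  assumes stab: "\<And>e. e \<in> E \<Longrightarrow> finite {g \<in> carrier G. act g e = e}"
    and T: "subgroup T G" "locally_finite_subgroup G T"
    and B: "compact_space B" and \<phi>: "continuous_map B (quot T) \<phi>"
  shows "\<exists>F s. subgroup F G \<and> F \<subseteq> T \<and> finite F \<and> continuous_map B (quot F) (\<lambda>b. proj F (s b)) \<and>
    (\<forall>b\<in>topspace B. s b \<in> topspace X \<and> \<phi> b = proj T (s b))"
proof -
  have "compactin (quot T) (\<phi> ` topspace B)"
    using image_compactin[OF _ \<phi>] B unfolding compact_space_def by simp
  from compactin_quotient_subset_finite_subcomplex[OF T(1) this]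
  obtain M where M: "finite M" "subcomplex M"
    and cover: "\<phi> ` topspace B \<subseteq> proj T ` (\<Union>e\<in>M. char e ` disc_interior (dim e))" by auto
  define L where "L = (\<Union>e\<in>M. char e ` disc_interior (dim e))"
  have ME: "M \<subseteq> E" using M(2) unfolding subcomplex_def by simp
  have L_closed: "closedin X L" unfolding L_def by (rule closedin_subcomplex[OF M(2)])
  then have LX: "L \<subseteq> topspace X" by (rule closedin_subset)
  have TG: "t \<in> carrier G" if "t \<in> T" for t using T(1) that by (rule subgroup.mem_carrier)
  define D where "D = {t \<in> T. \<exists>e\<in>M. act t e \<in> M}"
  have "finite D"
  proof (rule finite_subset)
    show "D \<subseteq> {g \<in> carrier G. \<exists>e\<in>M. act g e \<in> M}" using TG unfolding D_def by auto
  qed (rule finite_transporter[OF stab M(1) ME M(1)])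
  define F where "F = generate G D"
  have DT: "D \<subseteq> T" unfolding D_def by auto
  have DG: "D \<subseteq> carrier G" using DT TG by auto
  have F: "subgroup F G" unfolding F_def by (rule group.generate_is_subgroup[OF grp DG])
  have FT: "F \<subseteq> T" unfolding F_def by (rule group.generate_subgroup_incl[OF grp DT T(1)])
  have fin: "finite F"
    using T(2) \<open>finite D\<close> DT unfolding locally_finite_subgroup_def F_def by simp
  have move: "t \<in> F" if t: "t \<in> T" and l: "l \<in> L" "\<alpha> t l \<in> L" for t l
  proof -
    obtain e a where e: "e \<in> M" "a \<in> disc_interior (dim e)" "l = char e a" using l(1) unfolding L_def by auto
    obtain f b where f: "f \<in> M" "b \<in> disc_interior (dim f)" "\<alpha> t l = char f b" using l(2) unfolding L_def by auto
    have "act t e = f" using action_moves_cell[OF TG[OF t], of e a f b] e f ME by auto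
    then have "t \<in> D" using t e(1) f(1) unfolding D_def by auto
    then show ?thesis unfolding F_def by (rule generate.incl)
  qed
  \<comment> \<open>An arbitrary choice, which need not be continuous. Two points of
    \<open>L\<close> over the same \<open>T\<close>-orbit differ by an element of \<open>F\<close>,
    so the choice becomes unambiguous in \<open>quot F\<close>.\<close>
  define s where "s b = (SOME l. l \<in> L \<and> \<phi> b = proj T l)" for b
  have s: "s b \<in> L \<and> \<phi> b = proj T (s b)" if b: "b \<in> topspace B" for b
  proof -
    have "\<phi> b \<in> proj T ` L" using cover b unfolding L_def by auto
    then have "\<exists>l. l \<in> L \<and> \<phi> b = proj T l" by auto
    then show ?thesis unfolding s_def by (rule someI_ex)
  qed
  have "continuous_map B (quot F) (\<lambda>b. proj F (s b))"
    unfolding continuous_map_closedin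
  proof (intro conjI allI impI)
    show "(\<lambda>b. proj F (s b)) \<in> topspace B \<rightarrow> topspace (quot F)"
      using s LX unfolding topspace_quot by auto
    fix C assume C: "closedin (quot F) C"
    \<comment> \<open>The part of \<open>L\<close> over \<open>C\<close>. Its image in
      \<open>quot T\<close> is closed, and the preimage of this image under \<open>\<phi>\<close> is
      the set in question: if \<open>\<alpha> t (s b)\<close> is in \<open>L'\<close>, then
      \<open>t\<close> is in \<open>F\<close>, so \<open>s b\<close> lies over \<open>C\<close> as
      well.\<close>
    define L' where "L' = L \<inter> {y \<in> topspace X. proj F y \<in> C}"
    have "closedin X {y \<in> topspace X. proj F y \<in> C}"
      by (rule closedin_continuous_map_preimage[OF quotient_imp_continuous_map[OF quotient_map_proj] C])
    then have L': "closedin X L'" unfolding L'_def using L_closed by (rule closedin_Int[rotated])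
    have L'X: "L' \<subseteq> topspace X" using L' by (rule closedin_subset)
    have sat: "proj T y \<in> proj T ` L' \<longleftrightarrow> (\<exists>t\<in>T. \<alpha> t y \<in> L')" if y: "y \<in> topspace X" for y
    proof
      assume "proj T y \<in> proj T ` L'"
      then obtain l where "l \<in> L'" "proj T y = proj T l" by auto
      then show "\<exists>t\<in>T. \<alpha> t y \<in> L'" using proj_eq_iff[OF T(1) y, of l] L'X by auto
    next
      assume "\<exists>t\<in>T. \<alpha> t y \<in> L'"
      then obtain t where t: "t \<in> T" "\<alpha> t y \<in> L'" by auto
      then have "proj T y = proj T (\<alpha> t y)" using proj_eq_iff[OF T(1) y, of "\<alpha> t y"] L'X by auto
      then show "proj T y \<in> proj T ` L'" using t(2) by simp
    qed
    have "closedin (quot T) (proj T ` L')"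
    proof (rule closedin_quotI)
      show "proj T ` L' \<subseteq> topspace (quot T)" using L'X unfolding topspace_quot by auto
      have "{y \<in> topspace X. proj T y \<in> proj T ` L'} = {y \<in> topspace X. \<exists>t\<in>T. \<alpha> t y \<in> L'}"
        using sat by auto
      moreover have "closedin X {y \<in> topspace X. \<exists>t\<in>T. \<alpha> t y \<in> L'}"
        by (rule saturation_closed[OF stab T(1) M(1) ME L']) (auto simp: L'_def L_def)
      ultimately show "closedin X {y \<in> topspace X. proj T y \<in> proj T ` L'}" by simp
    qed
    then have "closedin B {b \<in> topspace B. \<phi> b \<in> proj T ` L'}"
      by (rule closedin_continuous_map_preimage[OF \<phi>])
    also have "{b \<in> topspace B. \<phi> b \<in> proj T ` L'} = {b \<in> topspace B. proj F (s b) \<in> C}"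
    proof (rule Collect_cong, rule conj_cong[OF refl])
      fix b assume b: "b \<in> topspace B"
      have sL: "s b \<in> L" "s b \<in> topspace X" "\<phi> b = proj T (s b)" using s[OF b] LX by auto
      show "\<phi> b \<in> proj T ` L' \<longleftrightarrow> proj F (s b) \<in> C"
      proof
        assume "\<phi> b \<in> proj T ` L'"
        then obtain t where t: "t \<in> T" "\<alpha> t (s b) \<in> L'" using sat[OF sL(2)] sL(3) by auto
        then have "t \<in> F" using move[OF t(1) sL(1)] unfolding L'_def by simp
        then have "proj F (s b) = proj F (\<alpha> t (s b))"
          using proj_eq_iff[OF F sL(2), of "\<alpha> t (s b)"] t(2) L'X by auto
        then show "proj F (s b) \<in> C" using t(2) unfolding L'_def by simp
      next
        assume "proj F (s b) \<in> C"
        then have "s b \<in> L'" using sL unfolding L'_def by simp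
        then show "\<phi> b \<in> proj T ` L'" using sL(3) by simp
      qed
    qed
    finally show "closedin B {b \<in> topspace B. proj F (s b) \<in> C}" .
  qed
  then show ?thesis using F FT fin s LX by (intro exI[of _ F] exI[of _ s]) auto
qed

text \<open>Obstruction theory for the action of \<open>F\<close> on \<open>X\<close> with
  \<open>X\<close> itself as target: the stabilizer in \<open>F\<close> of a cell is a finite
  subgroup, to whose fixed points \<open>contr\<close> applies. The homotopy runs from the identity
  to a point fixed by \<open>F\<close>, so both of its ends are equivariant.\<close>

lemma finite_group_contraction:
  assumes F: "subgroup F G" "finite F"
    and contr: "\<And>H. subgroup H G \<Longrightarrow> finite H \<Longrightarrow>
      compactly_contractible (subtopology X (fixed_points X \<alpha> H))"
  shows "\<exists>h y\<^sub>0. continuous_map (prod_topology (top_of_set {0..1::real}) X) X h \<and> y\<^sub>0 \<in> topspace X \<and>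
    (\<forall>x\<in>topspace X. h (0, x) = x \<and> h (1, x) = y\<^sub>0) \<and>
    (\<forall>k\<in>F. \<forall>t\<in>{0..1}. \<forall>x\<in>topspace X. h (t, \<alpha> k x) = \<alpha> k (h (t, x)))"
proof -
  have FG: "k \<in> carrier G" if "k \<in> F" for k using F(1) that by (rule subgroup.mem_carrier)
  have "topspace (subtopology X (fixed_points X \<alpha> F)) \<noteq> {}"
    using contr[OF F] unfolding compactly_contractible_def by simp
  then obtain y\<^sub>0 where y\<^sub>0: "y\<^sub>0 \<in> topspace X" "\<And>k. k \<in> F \<Longrightarrow> \<alpha> k y\<^sub>0 = y\<^sub>0"
    unfolding fixed_points_def by auto
  interpret ext: equivariant_extension G X \<alpha> E dim char act skeleton F X \<alpha> "{0..1}" "{0,1}"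
    "\<lambda>(t, x). if t = 0 then x else y\<^sub>0"
  proof (rule equivariant_extension.intro[OF cellular_action_axioms],
      rule equivariant_extension_axioms.intro)
    show "subgroup F G" by (rule F(1))
    show "continuous_map X X (\<alpha> k)" if "k \<in> F" for k using action_continuous FG[OF that] by simp
    show "\<alpha> (k \<otimes>\<^bsub>G\<^esub> l) x = \<alpha> k (\<alpha> l x)" if "k \<in> F" "l \<in> F" "x \<in> topspace X" for k l x
      using action_mult[OF FG FG] that by simp
    show "compact {0..1::real}" "closed {0, 1::real}" "{0, 1} \<subseteq> {0..1::real}" by auto
    show "continuous_map (prod_topology (top_of_set {0, 1::real}) X) X (\<lambda>(t, x). if t = 0 then x else y\<^sub>0)"
      by (rule continuous_map_two_points) (use y\<^sub>0 in auto)
    show "(case (t, \<alpha> k x) of (t, x) \<Rightarrow> if t = 0 then x else y\<^sub>0) =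
        \<alpha> k (case (t, x) of (t, x) \<Rightarrow> if t = 0 then x else y\<^sub>0)"
      if "k \<in> F" "t \<in> {0, 1}" "x \<in> topspace X" for k t x
      using that y\<^sub>0(2) by simp
    fix e assume e: "e \<in> E"
    let ?H = "{k \<in> F. act k e = e}"
    have "subgroup ?H G"
    proof (rule group.subgroupI[OF grp])
      show "?H \<subseteq> carrier G" using FG by auto
      show "?H \<noteq> {}" using subgroup.one_closed[OF F(1)] act_one[OF e] by auto
      show "inv\<^bsub>G\<^esub> k \<in> ?H" if "k \<in> ?H" for k
        using that subgroup.m_inv_closed[OF F(1), of k] act_inv[OF FG e, of k] by auto
      show "k \<otimes>\<^bsub>G\<^esub> l \<in> ?H" if "k \<in> ?H" "l \<in> ?H" for k l
        using that subgroup.m_closed[OF F(1), of k l] act_mult[OF FG FG e, of k l] by auto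
    qed
    then have "compactly_contractible (subtopology X (fixed_points X \<alpha> ?H))"
      using contr F(2) by simp
    moreover have "fixed_points X \<alpha> ?H = {x \<in> topspace X. \<forall>k\<in>F. act k e = e \<longrightarrow> \<alpha> k x = x}"
      unfolding fixed_points_def by auto
    ultimately show "extends_over_cells {0..1} {0, 1}
        (subtopology X {x \<in> topspace X. \<forall>k\<in>F. act k e = e \<longrightarrow> \<alpha> k x = x})"
      using extends_over_cells_interval by simp
  qed (rule skeleton_def)
  obtain h where h: "continuous_map (prod_topology (top_of_set {0..1::real}) X) X h"
    "\<forall>t\<in>{0, 1}. \<forall>x\<in>topspace X. h (t, x) = (case (t, x) of (t, x) \<Rightarrow> if t = 0 then x else y\<^sub>0)"
    "\<forall>k\<in>F. \<forall>t\<in>{0..1}. \<forall>x\<in>topspace X. h (t, \<alpha> k x) = \<alpha> k (h (t, x))"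
    using ext.extension_exists by metis
  then show ?thesis using y\<^sub>0(1) by (intro exI[of _ h] exI[of _ y\<^sub>0]) simp
qed

proposition quotient_compactly_contractible:
  assumes stab: "\<And>e. e \<in> E \<Longrightarrow> finite {g \<in> carrier G. act g e = e}"
    and T: "subgroup T G" "locally_finite_subgroup G T"
    and contr: "\<And>H. subgroup H G \<Longrightarrow> finite H \<Longrightarrow>
      compactly_contractible (subtopology X (fixed_points X \<alpha> H))"
  shows "compactly_contractible (quot T)"
  unfolding compactly_contractible_def
proof (intro conjI allI impI)
  have "compactly_contractible (subtopology X (fixed_points X \<alpha> {\<one>\<^bsub>G\<^esub>}))"
    by (rule contr) (simp_all add: group.triv_subgroup[OF grp])
  then show "topspace (quot T) \<noteq> {}" unfolding compactly_contractible_def topspace_quot by auto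
  fix B :: "(real \<times> (nat \<Rightarrow> real)) topology" and \<phi>
  assume B: "compact_space B \<and> continuous_map B (quot T) \<phi>"
  obtain F s where F: "subgroup F G" "F \<subseteq> T" "finite F"
    and s: "continuous_map B (quot F) (\<lambda>b. proj F (s b))"
      "\<forall>b\<in>topspace B. s b \<in> topspace X \<and> \<phi> b = proj T (s b)"
    using compact_map_lifts_to_finite_quotient[OF stab T] B by metis
  obtain h y\<^sub>0 where h: "continuous_map (prod_topology (top_of_set {0..1::real}) X) X h" "y\<^sub>0 \<in> topspace X"
      "\<forall>x\<in>topspace X. h (0, x) = x \<and> h (1, x) = y\<^sub>0"
      "\<forall>k\<in>F. \<forall>t\<in>{0..1}. \<forall>x\<in>topspace X. h (t, \<alpha> k x) = \<alpha> k (h (t, x))"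
    using finite_group_contraction[OF F(1,3) contr] by metis
  let ?I = "top_of_set {0..1::real}"
  have hX: "h (t, x) \<in> topspace X" if "t \<in> {0..1}" "x \<in> topspace X" for t x
    using continuous_map_funspace[OF h(1)] that by (auto simp: Pi_iff)
  have c: "continuous_map (prod_topology ?I X) (quot T) (proj T \<circ> h)"
    by (rule continuous_map_compose[OF h(1) quotient_imp_continuous_map[OF quotient_map_proj]])
  \<comment> \<open>The contraction is known to commute with \<open>F\<close> only, so it induces a
    homotopy on \<open>quot F\<close>; this is why \<open>\<phi>\<close> was lifted. Its values may
    be projected on to \<open>quot T\<close> because \<open>F \<subseteq> T\<close>.\<close>
  have "\<exists>h'. continuous_map (prod_topology ?I (quot F)) (quot T) h' \<and>
      (\<forall>t\<in>{0..1}. \<forall>x\<in>topspace X. h' (t, proj F x) = (proj T \<circ> h) (t, x))"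
  proof (rule homotopy_descends[OF quotient_map_proj c])
    fix t :: real and x y assume t: "t \<in> {0..1}" and xy: "x \<in> topspace X" "y \<in> topspace X" "proj F x = proj F y"
    obtain k where k: "k \<in> F" "y = \<alpha> k x" using proj_eq_iff[OF F(1) xy(1,2)] xy(3) by auto
    then have "h (t, y) = \<alpha> k (h (t, x))" using h(4) t xy by simp
    then show "(proj T \<circ> h) (t, x) = (proj T \<circ> h) (t, y)"
      using proj_eq_iff[OF T(1) hX[OF t xy(1)] hX[OF t xy(2)]] k(1) F(2) by auto
  qed
  then obtain h' where h': "continuous_map (prod_topology ?I (quot F)) (quot T) h'"
    "\<And>t x. t \<in> {0..1} \<Longrightarrow> x \<in> topspace X \<Longrightarrow> h' (t, proj F x) = proj T (h (t, x))" by auto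
  have "continuous_map (prod_topology ?I B) (prod_topology ?I (quot F)) (\<lambda>z. (fst z, proj F (s (snd z))))"
  proof (rule continuous_map_pairedI[OF continuous_map_fst])
    show "continuous_map (prod_topology ?I B) (quot F) (\<lambda>z. proj F (s (snd z)))"
      using continuous_map_compose[OF continuous_map_snd s(1)] by (simp add: o_def)
  qed
  from continuous_map_compose[OF this h'(1)]
  have "continuous_map (prod_topology ?I B) (quot T) (\<lambda>z. h' (fst z, proj F (s (snd z))))"
    by (simp add: o_def)
  then have "homotopic_with (\<lambda>_. True) B (quot T) \<phi> (\<lambda>_. proj T y\<^sub>0)"
    using s(2) h(3) h'(2)
    by (subst homotopic_with) (auto intro!: exI[of _ "\<lambda>z. h' (fst z, proj F (s (snd z)))"])
  then show "\<exists>c. homotopic_with (\<lambda>_. True) B (quot T) \<phi> (\<lambda>_. c)" by blast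
qed

end

section \<open>Equivariant CW-complexes as spaces built from permuted cells\<close>

lemma closedin_discrete_prod:
  assumes W: "W \<subseteq> U \<times> topspace D" and slices: "\<And>c. c \<in> U \<Longrightarrow> closedin D {a \<in> topspace D. (c, a) \<in> W}"
  shows "closedin (prod_topology (discrete_topology U) D) W"
proof -
  have "openin D (topspace D - {a \<in> topspace D. (c, a) \<in> W})" if "c \<in> U" for c
    using slices[OF that] by (intro openin_diff openin_topspace)
  then have "openin (prod_topology (discrete_topology U) D)
      (\<Union>c\<in>U. {c} \<times> (topspace D - {a \<in> topspace D. (c, a) \<in> W}))"
    by (intro openin_Union) (auto simp: openin_prod_Times_iff)
  moreover have "(\<Union>c\<in>U. {c} \<times> (topspace D - {a \<in> topspace D. (c, a) \<in> W})) =
      topspace (prod_topology (discrete_topology U) D) - W"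
    by auto
  ultimately show ?thesis using W by (simp add: closedin_def)
qed

text \<open>Brings the attaching data into a form with separate quantifiers for \<open>H\<close> and
  \<open>\<Phi>\<close>, ready for choosing one family for every \<open>n\<close>.\<close>

lemma attaches_cells_family:
  assumes "attaches_cells G X \<alpha> n A B"
  shows "\<exists>C :: ('g set \<times> ('g set \<times> (nat \<Rightarrow> real) \<Rightarrow> 'x)) set.
    (\<forall>H \<Phi>. (H, \<Phi>) \<in> C \<longrightarrow> subgroup H G \<and>
      continuous_map (cell_space G n H) (subtopology X B) \<Phi> \<and>
      (\<forall>g\<in>carrier G. \<forall>c\<in>lcosets\<^bsub>G\<^esub> H. \<forall>x\<in>topspace (disc n). \<Phi> (g <#\<^bsub>G\<^esub> c, x) = \<alpha> g (\<Phi> (c, x))) \<and>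
      \<Phi> ` ((lcosets\<^bsub>G\<^esub> H) \<times> disc_boundary n) \<subseteq> A) \<and>
    bij_betw (\<lambda>((H, \<Phi>), z). \<Phi> z) (SIGMA (H, \<Phi>):C. (lcosets\<^bsub>G\<^esub> H) \<times> disc_interior n) (B - A) \<and>
    (\<forall>S\<subseteq>B. closedin (subtopology X A) (S \<inter> A) \<longrightarrow>
      (\<forall>H \<Phi>. (H, \<Phi>) \<in> C \<longrightarrow> closedin (cell_space G n H) {z \<in> topspace (cell_space G n H). \<Phi> z \<in> S}) \<longrightarrow>
      closedin (subtopology X B) S)"
proof -
  have pairs: "(\<forall>(x, y)\<in>C. P x y) \<longleftrightarrow> (\<forall>x y. (x, y) \<in> C \<longrightarrow> P x y)"
    for C :: "('c \<times> 'd) set" and P by auto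
  show ?thesis
    using assms unfolding attaches_cells_def pairs by (elim conjE ex_forward) (intro conjI; simp)
qed

text \<open>A cell is a tuple \<open>(n, H, \<Phi>, c)\<close> with a coset \<open>c\<close> of
  \<open>H\<close>; group elements translate \<open>c\<close> and keep the rest. The main work is to
  turn the relative topological conditions of the filtration into criteria for closedness in
  \<open>X\<close>.\<close>

proposition G_CW_complex_cellular_action:
  fixes G :: "('g, 'm) monoid_scheme" and X :: "'x topology"
  assumes G: "group G" and CW: "G_CW_complex G X \<alpha>"
  shows "\<exists>(E :: (nat \<times> 'g set \<times> ('g set \<times> (nat \<Rightarrow> real) \<Rightarrow> 'x) \<times> 'g set) set) dim char act.
    cellular_action G X \<alpha> E dim char act"
proof -
  have X: "group_action G (topspace X) \<alpha>" "\<And>g. g \<in> carrier G \<Longrightarrow> continuous_map X X (\<alpha> g)"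
    using CW unfolding G_CW_complex_def G_space_def by auto
  obtain F where F: "CW_filtration G X \<alpha> F" using CW unfolding G_CW_complex_def by auto
  have F0: "F 0 = {}" and F_att: "\<And>n. attaches_cells G X \<alpha> n (F n) (F (Suc n))"
    and F_cover: "(\<Union>n. F n) = topspace X"
    and F_colim: "\<And>S. S \<subseteq> topspace X \<Longrightarrow> (\<And>n. closedin (subtopology X (F n)) (S \<inter> F n)) \<Longrightarrow> closedin X S"
    using F unfolding CW_filtration_def by auto
  have F_Suc: "F n \<subseteq> F (Suc n)" for n using F_att[of n] unfolding attaches_cells_def by simp
  have F_mono: "F m \<subseteq> F n" if "m \<le> n" for m n using lift_Suc_mono_le[of F] F_Suc that by auto
  let ?P = "\<lambda>n C. (\<forall>H \<Phi>. (H, \<Phi>) \<in> C \<longrightarrow> subgroup H G \<and>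
      continuous_map (cell_space G n H) (subtopology X (F (Suc n))) \<Phi> \<and>
      (\<forall>g\<in>carrier G. \<forall>c\<in>lcosets\<^bsub>G\<^esub> H. \<forall>x\<in>topspace (disc n). \<Phi> (g <#\<^bsub>G\<^esub> c, x) = \<alpha> g (\<Phi> (c, x))) \<and>
      \<Phi> ` ((lcosets\<^bsub>G\<^esub> H) \<times> disc_boundary n) \<subseteq> F n) \<and>
    bij_betw (\<lambda>((H, \<Phi>), z). \<Phi> z) (SIGMA (H, \<Phi>):C. (lcosets\<^bsub>G\<^esub> H) \<times> disc_interior n) (F (Suc n) - F n) \<and>
    (\<forall>S\<subseteq>F (Suc n). closedin (subtopology X (F n)) (S \<inter> F n) \<longrightarrow>
      (\<forall>H \<Phi>. (H, \<Phi>) \<in> C \<longrightarrow> closedin (cell_space G n H) {z \<in> topspace (cell_space G n H). \<Phi> z \<in> S}) \<longrightarrow>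
      closedin (subtopology X (F (Suc n))) S)"
  have "\<forall>n. \<exists>C. ?P n C" using attaches_cells_family[OF F_att] by (intro allI)
  then have "\<exists>C. \<forall>n. ?P n (C n)" by (rule choice)
  then obtain C where C: "\<forall>n. ?P n (C n)" by (elim exE)
  have C_sub: "\<And>n H \<Phi>. (H, \<Phi>) \<in> C n \<Longrightarrow> subgroup H G"
    and C_cont: "\<And>n H \<Phi>. (H, \<Phi>) \<in> C n \<Longrightarrow> continuous_map (cell_space G n H) (subtopology X (F (Suc n))) \<Phi>"
    and C_equiv: "\<And>n H \<Phi> g c a. (H, \<Phi>) \<in> C n \<Longrightarrow> g \<in> carrier G \<Longrightarrow> c \<in> lcosets\<^bsub>G\<^esub> H \<Longrightarrow>
      a \<in> topspace (disc n) \<Longrightarrow> \<Phi> (g <#\<^bsub>G\<^esub> c, a) = \<alpha> g (\<Phi> (c, a))"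
    and C_bd: "\<And>n H \<Phi>. (H, \<Phi>) \<in> C n \<Longrightarrow> \<Phi> ` ((lcosets\<^bsub>G\<^esub> H) \<times> disc_boundary n) \<subseteq> F n"
    and C_bij: "\<And>n. bij_betw (\<lambda>((H, \<Phi>), z). \<Phi> z)
      (SIGMA (H, \<Phi>):C n. (lcosets\<^bsub>G\<^esub> H) \<times> disc_interior n) (F (Suc n) - F n)"
    and C_closed: "\<And>n S. S \<subseteq> F (Suc n) \<Longrightarrow> closedin (subtopology X (F n)) (S \<inter> F n) \<Longrightarrow>
      (\<And>H \<Phi>. (H, \<Phi>) \<in> C n \<Longrightarrow> closedin (cell_space G n H) {z \<in> topspace (cell_space G n H). \<Phi> z \<in> S}) \<Longrightarrow>
      closedin (subtopology X (F (Suc n))) S"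
    using C by simp_all
  define E where "E = {(n, H, \<Phi>, c). (H, \<Phi>) \<in> C n \<and> c \<in> lcosets\<^bsub>G\<^esub> H}"
  define dim :: "nat \<times> 'g set \<times> ('g set \<times> (nat \<Rightarrow> real) \<Rightarrow> 'x) \<times> 'g set \<Rightarrow> nat"
    where "dim = (\<lambda>(n, H, \<Phi>, c). n)"
  define char :: "nat \<times> 'g set \<times> ('g set \<times> (nat \<Rightarrow> real) \<Rightarrow> 'x) \<times> 'g set \<Rightarrow> (nat \<Rightarrow> real) \<Rightarrow> 'x"
    where "char = (\<lambda>(n, H, \<Phi>, c) a. \<Phi> (c, a))"
  define act :: "'g \<Rightarrow> nat \<times> 'g set \<times> ('g set \<times> (nat \<Rightarrow> real) \<Rightarrow> 'x) \<times> 'g set \<Rightarrow> _"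
    where "act = (\<lambda>g (n, H, \<Phi>, c). (n, H, \<Phi>, g <#\<^bsub>G\<^esub> c))"
  define sk where "sk n = (\<Union>e\<in>{e \<in> E. dim e < n}. char e ` disc_interior (dim e))" for n
  have mem_E: "(n, H, \<Phi>, c) \<in> E \<longleftrightarrow> (H, \<Phi>) \<in> C n \<and> c \<in> lcosets\<^bsub>G\<^esub> H" for n H \<Phi> c
    by (simp add: E_def)
  have dim: "dim (n, H, \<Phi>, c) = n" and char: "char (n, H, \<Phi>, c) a = \<Phi> (c, a)"
    and act: "act g (n, H, \<Phi>, c) = (n, H, \<Phi>, g <#\<^bsub>G\<^esub> c)" for n H \<Phi> c a g
    by (simp_all add: dim_def char_def act_def)
  have layer: "F (Suc n) - F n = (\<Union>e\<in>{e \<in> E. dim e = n}. char e ` disc_interior (dim e))" for n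
  proof -
    have "F (Suc n) - F n = (\<lambda>((H, \<Phi>), z). \<Phi> z) ` (SIGMA (H, \<Phi>):C n. (lcosets\<^bsub>G\<^esub> H) \<times> disc_interior n)"
      using C_bij[of n] by (simp add: bij_betw_def)
    also have "\<dots> = (\<Union>e\<in>{e \<in> E. dim e = n}. char e ` disc_interior (dim e))"
    proof (intro equalityI subsetI)
      fix y assume "y \<in> (\<lambda>((H, \<Phi>), z). \<Phi> z) ` (SIGMA (H, \<Phi>):C n. (lcosets\<^bsub>G\<^esub> H) \<times> disc_interior n)"
      then obtain H \<Phi> c a where "(H, \<Phi>) \<in> C n" "c \<in> lcosets\<^bsub>G\<^esub> H" "a \<in> disc_interior n" "y = \<Phi> (c, a)"
        by auto
      then show "y \<in> (\<Union>e\<in>{e \<in> E. dim e = n}. char e ` disc_interior (dim e))"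
        by (intro UN_I[of "(n, H, \<Phi>, c)"]) (auto simp: mem_E dim char)
    next
      fix y assume "y \<in> (\<Union>e\<in>{e \<in> E. dim e = n}. char e ` disc_interior (dim e))"
      then obtain e a where ea: "e \<in> E" "dim e = n" "a \<in> disc_interior (dim e)" "y = char e a" by auto
      obtain H \<Phi> c where "e = (n, H, \<Phi>, c)" using ea(2) by (cases e) (auto simp: dim)
      then show "y \<in> (\<lambda>((H, \<Phi>), z). \<Phi> z) ` (SIGMA (H, \<Phi>):C n. (lcosets\<^bsub>G\<^esub> H) \<times> disc_interior n)"
        using ea by (intro image_eqI[of _ _ "((H, \<Phi>), (c, a))"]) (auto simp: mem_E dim char)
    qed
    finally show ?thesis .
  qed
  have sk_F: "sk n = F n" for n
  proof (induction n)
    case 0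
    then show ?case by (simp add: sk_def F0)
  next
    case (Suc n)
    have "sk (Suc n) = sk n \<union> (\<Union>e\<in>{e \<in> E. dim e = n}. char e ` disc_interior (dim e))"
      unfolding sk_def by (auto simp: less_Suc_eq)
    also have "\<dots> = F n \<union> (F (Suc n) - F n)" by (simp only: Suc layer)
    finally show ?case using F_Suc[of n] by (simp only: Un_Diff_cancel Un_absorb1)
  qed
  have FX: "F n \<subseteq> topspace X" for n using F_cover by auto
  have char_cont: "continuous_map (disc (dim e)) (subtopology X (F (Suc (dim e)))) (char e)" if e: "e \<in> E" for e
  proof -
    obtain n H \<Phi> c where e_eq: "e = (n, H, \<Phi>, c)" by (cases e)
    have "continuous_map (disc n) (cell_space G n H) (\<lambda>a. (c, a))"
      using e unfolding e_eq mem_E cell_space_def by (intro continuous_map_pairedI) auto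
    from continuous_map_compose[OF this C_cont] show ?thesis
      using e unfolding e_eq mem_E dim by (simp add: o_def char_def)
  qed
  have char_bd: "char e ` disc_boundary (dim e) \<subseteq> F (dim e)" if e: "e \<in> E" for e
  proof -
    obtain n H \<Phi> c where e_eq: "e = (n, H, \<Phi>, c)" by (cases e)
    then have "(H, \<Phi>) \<in> C n" "c \<in> lcosets\<^bsub>G\<^esub> H" using e by (simp_all add: mem_E)
    then show ?thesis using C_bd[of H \<Phi> n] by (auto simp: e_eq dim char)
  qed
  have char_int: "char e ` disc_interior (dim e) \<subseteq> F (Suc (dim e)) - F (dim e)" if "e \<in> E" for e
    unfolding layer using that by blast
  \<comment> \<open>The colimit condition tests \<open>S\<close> at every stage, whereas information
    is given for cells of dimension below \<open>n\<close> only. Hence an induction along all stages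
    \<open>m\<close>, including those beyond \<open>n\<close>.\<close>
  have closed_F: "closedin X S"
    if S: "S \<subseteq> F n" and cl: "\<And>e. e \<in> E \<Longrightarrow> dim e < n \<Longrightarrow>
      closedin (disc (dim e)) {a \<in> topspace (disc (dim e)). char e a \<in> S}" for S n
  proof (rule F_colim)
    show "S \<subseteq> topspace X" using S FX by blast
    show "closedin (subtopology X (F m)) (S \<inter> F m)" for m
    proof (induction m)
      case 0
      then show ?case by (simp add: F0)
    next
      case (Suc m)
      show ?case
      proof (rule C_closed)
        have "S \<inter> F (Suc m) \<inter> F m = S \<inter> F m" using F_Suc[of m] by auto
        then show "closedin (subtopology X (F m)) (S \<inter> F (Suc m) \<inter> F m)" using Suc by simp
        fix H \<Phi> assume H\<Phi>: "(H, \<Phi>) \<in> C m"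
        show "closedin (cell_space G m H) {z \<in> topspace (cell_space G m H). \<Phi> z \<in> S \<inter> F (Suc m)}"
          unfolding cell_space_def
        proof (rule closedin_discrete_prod)
          fix c assume c: "c \<in> lcosets\<^bsub>G\<^esub> H"
          let ?e = "(m, H, \<Phi>, c)"
          have e: "?e \<in> E" using H\<Phi> c by (simp add: mem_E)
          have in_F: "\<Phi> (c, a) \<in> F (Suc m)" if "a \<in> topspace (disc m)" for a
            using continuous_map_image_subset_topspace[OF char_cont[OF e]] that by (auto simp: dim char)
          have "{a \<in> topspace (disc m). (c, a) \<in>
              {z \<in> topspace (prod_topology (discrete_topology (lcosets\<^bsub>G\<^esub> H)) (disc m)). \<Phi> z \<in> S \<inter> F (Suc m)}}
            = {a \<in> topspace (disc m). char ?e a \<in> S}"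
            using c in_F by (auto simp: char)
          moreover have "closedin (disc m) {a \<in> topspace (disc m). char ?e a \<in> S}"
          proof (cases "m < n")
            case True
            then show ?thesis using cl[OF e] by (simp add: dim)
          next
            case False
            \<comment> \<open>A cell of dimension \<open>m \<ge> n\<close> meets \<open>S\<close>
              only in its boundary, because its interior avoids \<open>F m\<close>; the trace is
              then closed by the induction hypothesis.\<close>
            then have SF: "S \<subseteq> F m" using S F_mono[of n m] by auto
            then have "closedin (subtopology X (F m)) S" using Suc by (simp add: Int_absorb2)
            moreover have "continuous_map (subtopology (disc m) (disc_boundary m)) (subtopology X (F m)) (char ?e)"
            proof -
              have "continuous_map (disc m) X (char ?e)"
                using continuous_map_into_fulltopology[OF char_cont[OF e]] by (simp add: dim)
              then show ?thesis
                using char_bd[OF e]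
                by (auto simp: continuous_map_in_subtopology dim intro: continuous_map_from_subtopology)
            qed
            ultimately have "closedin (subtopology (disc m) (disc_boundary m))
                {a \<in> topspace (subtopology (disc m) (disc_boundary m)). char ?e a \<in> S}"
              by (intro closedin_continuous_map_preimage)
            then have "closedin (disc m) {a \<in> topspace (subtopology (disc m) (disc_boundary m)). char ?e a \<in> S}"
              by (rule closedin_trans_full[OF _ closedin_disc_boundary])
            moreover have "{a \<in> topspace (subtopology (disc m) (disc_boundary m)). char ?e a \<in> S} =
                {a \<in> topspace (disc m). char ?e a \<in> S}"
              using char_int[OF e] SF by (auto simp: topspace_disc_split dim)
            ultimately show ?thesis by simp
          qed
          ultimately show "closedin (disc m) {a \<in> topspace (disc m). (c, a) \<in>
              {z \<in> topspace (prod_topology (discrete_topology (lcosets\<^bsub>G\<^esub> H)) (disc m)). \<Phi> z \<in> S \<inter> F (Suc m)}}"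
            by simp
        qed auto
      qed auto
    qed
  qed
  have "cellular_action G X \<alpha> E dim char act"
  proof (rule cellular_action.intro, fold sk_def)
    show "group G" by (rule G)
    show "continuous_map X X (\<alpha> g)" if "g \<in> carrier G" for g using X(2) that .
    show "\<alpha> \<one>\<^bsub>G\<^esub> x = x" if "x \<in> topspace X" for x
      using group_action.id_eq_one[OF X(1)] that by (metis restrict_apply')
    show "\<alpha> (g \<otimes>\<^bsub>G\<^esub> h) x = \<alpha> g (\<alpha> h x)" if "g \<in> carrier G" "h \<in> carrier G" "x \<in> topspace X" for g h x
      using group_action.composition_rule[OF X(1)] that by simp
    show "continuous_map (disc (dim e)) X (char e)" if "e \<in> E" for e
      using continuous_map_into_fulltopology[OF char_cont[OF that]] .
    show "char e ` disc_boundary (dim e) \<subseteq> sk (dim e)" if "e \<in> E" for e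
      using char_bd[OF that] by (simp add: sk_F)
    show "topspace X \<subseteq> (\<Union>e\<in>E. char e ` disc_interior (dim e))"
    proof
      fix y assume "y \<in> topspace X"
      then obtain n where "y \<in> sk n" using F_cover by (auto simp: sk_F)
      then show "y \<in> (\<Union>e\<in>E. char e ` disc_interior (dim e))" unfolding sk_def by auto
    qed
    show "closedin X S" if "S \<subseteq> sk n" "\<And>e. e \<in> E \<Longrightarrow> dim e < n \<Longrightarrow>
        closedin (disc (dim e)) {a \<in> topspace (disc (dim e)). char e a \<in> S}" for S n
      using that closed_F[of S n] by (simp add: sk_F)
    show "closedin X S" if "S \<subseteq> topspace X" "\<And>n. closedin X (S \<inter> sk n)" for S
      using that(2) by (intro F_colim[OF that(1)] closedin_subset_topspace) (auto simp: sk_F)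
    show "e = e' \<and> a = a'"
      if e: "e \<in> E" "e' \<in> E" "a \<in> disc_interior (dim e)" "a' \<in> disc_interior (dim e')" "char e a = char e' a'"
      for e e' a a'
    proof -
      let ?y = "char e a"
      have y: "?y \<in> F (Suc (dim e)) - F (dim e)" "?y \<in> F (Suc (dim e')) - F (dim e')"
        using char_int[OF e(1)] char_int[OF e(2)] e(3-5) by auto
      have "dim e = dim e'"
      proof (rule ccontr)
        assume "dim e \<noteq> dim e'"
        then have "Suc (dim e) \<le> dim e' \<or> Suc (dim e') \<le> dim e" by linarith
        then show False using y F_mono by blast
      qed
      then obtain n H \<Phi> c H' \<Phi>' c' where eq: "e = (n, H, \<Phi>, c)" "e' = (n, H', \<Phi>', c')"
        by (cases e; cases e') (auto simp: dim)
      have "inj_on (\<lambda>((H, \<Phi>), z). \<Phi> z) (SIGMA (H, \<Phi>):C n. (lcosets\<^bsub>G\<^esub> H) \<times> disc_interior n)"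
        using C_bij[of n] by (simp add: bij_betw_def)
      from inj_onD[OF this, of "((H, \<Phi>), (c, a))" "((H', \<Phi>'), (c', a'))"]
      show ?thesis using e by (simp add: eq mem_E dim char)
    qed
    show "act g e \<in> E" if g: "g \<in> carrier G" and e: "e \<in> E" for g e
    proof -
      obtain n H \<Phi> c where e_eq: "e = (n, H, \<Phi>, c)" by (cases e)
      have H\<Phi>: "(H, \<Phi>) \<in> C n" and "c \<in> lcosets\<^bsub>G\<^esub> H" using e by (simp_all add: e_eq mem_E)
      then obtain x where x: "x \<in> carrier G" "c = x <#\<^bsub>G\<^esub> H" by (auto simp: LCOSETS_def)
      have "g <#\<^bsub>G\<^esub> c = (g \<otimes>\<^bsub>G\<^esub> x) <#\<^bsub>G\<^esub> H"
        using group.lcos_m_assoc[OF G subgroup.subset[OF C_sub[OF H\<Phi>]] g x(1)] x(2) by simp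
      moreover have "g \<otimes>\<^bsub>G\<^esub> x \<in> carrier G"
        using subgroup.m_closed[OF group.subgroup_self[OF G] g x(1)] .
      ultimately show ?thesis using H\<Phi> by (auto simp: e_eq act mem_E LCOSETS_def)
    qed
    show "dim (act g e) = dim e" for g e by (cases e) (simp add: dim act)
    show "char (act g e) a = \<alpha> g (char e a)"
      if "g \<in> carrier G" "e \<in> E" "a \<in> topspace (disc (dim e))" for g e a
    proof -
      obtain n H \<Phi> c where e_eq: "e = (n, H, \<Phi>, c)" by (cases e)
      then have "(H, \<Phi>) \<in> C n" "c \<in> lcosets\<^bsub>G\<^esub> H" "a \<in> topspace (disc n)"
        using that by (simp_all add: mem_E dim)
      then show ?thesis using C_equiv[of H \<Phi> n g c a] that(1) by (simp add: e_eq char act)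
    qed
  qed
  then show ?thesis by (intro exI)
qed

section \<open>Equivariant maps into weakly contractible spaces\<close>

context cellular_action
begin

text \<open>By \<open>trivial\<close> the stabilizers of cells act as the identity on
  \<open>V\<close>, so every fixed set in the extension problem is \<open>V\<close> itself. In the
  applications, stabilizers in \<open>Y\<close> vanish in the quotient by torsion, and
  \<open>Z\<close> is free.\<close>

lemma
  fixes V :: "'v topology" and \<gamma> :: "'g \<Rightarrow> 'v \<Rightarrow> 'v"
  assumes cont: "\<And>g. g \<in> carrier G \<Longrightarrow> continuous_map V V (\<gamma> g)"
    and mult: "\<And>g h v. g \<in> carrier G \<Longrightarrow> h \<in> carrier G \<Longrightarrow> v \<in> topspace V \<Longrightarrow>
      \<gamma> (g \<otimes>\<^bsub>G\<^esub> h) v = \<gamma> g (\<gamma> h v)"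
    and V: "compactly_contractible V"
    and trivial: "\<And>g e v. g \<in> carrier G \<Longrightarrow> e \<in> E \<Longrightarrow> act g e = e \<Longrightarrow> v \<in> topspace V \<Longrightarrow> \<gamma> g v = v"
  shows equivariant_map_exists: "\<exists>f. continuous_map X V f \<and>
      (\<forall>g\<in>carrier G. \<forall>x\<in>topspace X. f (\<alpha> g x) = \<gamma> g (f x))"
    and equivariant_homotopy_exists: "\<And>f\<^sub>0 f\<^sub>1. continuous_map X V f\<^sub>0 \<Longrightarrow> continuous_map X V f\<^sub>1 \<Longrightarrow>
      (\<And>g x. g \<in> carrier G \<Longrightarrow> x \<in> topspace X \<Longrightarrow> f\<^sub>0 (\<alpha> g x) = \<gamma> g (f\<^sub>0 x)) \<Longrightarrow>
      (\<And>g x. g \<in> carrier G \<Longrightarrow> x \<in> topspace X \<Longrightarrow> f\<^sub>1 (\<alpha> g x) = \<gamma> g (f\<^sub>1 x)) \<Longrightarrow>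
      \<exists>h. continuous_map (prod_topology (top_of_set {0..1::real}) X) V h \<and>
        (\<forall>x\<in>topspace X. h (0, x) = f\<^sub>0 x \<and> h (1, x) = f\<^sub>1 x) \<and>
        (\<forall>g\<in>carrier G. \<forall>t\<in>{0..1}. \<forall>x\<in>topspace X. h (t, \<alpha> g x) = \<gamma> g (h (t, x)))"
proof -
  have carrier: "subgroup (carrier G) G" by (rule group.subgroup_self[OF grp])
  have fixed: "{v \<in> topspace V. \<forall>g\<in>carrier G. act g e = e \<longrightarrow> \<gamma> g v = v} = topspace V" if "e \<in> E" for e
    using trivial that by auto
  have ext: "equivariant_extension G X \<alpha> E dim char act (carrier G) V \<gamma> J J\<^sub>0 h\<^sub>0"
    if J: "compact J" "closed J\<^sub>0" "J\<^sub>0 \<subseteq> J" "extends_over_cells J J\<^sub>0 V"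
      and h\<^sub>0: "continuous_map (prod_topology (top_of_set J\<^sub>0) X) V h\<^sub>0"
        "\<And>g t x. g \<in> carrier G \<Longrightarrow> t \<in> J\<^sub>0 \<Longrightarrow> x \<in> topspace X \<Longrightarrow> h\<^sub>0 (t, \<alpha> g x) = \<gamma> g (h\<^sub>0 (t, x))"
    for J J\<^sub>0 h\<^sub>0
    by (rule equivariant_extension.intro[OF cellular_action_axioms],
        rule equivariant_extension_axioms.intro)
      (use carrier cont mult J h\<^sub>0 in \<open>simp_all add: fixed\<close>)
  \<comment> \<open>A map is a family over the one-point set \<open>{0}\<close> with empty initial
    data, so the value \<open>undefined\<close> is never consulted.\<close>
  have "equivariant_extension G X \<alpha> E dim char act (carrier G) V \<gamma> {0} {} (\<lambda>_. undefined)"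
    by (rule ext) (use extends_over_cells_point[OF V] in \<open>auto simp: continuous_map_def\<close>)
  then have "\<exists>h. continuous_map (prod_topology (top_of_set {0::real}) X) V h \<and>
      (\<forall>g\<in>carrier G. \<forall>t\<in>{0}. \<forall>x\<in>topspace X. h (t, \<alpha> g x) = \<gamma> g (h (t, x)))"
    using equivariant_extension.extension_exists by blast
  then obtain h where h: "continuous_map (prod_topology (top_of_set {0::real}) X) V h"
    "\<And>g x. g \<in> carrier G \<Longrightarrow> x \<in> topspace X \<Longrightarrow> h (0, \<alpha> g x) = \<gamma> g (h (0, x))" by auto
  have "continuous_map X V (h \<circ> Pair 0)"
    by (rule continuous_map_o_Pair[OF h(1)]) simp
  then show "\<exists>f. continuous_map X V f \<and> (\<forall>g\<in>carrier G. \<forall>x\<in>topspace X. f (\<alpha> g x) = \<gamma> g (f x))"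
    using h(2) by (intro exI[of _ "h \<circ> Pair 0"]) simp
  fix f\<^sub>0 f\<^sub>1
  assume f: "continuous_map X V f\<^sub>0" "continuous_map X V f\<^sub>1"
    "\<And>g x. g \<in> carrier G \<Longrightarrow> x \<in> topspace X \<Longrightarrow> f\<^sub>0 (\<alpha> g x) = \<gamma> g (f\<^sub>0 x)"
    "\<And>g x. g \<in> carrier G \<Longrightarrow> x \<in> topspace X \<Longrightarrow> f\<^sub>1 (\<alpha> g x) = \<gamma> g (f\<^sub>1 x)"
  let ?h\<^sub>0 = "\<lambda>(t::real, x). if t = 0 then f\<^sub>0 x else f\<^sub>1 x"
  have "equivariant_extension G X \<alpha> E dim char act (carrier G) V \<gamma> {0..1} {0, 1} ?h\<^sub>0"
    by (rule ext) (use extends_over_cells_interval[OF V] continuous_map_two_points[OF f(1,2)] f(3,4) in auto)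
  from equivariant_extension.extension_exists[OF this]
  show "\<exists>h. continuous_map (prod_topology (top_of_set {0..1::real}) X) V h \<and>
        (\<forall>x\<in>topspace X. h (0, x) = f\<^sub>0 x \<and> h (1, x) = f\<^sub>1 x) \<and>
        (\<forall>g\<in>carrier G. \<forall>t\<in>{0..1}. \<forall>x\<in>topspace X. h (t, \<alpha> g x) = \<gamma> g (h (t, x)))"
    by (elim ex_forward) simp
qed

lemma proj_carrier: "proj (carrier G) = orbit G \<alpha>"
  by (simp add: orbit_def fun_eq_iff)

lemma orbit_eq_iff:
  assumes "x \<in> topspace X" "y \<in> topspace X"
  shows "orbit G \<alpha> x = orbit G \<alpha> y \<longleftrightarrow> (\<exists>g\<in>carrier G. y = \<alpha> g x)"
  using proj_eq_iff[OF group.subgroup_self[OF grp] assms] by (simp only: proj_carrier)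

lemma stabilizer_cell_subset:
  assumes "e \<in> E"
  shows "{g \<in> carrier G. act g e = e} \<subseteq> stabilizer G \<alpha> (char e (\<lambda>_. 0))"
  using stabilizer_cell_fixes[OF _ assms, of _ "\<lambda>_. 0"] interior_disc[OF zero_in_disc_interior]
  by (auto simp: stabilizer_def)

lemma char_zero_topspace: "e \<in> E \<Longrightarrow> char e (\<lambda>_. 0) \<in> topspace X"
  using char_topspace interior_disc[OF zero_in_disc_interior] by simp

text \<open>Points of the quotient are subsets of \<open>X\<close>, so \<open>G\<close> can act on
  them by images; normality of \<open>T\<close> makes the image of an orbit an orbit,
  \<open>g T x = T g x\<close>.\<close>

lemma
  assumes T: "T \<lhd> G" and g: "g \<in> carrier G"
  shows image_proj: "x \<in> topspace X \<Longrightarrow> \<alpha> g ` proj T x = proj T (\<alpha> g x)"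
    and image_continuous: "continuous_map (quot T) (quot T) ((`) (\<alpha> g))"
proof -
  have TG: "t \<in> carrier G" if "t \<in> T" for t
    using subgroup.mem_carrier[OF normal_imp_subgroup[OF T] that] .
  have inv: "inv\<^bsub>G\<^esub> g \<in> carrier G" using g group.inv_closed[OF grp] by simp
  show image: "\<alpha> g ` proj T x = proj T (\<alpha> g x)" if x: "x \<in> topspace X" for x
  proof -
    interpret group G by (rule grp)
    show ?thesis
      unfolding proj_eq_image image_image
    proof (intro equalityI subsetI)
      fix z assume "z \<in> (\<lambda>t. \<alpha> g (\<alpha> t x)) ` T"
      then obtain t where t: "t \<in> T" "z = \<alpha> g (\<alpha> t x)" by auto
      let ?s = "g \<otimes>\<^bsub>G\<^esub> t \<otimes>\<^bsub>G\<^esub> inv\<^bsub>G\<^esub> g"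
      have s: "?s \<in> T" using normal.inv_op_closed2[OF T g t(1)] .
      have "\<alpha> ?s (\<alpha> g x) = \<alpha> (?s \<otimes>\<^bsub>G\<^esub> g) x" using action_mult[OF TG[OF s] g x] by simp
      also have "?s \<otimes>\<^bsub>G\<^esub> g = g \<otimes>\<^bsub>G\<^esub> t" using g TG[OF t(1)] by (simp add: m_assoc)
      finally have "z = \<alpha> ?s (\<alpha> g x)" using action_mult[OF g TG[OF t(1)] x] t(2) by simp
      then show "z \<in> (\<lambda>t. \<alpha> t (\<alpha> g x)) ` T" using s by (rule image_eqI)
    next
      fix z assume "z \<in> (\<lambda>t. \<alpha> t (\<alpha> g x)) ` T"
      then obtain t where t: "t \<in> T" "z = \<alpha> t (\<alpha> g x)" by auto
      let ?s = "inv\<^bsub>G\<^esub> g \<otimes>\<^bsub>G\<^esub> t \<otimes>\<^bsub>G\<^esub> g"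
      have s: "?s \<in> T" using normal.inv_op_closed1[OF T g t(1)] .
      have "\<alpha> g (\<alpha> ?s x) = \<alpha> (g \<otimes>\<^bsub>G\<^esub> ?s) x" using action_mult[OF g TG[OF s] x] by simp
      also have "g \<otimes>\<^bsub>G\<^esub> ?s = t \<otimes>\<^bsub>G\<^esub> g"
        using g TG[OF t(1)] by (simp add: m_assoc inv_cancel_left)
      finally have "z = \<alpha> g (\<alpha> ?s x)" using action_mult[OF TG[OF t(1)] g x] t(2) by simp
      then show "z \<in> (\<lambda>t. \<alpha> g (\<alpha> t x)) ` T" using s by (rule image_eqI)
    qed
  qed
  show "continuous_map (quot T) (quot T) ((`) (\<alpha> g))"
  proof (rule continuous_compose_quotient_map[OF quotient_map_proj])
    have "continuous_map X (quot T) (proj T \<circ> \<alpha> g)"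
      by (rule continuous_map_compose[OF action_continuous[OF g]
            quotient_imp_continuous_map[OF quotient_map_proj]])
    then show "continuous_map X (quot T) ((`) (\<alpha> g) \<circ> proj T)"
      by (rule continuous_map_eq) (simp add: image)
  qed
qed

end

lemma homotopic_with_descends:
  assumes q: "quotient_map X X' q"
    and h: "continuous_map (prod_topology (top_of_set {0..1::real}) X) V h"
    and compat: "\<And>t x y. t \<in> {0..1} \<Longrightarrow> x \<in> topspace X \<Longrightarrow> y \<in> topspace X \<Longrightarrow> q x = q y \<Longrightarrow>
      h (t, x) = h (t, y)"
    and ends: "\<And>x. x \<in> topspace X \<Longrightarrow> h (0, x) = f\<^sub>0 (q x)" "\<And>x. x \<in> topspace X \<Longrightarrow> h (1, x) = f\<^sub>1 (q x)"
  shows "homotopic_with (\<lambda>_. True) X' V f\<^sub>0 f\<^sub>1"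
proof -
  have "\<exists>h'. continuous_map (prod_topology (top_of_set {0..1::real}) X') V h' \<and>
      (\<forall>t\<in>{0..1}. \<forall>x\<in>topspace X. h' (t, q x) = h (t, x))"
    by (rule homotopy_descends[OF q h compat])
  then obtain h' where h': "continuous_map (prod_topology (top_of_set {0..1::real}) X') V h'"
    "\<And>t x. t \<in> {0..1} \<Longrightarrow> x \<in> topspace X \<Longrightarrow> h' (t, q x) = h (t, x)"
    by auto
  have surj: "topspace X' = q ` topspace X" using quotient_imp_surjective_map[OF q] by simp
  show ?thesis
    by (subst homotopic_with) (use h' ends surj in \<open>auto intro!: exI[of _ h']\<close>)
qed

theorem corollary5p5:
  fixes G :: "('g, 'm) monoid_scheme"
    and Y :: "'y topology" and \<alpha> :: "'g \<Rightarrow> 'y \<Rightarrow> 'y"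
    and W :: "'x topology"
    and Z :: "'z topology" and \<beta> :: "'g set \<Rightarrow> 'z \<Rightarrow> 'z"
  assumes "group G"
    and "normalizer_condition G"
    and "\<And>p::nat. Factorial_Ring.prime p \<Longrightarrow> locally_finite_subgroup G (p_torsion G p)"
    and "proper_EG_model G Y \<alpha>"
    and "finite_dim_CW_complex W"
    and "W homotopy_equivalent_space orbit_space G Y \<alpha>"
    and "EG_model (G Mod torsion G) Z \<beta>"
  shows "orbit_space G Y \<alpha> homotopy_equivalent_space orbit_space (G Mod torsion G) Z \<beta>"
proof -
  define T where "T = torsion G"
  define Q where "Q = G Mod T"
  let ?c = "\<lambda>g. T #>\<^bsub>G\<^esub> g"
  have T: "T \<lhd> G" "locally_finite_subgroup G T"
    using group.torsion_normal_locally_finite[OF assms(1-3)] by (simp_all add: T_def)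
  have T_sub: "subgroup T G" by (rule normal_imp_subgroup[OF T(1)])
  have TG: "t \<in> carrier G" if "t \<in> T" for t using T_sub that by (rule subgroup.mem_carrier)
  have Q_group: "group Q" unfolding Q_def by (rule normal.factorgroup_is_group[OF T(1)])
  have c_Q: "?c g \<in> carrier Q" if "g \<in> carrier G" for g using that by (simp add: Q_def carrier_FactGroup)
  have c_mult: "?c (g \<otimes>\<^bsub>G\<^esub> h) = ?c g \<otimes>\<^bsub>Q\<^esub> ?c h" if "g \<in> carrier G" "h \<in> carrier G" for g h
    using normal.rcos_sum[OF T(1) that] by (simp add: Q_def)
  have c_T: "?c t = \<one>\<^bsub>Q\<^esub>" if "t \<in> T" for t
    using group.coset_join2[OF assms(1) TG[OF that] T_sub that] by (simp add: Q_def)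
  have one_T: "\<one>\<^bsub>G\<^esub> \<in> T" by (rule subgroup.one_closed[OF T_sub])
  have Q_cases: "\<exists>g\<in>carrier G. q = ?c g" if "q \<in> carrier Q" for q
    using that by (auto simp: Q_def carrier_FactGroup)

  have Y_CW: "G_CW_complex G Y \<alpha>"
    and Y_stab: "\<And>y. y \<in> topspace Y \<Longrightarrow> finite (stabilizer G \<alpha> y)"
    and Y_fix: "\<And>H. subgroup H G \<Longrightarrow> finite H \<Longrightarrow> fixed_points Y \<alpha> H \<noteq> {} \<and>
      contractible_space (subtopology Y (fixed_points Y \<alpha> H))"
    using assms(4) unfolding proper_EG_model_def by auto
  have Z_CW: "G_CW_complex Q Z \<beta>"
    and Z_stab: "\<And>z. z \<in> topspace Z \<Longrightarrow> stabilizer Q \<beta> z = {\<one>\<^bsub>Q\<^esub>}"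
    and Z_contr: "compactly_contractible Z"
    using assms(7) contractible_imp_compactly_contractible unfolding EG_model_def T_def[symmetric] Q_def[symmetric]
    by auto
  obtain E\<^sub>Y :: "(nat \<times> 'g set \<times> ('g set \<times> (nat \<Rightarrow> real) \<Rightarrow> 'y) \<times> 'g set) set"
    and dim\<^sub>Y char\<^sub>Y act\<^sub>Y where "cellular_action G Y \<alpha> E\<^sub>Y dim\<^sub>Y char\<^sub>Y act\<^sub>Y"
    using G_CW_complex_cellular_action[OF assms(1) Y_CW] by (elim exE)
  then interpret Y: cellular_action G Y \<alpha> E\<^sub>Y dim\<^sub>Y char\<^sub>Y act\<^sub>Y
    "\<lambda>n. \<Union>e\<in>{e \<in> E\<^sub>Y. dim\<^sub>Y e < n}. char\<^sub>Y e ` disc_interior (dim\<^sub>Y e)" by simp_all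
  obtain E\<^sub>Z :: "(nat \<times> 'g set set \<times> ('g set set \<times> (nat \<Rightarrow> real) \<Rightarrow> 'z) \<times> 'g set set) set"
    and dim\<^sub>Z char\<^sub>Z act\<^sub>Z where "cellular_action Q Z \<beta> E\<^sub>Z dim\<^sub>Z char\<^sub>Z act\<^sub>Z"
    using G_CW_complex_cellular_action[OF Q_group Z_CW] by (elim exE)
  then interpret Z: cellular_action Q Z \<beta> E\<^sub>Z dim\<^sub>Z char\<^sub>Z act\<^sub>Z
    "\<lambda>n. \<Union>e\<in>{e \<in> E\<^sub>Z. dim\<^sub>Z e < n}. char\<^sub>Z e ` disc_interior (dim\<^sub>Z e)" by simp_all

  have Y_cell_stab: "finite {g \<in> carrier G. act\<^sub>Y g e = e}" if "e \<in> E\<^sub>Y" for e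
    using finite_subset[OF Y.stabilizer_cell_subset[OF that] Y_stab[OF Y.char_zero_topspace[OF that]]] .
  \<comment> \<open>A finite stabilizer consists of torsion elements, so the stabilizers of cells of
    \<open>Y\<close> become trivial in \<open>Q\<close>.\<close>
  have Y_cell_T: "g \<in> T" if g: "g \<in> carrier G" and e: "e \<in> E\<^sub>Y" and fix_e: "act\<^sub>Y g e = e" for g e
  proof -
    have X: "group_action G (topspace Y) \<alpha>"
      using Y_CW unfolding G_CW_complex_def G_space_def by simp
    have y: "char\<^sub>Y e (\<lambda>_. 0) \<in> topspace Y" by (rule Y.char_zero_topspace[OF e])
    have "stabilizer G \<alpha> (char\<^sub>Y e (\<lambda>_. 0)) \<subseteq> torsion G"
      by (rule group.finite_subgroup_subset_torsion[OF assms(1)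
            group_action.stabilizer_subgroup[OF X y] Y_stab[OF y]])
    then show ?thesis using Y.stabilizer_cell_subset[OF e] g fix_e unfolding T_def by auto
  qed
  have Z_cell_one: "q = \<one>\<^bsub>Q\<^esub>" if "q \<in> carrier Q" "e \<in> E\<^sub>Z" "act\<^sub>Z q e = e" for q e
    using Z.stabilizer_cell_subset[OF that(2)] Z_stab[OF Z.char_zero_topspace[OF that(2)]] that by auto

  let ?V = "Y.quot T" and ?p = "Y.proj T"
  have V_contr: "compactly_contractible ?V"
    by (rule Y.quotient_compactly_contractible[OF Y_cell_stab T_sub T(2)
          contractible_imp_compactly_contractible])
      (use Y_fix in \<open>auto simp: fixed_points_def\<close>)
  have p_quot: "quotient_map Y ?V ?p" by (rule Y.quotient_map_proj)
  have p_cont: "continuous_map Y ?V ?p" by (rule quotient_imp_continuous_map[OF p_quot])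
  have V_top: "\<exists>y\<in>topspace Y. v = ?p y" if "v \<in> topspace ?V" for v
    using that unfolding Y.topspace_quot by auto
  have p_T: "?p (\<alpha> t y) = ?p y" if "t \<in> T" "y \<in> topspace Y" for t y
    using Y.proj_eq_iff[OF T_sub that(2), of "\<alpha> t y"] Y.action_closed[OF TG[OF that(1)] that(2)] that(1)
    by auto

  \<comment> \<open>A coset acts on \<open>Y/T\<close> through an arbitrary representative; two
    representatives differ by an element of \<open>T\<close>, which disappears under
    \<open>?p\<close>.\<close>
  define \<gamma> where "\<gamma> q = (`) (\<alpha> (SOME g. g \<in> carrier G \<and> q = ?c g))" for q
  have rep: "\<exists>g\<in>carrier G. q = ?c g \<and> \<gamma> q = (`) (\<alpha> g)" if "q \<in> carrier Q" for q
  proof -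
    have "\<exists>g. g \<in> carrier G \<and> q = ?c g" using Q_cases[OF that] by auto
    then have "(SOME g. g \<in> carrier G \<and> q = ?c g) \<in> carrier G \<and> q = ?c (SOME g. g \<in> carrier G \<and> q = ?c g)"
      by (rule someI_ex)
    then show ?thesis unfolding \<gamma>_def by (intro bexI[of _ "SOME g. g \<in> carrier G \<and> q = ?c g"]) simp_all
  qed
  have \<gamma>: "\<gamma> (?c g) (?p y) = ?p (\<alpha> g y)" if g: "g \<in> carrier G" and y: "y \<in> topspace Y" for g y
  proof -
    obtain h where h: "h \<in> carrier G" "?c g = ?c h" "\<gamma> (?c g) = (`) (\<alpha> h)" using rep[OF c_Q[OF g]] by auto
    have "h \<in> ?c g"
      using group.repr_independenceD[OF assms(1) T_sub h(1) h(2)] .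
    then obtain t where t: "t \<in> T" "h = t \<otimes>\<^bsub>G\<^esub> g" by (auto simp: r_coset_def)
    have "\<gamma> (?c g) (?p y) = ?p (\<alpha> h y)" using h(3) Y.image_proj[OF T(1) h(1) y] by simp
    also have "\<alpha> h y = \<alpha> t (\<alpha> g y)" using Y.action_mult[OF TG[OF t(1)] g y] t(2) by simp
    also have "?p (\<alpha> t (\<alpha> g y)) = ?p (\<alpha> g y)" by (rule p_T[OF t(1) Y.action_closed[OF g y]])
    finally show ?thesis .
  qed
  have \<gamma>_cont: "continuous_map ?V ?V (\<gamma> q)" if "q \<in> carrier Q" for q
    using rep[OF that] Y.image_continuous[OF T(1)] by auto
  have \<gamma>_one: "\<gamma> \<one>\<^bsub>Q\<^esub> v = v" if v: "v \<in> topspace ?V" for v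
  proof -
    obtain y where y: "y \<in> topspace Y" "v = ?p y" using V_top[OF v] by auto
    then show ?thesis using \<gamma>[OF TG[OF one_T] y(1)] c_T[OF one_T] Y.action_one[OF y(1)] by simp
  qed
  have \<gamma>_mult: "\<gamma> (q \<otimes>\<^bsub>Q\<^esub> r) v = \<gamma> q (\<gamma> r v)"
    if q: "q \<in> carrier Q" and r: "r \<in> carrier Q" and v: "v \<in> topspace ?V" for q r v
  proof -
    obtain g h where g: "g \<in> carrier G" "q = ?c g" and h: "h \<in> carrier G" "r = ?c h"
      using Q_cases[OF q] Q_cases[OF r] by auto
    obtain y where y: "y \<in> topspace Y" "v = ?p y" using V_top[OF v] by auto
    have gh: "g \<otimes>\<^bsub>G\<^esub> h \<in> carrier G"
      by (rule subgroup.m_closed[OF group.subgroup_self[OF assms(1)] g(1) h(1)])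
    have "\<gamma> (q \<otimes>\<^bsub>Q\<^esub> r) v = ?p (\<alpha> (g \<otimes>\<^bsub>G\<^esub> h) y)"
      using \<gamma>[OF gh y(1)] c_mult[OF g(1) h(1)] g(2) h(2) y(2) by simp
    also have "\<dots> = \<gamma> q (?p (\<alpha> h y))"
      using \<gamma>[OF g(1) Y.action_closed[OF h(1) y(1)]] Y.action_mult[OF g(1) h(1) y(1)] g(2) by simp
    also have "?p (\<alpha> h y) = \<gamma> r v" using \<gamma>[OF h(1) y(1)] h(2) y(2) by simp
    finally show ?thesis .
  qed

  \<comment> \<open>\<open>Z\<close> is regarded as a space on which \<open>G\<close> acts through
    \<open>Q\<close>, so stabilizers of cells of \<open>Y\<close> act trivially on it.\<close>
  have "\<exists>f. continuous_map Y Z f \<and> (\<forall>g\<in>carrier G. \<forall>y\<in>topspace Y. f (\<alpha> g y) = \<beta> (?c g) (f y))"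
  proof (rule Y.equivariant_map_exists)
    show "continuous_map Z Z (\<beta> (?c g))" if "g \<in> carrier G" for g using Z.action_continuous[OF c_Q[OF that]] .
    show "\<beta> (?c (g \<otimes>\<^bsub>G\<^esub> h)) z = \<beta> (?c g) (\<beta> (?c h) z)"
      if "g \<in> carrier G" "h \<in> carrier G" "z \<in> topspace Z" for g h z
      using Z.action_mult[OF c_Q c_Q] c_mult that by simp
    show "\<beta> (?c g) z = z" if "g \<in> carrier G" "e \<in> E\<^sub>Y" "act\<^sub>Y g e = e" "z \<in> topspace Z" for g e z
      using c_T[OF Y_cell_T[OF that(1-3)]] Z.action_one[OF that(4)] by simp
  qed (rule Z_contr)
  then obtain f where f: "continuous_map Y Z f"
    "\<And>g y. g \<in> carrier G \<Longrightarrow> y \<in> topspace Y \<Longrightarrow> f (\<alpha> g y) = \<beta> (?c g) (f y)" by auto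
  have fZ: "f y \<in> topspace Z" if "y \<in> topspace Y" for y
    using continuous_map_funspace[OF f(1)] that by (auto simp: Pi_iff)

  have \<gamma>_trivial: "\<gamma> q v = v" if "q \<in> carrier Q" "e \<in> E\<^sub>Z" "act\<^sub>Z q e = e" "v \<in> topspace ?V" for q e v
    using Z_cell_one[OF that(1-3)] \<gamma>_one[OF that(4)] by simp
  \<comment> \<open>Stabilizers of cells of \<open>Z\<close> are trivial, so weak contractibility of
    \<open>?V\<close> is all that a map back requires.\<close>
  have "\<exists>f. continuous_map Z ?V f \<and> (\<forall>q\<in>carrier Q. \<forall>z\<in>topspace Z. f (\<beta> q z) = \<gamma> q (f z))"
    by (rule Z.equivariant_map_exists[OF \<gamma>_cont \<gamma>_mult V_contr \<gamma>_trivial])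
  then obtain s where s: "continuous_map Z ?V s"
    "\<And>q z. q \<in> carrier Q \<Longrightarrow> z \<in> topspace Z \<Longrightarrow> s (\<beta> q z) = \<gamma> q (s z)" by auto
  have sV: "s z \<in> topspace ?V" if "z \<in> topspace Z" for z
    using continuous_map_funspace[OF s(1)] that by (auto simp: Pi_iff)

  have f_T: "f x = f y" if xy: "x \<in> topspace Y" "y \<in> topspace Y" "?p x = ?p y" for x y
  proof -
    obtain t where t: "t \<in> T" "y = \<alpha> t x" using Y.proj_eq_iff[OF T_sub xy(1,2)] xy(3) by auto
    then show ?thesis using f(2)[OF TG[OF t(1)] xy(1)] c_T[OF t(1)] Z.action_one[OF fZ[OF xy(1)]] by simp
  qed
  have "\<exists>f'. continuous_map ?V Z f' \<and> (\<forall>y\<in>topspace Y. f' (?p y) = f y)"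
    by (rule quotient_map_lift[OF p_quot f(1) f_T])
  then obtain f' where f': "continuous_map ?V Z f'" "\<And>y. y \<in> topspace Y \<Longrightarrow> f' (?p y) = f y" by auto
  have f'_equiv: "f' (\<gamma> q v) = \<beta> q (f' v)" if q: "q \<in> carrier Q" and v: "v \<in> topspace ?V" for q v
  proof -
    obtain g y where g: "g \<in> carrier G" "q = ?c g" and y: "y \<in> topspace Y" "v = ?p y"
      using Q_cases[OF q] V_top[OF v] by auto
    have "f' (\<gamma> q v) = f (\<alpha> g y)"
      using \<gamma>[OF g(1) y(1)] f'(2)[OF Y.action_closed[OF g(1) y(1)]] g(2) y(2) by simp
    then show ?thesis using f(2)[OF g(1) y(1)] f'(2)[OF y(1)] g(2) y(2) by simp
  qed

  let ?PY = "orbit G \<alpha>" and ?PZ = "orbit Q \<beta>"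
  let ?BY = "orbit_space G Y \<alpha>" and ?BZ = "orbit_space Q Z \<beta>"
  have PY: "quotient_map Y ?BY ?PY" and PZ: "quotient_map Z ?BZ ?PZ" by (rule quotient_map_orbit)+
  have PY_cont: "continuous_map Y ?BY ?PY" and PZ_cont: "continuous_map Z ?BZ ?PZ"
    using quotient_imp_continuous_map PY PZ by auto
  have PZ_act: "?PZ (\<beta> q z) = ?PZ z" if "q \<in> carrier Q" "z \<in> topspace Z" for q z
    using Z.orbit_eq_iff[OF that(2) Z.action_closed[OF that]] that(1) by auto
  have PY_act: "?PY (\<alpha> g y) = ?PY y" if "g \<in> carrier G" "y \<in> topspace Y" for g y
    using Y.orbit_eq_iff[OF that(2) Y.action_closed[OF that]] that(1) by auto

  \<comment> \<open>The remaining part of the projection to \<open>Y/G\<close>; it turns maps and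
    homotopies with values in \<open>Y/T\<close> into ones with values in
    \<open>Y/G\<close>.\<close>
  have "\<exists>\<rho>. continuous_map ?V ?BY \<rho> \<and> (\<forall>y\<in>topspace Y. \<rho> (?p y) = ?PY y)"
  proof (rule quotient_map_lift[OF p_quot PY_cont])
    fix x y assume xy: "x \<in> topspace Y" "y \<in> topspace Y" "?p x = ?p y"
    obtain t where t: "t \<in> T" "y = \<alpha> t x" using Y.proj_eq_iff[OF T_sub xy(1,2)] xy(3) by auto
    then show "?PY x = ?PY y" using PY_act[OF TG[OF t(1)] xy(1)] by simp
  qed
  then obtain \<rho> where \<rho>: "continuous_map ?V ?BY \<rho>" "\<And>y. y \<in> topspace Y \<Longrightarrow> \<rho> (?p y) = ?PY y" by auto
  have \<rho>_\<gamma>: "\<rho> (\<gamma> q v) = \<rho> v" if q: "q \<in> carrier Q" and v: "v \<in> topspace ?V" for q v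
  proof -
    obtain g y where g: "g \<in> carrier G" "q = ?c g" and y: "y \<in> topspace Y" "v = ?p y"
      using Q_cases[OF q] V_top[OF v] by auto
    then show ?thesis
      using \<gamma>[OF g(1) y(1)] \<rho>(2)[OF Y.action_closed[OF g(1) y(1)]] \<rho>(2)[OF y(1)] PY_act[OF g(1) y(1)]
      by simp
  qed

  have "\<exists>a. continuous_map ?BY ?BZ a \<and> (\<forall>y\<in>topspace Y. a (?PY y) = (?PZ \<circ> f) y)"
  proof (rule quotient_map_lift[OF PY continuous_map_compose[OF f(1) PZ_cont]])
    fix x y assume xy: "x \<in> topspace Y" "y \<in> topspace Y" "?PY x = ?PY y"
    obtain g where g: "g \<in> carrier G" "y = \<alpha> g x" using Y.orbit_eq_iff[OF xy(1,2)] xy(3) by auto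
    then show "(?PZ \<circ> f) x = (?PZ \<circ> f) y" using f(2)[OF g(1) xy(1)] PZ_act[OF c_Q[OF g(1)] fZ[OF xy(1)]] by simp
  qed
  then obtain a where a: "continuous_map ?BY ?BZ a" "\<And>y. y \<in> topspace Y \<Longrightarrow> a (?PY y) = ?PZ (f y)" by auto
  have "\<exists>b. continuous_map ?BZ ?BY b \<and> (\<forall>z\<in>topspace Z. b (?PZ z) = (\<rho> \<circ> s) z)"
  proof (rule quotient_map_lift[OF PZ continuous_map_compose[OF s(1) \<rho>(1)]])
    fix x y assume xy: "x \<in> topspace Z" "y \<in> topspace Z" "?PZ x = ?PZ y"
    obtain q where q: "q \<in> carrier Q" "y = \<beta> q x" using Z.orbit_eq_iff[OF xy(1,2)] xy(3) by auto
    then show "(\<rho> \<circ> s) x = (\<rho> \<circ> s) y" using s(2)[OF q(1) xy(1)] \<rho>_\<gamma>[OF q(1) sV[OF xy(1)]] by simp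
  qed
  then obtain b where b: "continuous_map ?BZ ?BY b" "\<And>z. z \<in> topspace Z \<Longrightarrow> b (?PZ z) = \<rho> (s z)" by auto

  have a_\<rho>: "a (\<rho> v) = ?PZ (f' v)" if "v \<in> topspace ?V" for v
    using V_top[OF that] \<rho>(2) a(2) f'(2) by auto

  \<comment> \<open>\<open>f' \<circ> s\<close> and the identity are \<open>Q\<close>-maps into the
    contractible space \<open>Z\<close>, hence equivariantly homotopic.\<close>
  have "\<exists>h. continuous_map (prod_topology (top_of_set {0..1::real}) Z) Z h \<and>
        (\<forall>z\<in>topspace Z. h (0, z) = (f' \<circ> s) z \<and> h (1, z) = id z) \<and>
        (\<forall>q\<in>carrier Q. \<forall>t\<in>{0..1}. \<forall>z\<in>topspace Z. h (t, \<beta> q z) = \<beta> q (h (t, z)))"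
  proof (rule Z.equivariant_homotopy_exists)
    show "continuous_map Z Z (f' \<circ> s)" by (rule continuous_map_compose[OF s(1) f'(1)])
    show "(f' \<circ> s) (\<beta> q z) = \<beta> q ((f' \<circ> s) z)" if "q \<in> carrier Q" "z \<in> topspace Z" for q z
      using s(2)[OF that] f'_equiv[OF that(1) sV[OF that(2)]] by simp
    show "\<beta> q z = z" if "q \<in> carrier Q" "e \<in> E\<^sub>Z" "act\<^sub>Z q e = e" "z \<in> topspace Z" for q e z
      using Z_cell_one[OF that(1-3)] Z.action_one[OF that(4)] by simp
  qed (simp_all add: Z.action_continuous Z.action_mult Z_contr)
  then obtain h\<^sub>Z where h\<^sub>Z: "continuous_map (prod_topology (top_of_set {0..1::real}) Z) Z h\<^sub>Z"
    "\<And>z. z \<in> topspace Z \<Longrightarrow> h\<^sub>Z (0, z) = f' (s z)" "\<And>z. z \<in> topspace Z \<Longrightarrow> h\<^sub>Z (1, z) = z"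
    "\<And>q t z. q \<in> carrier Q \<Longrightarrow> t \<in> {0..1} \<Longrightarrow> z \<in> topspace Z \<Longrightarrow> h\<^sub>Z (t, \<beta> q z) = \<beta> q (h\<^sub>Z (t, z))"
    by auto
  have h\<^sub>Z_top: "h\<^sub>Z (t, z) \<in> topspace Z" if "t \<in> {0..1}" "z \<in> topspace Z" for t z
    using continuous_map_funspace[OF h\<^sub>Z(1)] that by (auto simp: Pi_iff)
  have "homotopic_with (\<lambda>_. True) ?BZ ?BZ (a \<circ> b) id"
  proof (rule homotopic_with_descends[OF PZ continuous_map_compose[OF h\<^sub>Z(1) PZ_cont]])
    fix t :: real and x y
    assume t: "t \<in> {0..1}" and xy: "x \<in> topspace Z" "y \<in> topspace Z" "?PZ x = ?PZ y"
    obtain q where q: "q \<in> carrier Q" "y = \<beta> q x" using Z.orbit_eq_iff[OF xy(1,2)] xy(3) by auto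
    then show "(?PZ \<circ> h\<^sub>Z) (t, x) = (?PZ \<circ> h\<^sub>Z) (t, y)"
      using h\<^sub>Z(4)[OF q(1) t xy(1)] PZ_act[OF q(1) h\<^sub>Z_top[OF t xy(1)]] by simp
  qed (simp_all add: h\<^sub>Z(2,3) b(2) a_\<rho> sV)

  \<comment> \<open>The homotopy lives on \<open>Y\<close>, whose cells are available for the
    extension. Composed with \<open>\<rho>\<close> it descends to \<open>Y/G\<close>, and its ends
    \<open>s \<circ> f\<close> and \<open>?p\<close> turn into \<open>b \<circ> a\<close> and the
    identity.\<close>
  have "\<exists>h. continuous_map (prod_topology (top_of_set {0..1::real}) Y) ?V h \<and>
        (\<forall>y\<in>topspace Y. h (0, y) = (s \<circ> f) y \<and> h (1, y) = ?p y) \<and>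
        (\<forall>g\<in>carrier G. \<forall>t\<in>{0..1}. \<forall>y\<in>topspace Y. h (t, \<alpha> g y) = \<gamma> (?c g) (h (t, y)))"
  proof (rule Y.equivariant_homotopy_exists)
    show "continuous_map ?V ?V (\<gamma> (?c g))" if "g \<in> carrier G" for g by (rule \<gamma>_cont[OF c_Q[OF that]])
    show "\<gamma> (?c (g \<otimes>\<^bsub>G\<^esub> h)) v = \<gamma> (?c g) (\<gamma> (?c h) v)"
      if "g \<in> carrier G" "h \<in> carrier G" "v \<in> topspace ?V" for g h v
      using \<gamma>_mult[OF c_Q[OF that(1)] c_Q[OF that(2)] that(3)] c_mult[OF that(1,2)] by simp
    show "\<gamma> (?c g) v = v" if "g \<in> carrier G" "e \<in> E\<^sub>Y" "act\<^sub>Y g e = e" "v \<in> topspace ?V" for g e v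
      using c_T[OF Y_cell_T[OF that(1-3)]] \<gamma>_one[OF that(4)] by simp
    show "continuous_map Y ?V (s \<circ> f)" by (rule continuous_map_compose[OF f(1) s(1)])
    show "(s \<circ> f) (\<alpha> g y) = \<gamma> (?c g) ((s \<circ> f) y)" if "g \<in> carrier G" "y \<in> topspace Y" for g y
      using f(2)[OF that] s(2)[OF c_Q[OF that(1)] fZ[OF that(2)]] by simp
    show "?p (\<alpha> g y) = \<gamma> (?c g) (?p y)" if "g \<in> carrier G" "y \<in> topspace Y" for g y
      using \<gamma>[OF that] by simp
  qed (rule V_contr p_cont)+
  then obtain h\<^sub>Y where h\<^sub>Y: "continuous_map (prod_topology (top_of_set {0..1::real}) Y) ?V h\<^sub>Y"
    "\<And>y. y \<in> topspace Y \<Longrightarrow> h\<^sub>Y (0, y) = s (f y)" "\<And>y. y \<in> topspace Y \<Longrightarrow> h\<^sub>Y (1, y) = ?p y"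
    "\<And>g t y. g \<in> carrier G \<Longrightarrow> t \<in> {0..1} \<Longrightarrow> y \<in> topspace Y \<Longrightarrow> h\<^sub>Y (t, \<alpha> g y) = \<gamma> (?c g) (h\<^sub>Y (t, y))"
    by auto
  have h\<^sub>Y_top: "h\<^sub>Y (t, y) \<in> topspace ?V" if "t \<in> {0..1}" "y \<in> topspace Y" for t y
    using continuous_map_funspace[OF h\<^sub>Y(1)] that by (auto simp: Pi_iff)
  have "homotopic_with (\<lambda>_. True) ?BY ?BY (b \<circ> a) id"
  proof (rule homotopic_with_descends[OF PY continuous_map_compose[OF h\<^sub>Y(1) \<rho>(1)]])
    fix t :: real and x y
    assume t: "t \<in> {0..1}" and xy: "x \<in> topspace Y" "y \<in> topspace Y" "?PY x = ?PY y"
    obtain g where g: "g \<in> carrier G" "y = \<alpha> g x" using Y.orbit_eq_iff[OF xy(1,2)] xy(3) by auto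
    then show "(\<rho> \<circ> h\<^sub>Y) (t, x) = (\<rho> \<circ> h\<^sub>Y) (t, y)"
      using h\<^sub>Y(4)[OF g(1) t xy(1)] \<rho>_\<gamma>[OF c_Q[OF g(1)] h\<^sub>Y_top[OF t xy(1)]] by simp
  qed (simp_all add: h\<^sub>Y(2,3) b(2) a(2) \<rho>(2) fZ)
  with \<open>homotopic_with (\<lambda>_. True) ?BZ ?BZ (a \<circ> b) id\<close> a(1) b(1)
  show ?thesis
    unfolding homotopy_equivalent_space_def Q_def[symmetric] T_def[symmetric] by (intro exI conjI)
qed

end
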